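(* Let $W$ be a superspace with homogeneous basis $w_i$, $i\in R_W$. (a) $S^\bullet(S^2(W))=\bigoplus_\lambda W^\lambda$ as a $\mathfrak{gl}(W)$-module, where $\lambda$ runs over the partitions all of whose rows have even length, each appearing with multiplicity one. (b) For such $\lambda\vdash 2k$, let $t$ be the $\lambda$-tableau filled consecutively along the rows with $1,2,\dots,2k$ (first row first). Then the polynomials $\mathrm{Pf}_t(I)$, where $I$ runs over the $t$-semistandard sequences of length $2k$ with entries in $R_W$, form a basis of $W^\lambda\subset S^k(S^2(W))$.
   Context: $S^2(W)$ is the supersymmetric square; $x_{ij}$ denotes the image of $w_i\otimes w_j$ in $S^2(W)\subset S^\bullet(S^2(W))$. For a sequence $I$ of length $2k$, $X(I)=x_{i_1i_2}x_{i_3i_4}\cdots x_{i_{2k-1}i_{2k}}$. $\mathfrak S_{2k}$ permutes positions of sequences; $c(I,\sigma)=\pm1$ is defined by $x_{\sigma^{-1}I}=c(I,\sigma)x_I$ in the free supercommutative algebra on generators $x_i$ of parity $p(i)$. With $R_t,C_t$ the row and column stabilizers and $\varepsilon$ the sign, $\mathrm{Pf}_t(I)=\sum_{\tau\in C_t,\sigma\in R_t}\varepsilon(\tau)c(I,(\sigma\tau)^{-1})X(\sigma\tau I)$. $W^\lambda$ is the irreducible $\mathfrak{gl}(W)$-module paired with the Specht module $S^\lambda$ in $W^{\otimes|\lambda|}$ (zero if $\lambda$ is not in the $(p|q)$-hook, $\dim W=(p|q)$). A sequence is $t$-semistandard if, placing its $\alpha$-th entry in the cell containing $\alpha$, entries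 weakly increase along rows and down columns, even indices strictly increase down columns and odd indices strictly increase along rows (even indices precede odd ones). *)

theory Defs
  imports Complex_Main "HOL-Combinatorics.Permutations" "HOL-Library.Multiset"
    "HOL-Library.Product_Lexorder" "HOL-Library.Function_Algebras"
begin

text \<open>Conventions.  The superspace W has dimension (p|q) and homogeneous basis
 w_0, ..., w_(p+q-1); w_i is even for i < p and odd for p <= i (so even indices precede
 odd ones).  Ground field: complex numbers.  Sequences of length n are nat lists;
 positions are 0-based (position alpha corresponds to the paper's alpha+1).\<close>

definition oddi :: "nat \<Rightarrow> nat \<Rightarrow> bool" where
  "oddi p i \<longleftrightarrow> p \<le> i"

definition smul :: "complex \<Rightarrow> ('x \<Rightarrow> complex) \<Rightarrow> ('x \<Rightarrow> complex)" where
  "smul c f = (\<lambda>x. c * f x)"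

definition seqs :: "nat \<Rightarrow> nat \<Rightarrow> nat \<Rightarrow> nat list set" where
  "seqs p q n = {I. length I = n \<and> set I \<subseteq> {..<p+q}}"

definition pact :: "(nat \<Rightarrow> nat) \<Rightarrow> nat list \<Rightarrow> nat list" where
  "pact \<sigma> I = map (\<lambda>\<alpha>. I ! inv \<sigma> \<alpha>) [0..<length I]"

text \<open>c(I,sigma): x_(sigma^-1 I) = c(I,sigma) x_I in the free supercommutative algebra
 (Koszul sign; (sigma^-1 I)_alpha = I_(sigma alpha)).\<close>
definition csign :: "nat \<Rightarrow> nat list \<Rightarrow> (nat \<Rightarrow> nat) \<Rightarrow> complex" where
  "csign p I \<sigma> = (-1) ^ card {(\<alpha>,\<beta>). \<alpha> < \<beta> \<and> \<beta> < length I \<and> \<sigma> \<beta> < \<sigma> \<alpha>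
        \<and> oddi p (I ! \<sigma> \<alpha>) \<and> oddi p (I ! \<sigma> \<beta>)}"

text \<open>Elements are coefficient functions on monomials, a monomial being a multiset of
 normalised generators x_ij (i <= j); the monomial with sorted (lexicographic) factors
 is the basis element.  Generator x_ij has parity p(i)+p(j); x_ji = (-1)^(p(i)p(j)) x_ij.\<close>

definition gen_odd :: "nat \<Rightarrow> nat \<times> nat \<Rightarrow> bool" where
  "gen_odd p g \<longleftrightarrow> oddi p (fst g) \<noteq> oddi p (snd g)"

definition pairs_of :: "nat list \<Rightarrow> (nat \<times> nat) list" where
  "pairs_of J = map (\<lambda>a. (J ! (2*a), J ! (2*a+1))) [0..<length J div 2]"

definition npair :: "nat \<times> nat \<Rightarrow> nat \<times> nat" where
  "npair g = (if fst g \<le> snd g then g else (snd g, fst g))"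

definition pair_sign :: "nat \<Rightarrow> nat \<times> nat \<Rightarrow> complex" where
  "pair_sign p g = (if snd g < fst g \<and> oddi p (fst g) \<and> oddi p (snd g) then -1 else 1)"

text \<open>X(J) = x_(j1 j2) x_(j3 j4) ... \<close>
definition Xmon :: "nat \<Rightarrow> nat list \<Rightarrow> (nat \<times> nat) multiset \<Rightarrow> complex" where
  "Xmon p J = (let ys = map npair (pairs_of J) in
     if (\<exists>a<length ys. fst (ys!a) = snd (ys!a) \<and> oddi p (fst (ys!a)))
        \<or> (\<exists>a b. a < b \<and> b < length ys \<and> ys!a = ys!b \<and> gen_odd p (ys!a))
     then (\<lambda>m. 0)
     else (\<lambda>m. if m = mset ys then
              (\<Prod>g\<leftarrow>pairs_of J. pair_sign p g) *
              (-1) ^ card {(a,b). a < b \<and> b < length ys \<and> ys!b < ys!a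
                          \<and> gen_odd p (ys!a) \<and> gen_odd p (ys!b)}
            else 0))"

definition Sk :: "nat \<Rightarrow> nat \<Rightarrow> nat \<Rightarrow> ((nat \<times> nat) multiset \<Rightarrow> complex) set" where
  "Sk p q k = module.span smul (Xmon p ` seqs p q (2*k))"

section \<open>gl(W)-actions (by the elementary matrices E_ab, E_ab w_c = delta_bc w_a)\<close>

definition Esgn :: "nat \<Rightarrow> nat \<Rightarrow> nat \<Rightarrow> nat list \<Rightarrow> nat \<Rightarrow> complex" where
  "Esgn p a b J \<alpha> = (if oddi p a \<noteq> oddi p b
       then (-1) ^ card {\<gamma>. \<gamma> < \<alpha> \<and> oddi p (J ! \<gamma>)} else 1)"

text \<open>action on the tensor power W^{\<otimes>n} (elements: coefficient functions on sequences)\<close>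
definition Tact :: "nat \<Rightarrow> nat \<Rightarrow> nat \<Rightarrow> (nat list \<Rightarrow> complex) \<Rightarrow> (nat list \<Rightarrow> complex)" where
  "Tact p a b f = (\<lambda>J. \<Sum>\<alpha><length J. if J ! \<alpha> = a then Esgn p a b J \<alpha> * f (J[\<alpha> := b]) else 0)"

text \<open>E_ab applied to X(J): image of E_ab w_J\<close>
definition XE :: "nat \<Rightarrow> nat \<Rightarrow> nat \<Rightarrow> nat list \<Rightarrow> (nat \<times> nat) multiset \<Rightarrow> complex" where
  "XE p a b J = (\<Sum>\<alpha><length J. if J ! \<alpha> = b then smul (Esgn p a b J \<alpha>) (Xmon p (J[\<alpha> := a])) else 0)"

definition rep_mon :: "(nat \<times> nat) multiset \<Rightarrow> nat list" where
  "rep_mon m = concat (map (\<lambda>g. [fst g, snd g]) (sorted_list_of_multiset m))"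

text \<open>action on S(S^2 W) (superderivation extending the action on S^2 W); on finitely
 supported elements, f = sum_m f(m) X(rep m).\<close>
definition Pact :: "nat \<Rightarrow> nat \<Rightarrow> nat \<Rightarrow> ((nat \<times> nat) multiset \<Rightarrow> complex) \<Rightarrow> ((nat \<times> nat) multiset \<Rightarrow> complex)" where
  "Pact p a b f = (\<Sum>m | f m \<noteq> 0. smul (f m) (XE p a b (rep_mon m)))"

definition gl_submodule :: "nat \<Rightarrow> (nat \<Rightarrow> nat \<Rightarrow> ('y \<Rightarrow> complex) \<Rightarrow> ('y \<Rightarrow> complex)) \<Rightarrow> ('y \<Rightarrow> complex) set \<Rightarrow> bool" where
  "gl_submodule d act U \<longleftrightarrow> module.subspace smul U \<and>
     (\<forall>a<d. \<forall>b<d. \<forall>u\<in>U. act a b u \<in> U)"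

definition gl_iso :: "nat \<Rightarrow> (nat \<Rightarrow> nat \<Rightarrow> ('y \<Rightarrow> complex) \<Rightarrow> ('y \<Rightarrow> complex)) \<Rightarrow> ('y \<Rightarrow> complex) set
     \<Rightarrow> (nat \<Rightarrow> nat \<Rightarrow> ('z \<Rightarrow> complex) \<Rightarrow> ('z \<Rightarrow> complex)) \<Rightarrow> ('z \<Rightarrow> complex) set \<Rightarrow> bool" where
  "gl_iso d act1 U act2 V \<longleftrightarrow> (\<exists>\<phi>. bij_betw \<phi> U V
     \<and> (\<forall>u\<in>U. \<forall>v\<in>U. \<phi> (u + v) = \<phi> u + \<phi> v)
     \<and> (\<forall>c. \<forall>u\<in>U. \<phi> (smul c u) = smul c (\<phi> u))
     \<and> (\<forall>a<d. \<forall>b<d. \<forall>u\<in>U. \<phi> (act1 a b u) = act2 a b (\<phi> u)))"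

definition is_partition :: "nat list \<Rightarrow> bool" where
  "is_partition la \<longleftrightarrow> (\<forall>i. Suc i < length la \<longrightarrow> la ! Suc i \<le> la ! i) \<and> (\<forall>x\<in>set la. 0 < x)"

definition even_partitions :: "nat \<Rightarrow> nat list set" where
  "even_partitions n = {la. is_partition la \<and> sum_list la = n \<and> (\<forall>x\<in>set la. even x)}"

text \<open>t: the lambda-tableau filled consecutively along rows; position alpha (0-based)
 lies in row row_of lambda alpha and column col_of lambda alpha.\<close>
definition row_of :: "nat list \<Rightarrow> nat \<Rightarrow> nat" where
  "row_of la \<alpha> = (LEAST r. \<alpha> < sum_list (take (Suc r) la))"

definition col_of :: "nat list \<Rightarrow> nat \<Rightarrow> nat" where
  "col_of la \<alpha> = \<alpha> - sum_list (take (row_of la \<alpha>) la)"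

definition Rt :: "nat list \<Rightarrow> (nat \<Rightarrow> nat) set" where
  "Rt la = {\<sigma>. \<sigma> permutes {..<sum_list la} \<and> (\<forall>\<alpha><sum_list la. row_of la (\<sigma> \<alpha>) = row_of la \<alpha>)}"

definition Ct :: "nat list \<Rightarrow> (nat \<Rightarrow> nat) set" where
  "Ct la = {\<sigma>. \<sigma> permutes {..<sum_list la} \<and> (\<forall>\<alpha><sum_list la. col_of la (\<sigma> \<alpha>) = col_of la \<alpha>)}"

definition Pf :: "nat \<Rightarrow> nat list \<Rightarrow> nat list \<Rightarrow> (nat \<times> nat) multiset \<Rightarrow> complex" where
  "Pf p la I = (\<Sum>\<tau>\<in>Ct la. \<Sum>\<sigma>\<in>Rt la.
      smul (of_int (sign \<tau>) * csign p I (inv (\<sigma> \<circ> \<tau>))) (Xmon p (pact (\<sigma> \<circ> \<tau>) I)))"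

text \<open>W^lambda realised in W^{\<otimes>n} as the image of the Young symmetriser
 c_t = sum_(sigma in R_t, tau in C_t) eps(tau) sigma tau, where S_n acts on W^{\<otimes>n} with
 the Koszul sign: sigma w_I = c(I,sigma^-1) w_(sigma I).\<close>
definition delta :: "'x \<Rightarrow> 'x \<Rightarrow> complex" where
  "delta x = (\<lambda>y. if y = x then 1 else 0)"

definition young_vec :: "nat \<Rightarrow> nat list \<Rightarrow> nat list \<Rightarrow> nat list \<Rightarrow> complex" where
  "young_vec p la I = (\<Sum>\<tau>\<in>Ct la. \<Sum>\<sigma>\<in>Rt la.
      smul (of_int (sign \<tau>) * csign p I (inv (\<sigma> \<circ> \<tau>))) (delta (pact (\<sigma> \<circ> \<tau>) I)))"

definition Wlam :: "nat \<Rightarrow> nat \<Rightarrow> nat list \<Rightarrow> (nat list \<Rightarrow> complex) set" where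
  "Wlam p q la = module.span smul (young_vec p la ` seqs p q (sum_list la))"

definition semistandard :: "nat \<Rightarrow> nat \<Rightarrow> nat list \<Rightarrow> nat list \<Rightarrow> bool" where
  "semistandard p q la I \<longleftrightarrow> I \<in> seqs p q (sum_list la) \<and>
    (\<forall>\<alpha><sum_list la. \<forall>\<beta><sum_list la.
       (row_of la \<alpha> = row_of la \<beta> \<and> col_of la \<alpha> < col_of la \<beta> \<longrightarrow>
          I ! \<alpha> \<le> I ! \<beta> \<and> (oddi p (I ! \<alpha>) \<longrightarrow> I ! \<alpha> < I ! \<beta>)) \<and>
       (col_of la \<alpha> = col_of la \<beta> \<and> row_of la \<alpha> < row_of la \<beta> \<longrightarrow>
          I ! \<alpha> \<le> I ! \<beta> \<and> (\<not> oddi p (I ! \<alpha>) \<longrightarrow> I ! \<alpha> < I ! \<beta>)))"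

end

theory Submission
  imports Defs "HOL-Library.Poly_Mapping"
begin

text \<open>
  Write \<open>a\<close>, \<open>b\<close> for the row symmetriser and the column antisymmetriser of a shape with even rows, and \<open>e\<close> for the
  sum of the hyperoctahedral group \<open>H\<close>, the centraliser of the matching \<open>{2i, 2i+1}\<close> of positions. Up to the
  Koszul-signed place permutations, \<open>S\<^sup>k(S\<^sup>2 W)\<close> is the space of \<open>H\<close>-coinvariants of the tensor power, so projecting a
  tensor to it amounts to applying \<open>e\<close>, and \<open>Pf\<close> is the image of the Young symmetrised tensor \<open>a b w\<close>.

  In the group algebra \<open>a x b\<close> is a multiple of \<open>a b\<close>, and it vanishes if \<open>a\<close>, \<open>b\<close> belong to shapes in the wrong order. If
  \<open>h \<sigma> \<tau> = 1\<close> with \<open>h\<close> in \<open>H\<close> and \<open>\<sigma>\<close>, \<open>\<tau>\<close> a row and a column permutation, then \<open>\<tau>\<close> lies in \<open>H\<close> and hence is even; so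
  \<open>e a b\<close> has a positive coefficient at 1, and \<open>a e a b\<close> is a nonzero multiple of \<open>a b\<close>. Therefore the projection is
  injective on the image of \<open>a b\<close>, and the images for different shapes are independent by triangularity. They span
  because the elements \<open>e a b a e\<close> are independent and as many as the double cosets of \<open>H\<close>, which are
  classified by the cycle lengths of unions of two perfect matchings; so \<open>e\<close> is a combination of them.

  The semistandard basis of the image of \<open>a b\<close> follows from a leading term argument (independence) and from
  Garnir relations (spanning).
\<close>

section \<open>The group algebra of the permutations of the natural numbers\<close>

text \<open>The main obstacle is exhaustion: that the images fill \<open>Sk\<close>, each shape
  occurring once, is usually read off from complete reducibility and a character identity. Here it
  becomes one statement in the group algebra of S_2k, independent of \<open>p\<close> and
  \<open>q\<close>: e lies in the span of the elements e a b a e. The second a makes such an element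
  a positive multiple of x * star x with x = e a b, and over the reals star y * y vanishes only for
  y = 0; so it is nonzero without any semisimplicity theorem. This is why the group algebra is real
  although the modules are complex. Even rows enter because mates are then neighbouring cells of one
  row, so a column permutation in H acts alike on two adjacent columns. Shapes outside the hook need
  no separate case: no sequence is semistandard for them, and the basis statement then makes the
  module zero. Permutations of all natural numbers give one type for every degree. The group is
  written additively because the convolution product of polynomial mappings is taken over an
  additive, not necessarily commutative, monoid; \<open>symgrp n\<close> cuts out the
  degree.\<close>

typedef natperm = "{f :: nat \<Rightarrow> nat. bij f}" morphisms prm Natperm
  by (rule exI[of _ id]) simp

setup_lifting type_definition_natperm

instantiation natperm :: group_add
begin
lift_definition zero_natperm :: natperm is id by simp
lift_definition plus_natperm :: "natperm \<Rightarrow> natperm \<Rightarrow> natperm" is "(\<circ>)" by (rule bij_comp)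
lift_definition uminus_natperm :: "natperm \<Rightarrow> natperm" is inv by (rule bij_imp_bij_inv)
definition minus_natperm :: "natperm \<Rightarrow> natperm \<Rightarrow> natperm" where "minus_natperm g h = g + - h"
instance
proof
  fix g h k :: natperm
  show "g + h + k = g + (h + k)" by transfer (simp add: o_assoc)
  show "0 + g = g" by transfer simp
  show "g + 0 = g" by transfer simp
  show "- g + g = 0" by transfer (simp add: bij_is_inj)
  show "g + - h = g - h" by (simp add: minus_natperm_def)
qed
end

lemma bij_prm [simp]: "bij (prm g)"
  using prm by blast

lemma prm_zero [simp]: "prm 0 = id"
  by (rule zero_natperm.rep_eq)

lemma prm_plus [simp]: "prm (g + h) = prm g \<circ> prm h"
  by (rule plus_natperm.rep_eq)

lemma prm_uminus [simp]: "prm (- g) = inv (prm g)"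
  by (rule uminus_natperm.rep_eq)

lemma prm_uminus_prm [simp]: "inv (prm g) (prm g x) = x" "prm g (inv (prm g) x) = x"
  by (simp_all add: bij_is_inj bij_is_surj surj_f_inv_f)

lemma prm_Natperm: "f permutes S \<Longrightarrow> prm (Natperm f) = f"
  by (rule Natperm_inverse) (simp add: permutes_bij)

type_synonym galg = "natperm \<Rightarrow>\<^sub>0 real"

abbreviation sng :: "natperm \<Rightarrow> real \<Rightarrow> galg" where "sng \<equiv> Poly_Mapping.single"
abbreviation coef :: "galg \<Rightarrow> natperm \<Rightarrow> real" where "coef \<equiv> Poly_Mapping.lookup"
abbreviation supp :: "galg \<Rightarrow> natperm set" where "supp \<equiv> Poly_Mapping.keys"
abbreviation scal :: "real \<Rightarrow> galg" where "scal c \<equiv> sng 0 c"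

lemma galg_eq_sum: "finite S \<Longrightarrow> supp x \<subseteq> S \<Longrightarrow> (x :: galg) = (\<Sum>g\<in>S. sng g (coef x g))"
  by (rule poly_mapping_eqI)
     (auto simp: Poly_Mapping.lookup_sum lookup_single when_def not_in_keys_iff_lookup_eq_zero[symmetric])

lemma galg_sum: "(x :: galg) = (\<Sum>g\<in>supp x. sng g (coef x g))"
  by (rule galg_eq_sum) auto

lemma scal_commute: "scal c * x = x * (scal c :: galg)"
proof -
  have "scal c * sng g d = sng g d * scal c" for g d by (simp add: mult_single mult.commute)
  thus ?thesis by (subst (1 2) galg_sum[of x]) (simp add: sum_distrib_left sum_distrib_right)
qed

lemma scal_commute_left: "x * (scal c * y) = scal c * (x * (y :: galg))"
  by (metis mult.assoc scal_commute)

lemma coef_scal_mult: "coef (scal c * x) g = c * coef x g"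
proof -
  have "coef (scal c * sng h d) g = c * coef (sng h d) g" for h d
    by (simp add: mult_single lookup_single when_def)
  thus ?thesis by (subst (1 2) galg_sum[of x]) (simp add: sum_distrib_left Poly_Mapping.lookup_sum)
qed

lemma scal_mult_eq_0: "scal c * (x :: galg) = 0 \<Longrightarrow> c \<noteq> 0 \<Longrightarrow> x = 0"
  by (rule poly_mapping_eqI) (metis coef_scal_mult lookup_zero mult_eq_0_iff)

interpretation ga: vector_space "\<lambda>c (x :: galg). scal c * x"
  by unfold_locales (simp_all add: algebra_simps single_add mult_single flip: mult.assoc)

section \<open>The involution inverting permutations, and its positivity\<close>

definition star :: "galg \<Rightarrow> galg" where
  "star x = (\<Sum>g\<in>supp x. sng (- g) (coef x g))"

lemma coef_star: "coef (star x) g = coef x (- g)"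
proof -
  have "coef (star x) g = (\<Sum>h\<in>supp x. if h = - g then coef x h else 0)"
    unfolding star_def Poly_Mapping.lookup_sum lookup_single when_def
    by (rule sum.cong) (auto simp: minus_equation_iff[of _ g])
  thus ?thesis by (simp add: in_keys_iff)
qed

lemma star_sng: "star (sng g c) = sng (- g) c"
  by (rule poly_mapping_eqI) (auto simp: coef_star lookup_single when_def)

lemma star_sum: "star (\<Sum>i\<in>I. f i) = (\<Sum>i\<in>I. star (f i))"
  by (rule poly_mapping_eqI) (simp add: coef_star Poly_Mapping.lookup_sum)

lemma star_mult: "star (x * y) = star y * star x"
proof -
  have "star (x * y) = star ((\<Sum>g\<in>supp x. sng g (coef x g)) * (\<Sum>h\<in>supp y. sng h (coef y h)))"
    by (simp flip: galg_sum)
  also have "\<dots> = (\<Sum>h\<in>supp y. sng (- h) (coef y h)) * (\<Sum>g\<in>supp x. sng (- g) (coef x g))"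
    unfolding sum_product by (subst (2) sum.swap) (simp add: star_sum mult_single star_sng minus_add mult.commute)
  finally show ?thesis by (simp add: star_def)
qed

lemma star_star: "star (star x) = x"
  by (rule poly_mapping_eqI) (simp add: coef_star)

text \<open>The coefficient at the neutral element is the sum of the squares of the coefficients of
  \<open>x\<close>, which is positive over the reals.\<close>

lemma star_mult_self_nonzero:
  assumes "x \<noteq> 0" shows "star x * x \<noteq> 0"
proof -
  have "coef (star x * x) 0 = coef (star x * (\<Sum>g\<in>supp x. sng g (coef x g))) 0"
    by (simp flip: galg_sum)
  also have "\<dots> = (\<Sum>g\<in>supp x. \<Sum>h\<in>supp x. if h = g then coef x h * coef x g else 0)"
    unfolding star_def sum_product Poly_Mapping.lookup_sum mult_single lookup_single when_def
    by (subst sum.swap) (simp add: neg_eq_iff_add_eq_0[symmetric] cong: if_cong)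
  also have "\<dots> = (\<Sum>g\<in>supp x. (coef x g)^2)"
    by (simp add: power2_eq_square)
  also have "\<dots> > 0"
  proof (rule sum_pos)
    show "supp x \<noteq> {}" using assms by simp
  qed (auto simp: in_keys_iff)
  finally show ?thesis by auto
qed

text \<open>\<open>chsum S \<chi>\<close> is the unnormalised idempotent of the character \<open>\<chi>\<close> of the subgroup \<open>S\<close>.\<close>

definition chsum :: "natperm set \<Rightarrow> (natperm \<Rightarrow> real) \<Rightarrow> galg" where
  "chsum S \<chi> = (\<Sum>g\<in>S. sng g (\<chi> g))"

text \<open>Used with the sign for column groups and Garnir groups, and with the trivial character
  for row groups and the hyperoctahedral group.\<close>

locale signed_group =
  fixes S :: "natperm set" and \<chi> :: "natperm \<Rightarrow> real"
  assumes finite_S: "finite S" and zero_S: "0 \<in> S"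
    and plus_S: "g \<in> S \<Longrightarrow> h \<in> S \<Longrightarrow> g + h \<in> S"
    and uminus_S: "g \<in> S \<Longrightarrow> - g \<in> S"
    and hom: "g \<in> S \<Longrightarrow> h \<in> S \<Longrightarrow> \<chi> (g + h) = \<chi> g * \<chi> h"
    and pm: "g \<in> S \<Longrightarrow> \<chi> g = 1 \<or> \<chi> g = -1"
begin

lemma chi_sq: "g \<in> S \<Longrightarrow> \<chi> g * \<chi> g = 1"
  using pm[of g] by auto

lemma chi_zero: "\<chi> 0 = 1"
  using hom[OF zero_S zero_S] pm[OF zero_S] by auto

lemma chi_uminus: "g \<in> S \<Longrightarrow> \<chi> (- g) = \<chi> g"
  using hom[of g "- g"] pm[of g] pm[of "- g"] uminus_S chi_zero by auto

lemma left_mult: assumes "h \<in> S" shows "sng h 1 * chsum S \<chi> = scal (\<chi> h) * chsum S \<chi>"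
proof -
  have "sng h 1 * chsum S \<chi> = (\<Sum>g\<in>S. sng (h + g) (\<chi> g))"
    by (simp add: chsum_def sum_distrib_left mult_single)
  also have "\<dots> = (\<Sum>g\<in>S. sng g (\<chi> (- h + g)))"
    by (rule sum.reindex_bij_witness[of _ "\<lambda>g. - h + g" "\<lambda>g. h + g"])
       (use assms plus_S uminus_S in \<open>auto simp flip: add.assoc\<close>)
  also have "\<dots> = (\<Sum>g\<in>S. sng g (\<chi> h * \<chi> g))"
    by (rule sum.cong) (use assms hom uminus_S chi_uminus in auto)
  finally show ?thesis by (simp add: chsum_def sum_distrib_left mult_single)
qed

lemma right_mult: assumes "h \<in> S" shows "chsum S \<chi> * sng h 1 = scal (\<chi> h) * chsum S \<chi>"
proof -
  have "chsum S \<chi> * sng h 1 = (\<Sum>g\<in>S. sng (g + h) (\<chi> g))"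
    by (simp add: chsum_def sum_distrib_right mult_single)
  also have "\<dots> = (\<Sum>g\<in>S. sng g (\<chi> (g + - h)))"
    by (rule sum.reindex_bij_witness[of _ "\<lambda>g. g + - h" "\<lambda>g. g + h"])
       (use assms plus_S[of _ "- h"] plus_S uminus_S in \<open>auto simp: algebra_simps\<close>)
  also have "\<dots> = (\<Sum>g\<in>S. sng g (\<chi> h * \<chi> g))"
    by (rule sum.cong) (use assms hom[of _ "- h"] uminus_S chi_uminus in \<open>auto simp: mult.commute\<close>)
  finally show ?thesis by (simp add: chsum_def sum_distrib_left mult_single)
qed

lemma square: "chsum S \<chi> * chsum S \<chi> = scal (real (card S)) * chsum S \<chi>"
proof -
  have "chsum S \<chi> * chsum S \<chi> = (\<Sum>g\<in>S. scal (\<chi> g) * (sng g 1 * chsum S \<chi>))"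
    by (subst chsum_def) (simp add: sum_distrib_right mult_single flip: mult.assoc)
  also have "\<dots> = (\<Sum>g\<in>S. chsum S \<chi>)"
    by (rule sum.cong) (simp_all add: left_mult chi_sq mult_single flip: mult.assoc)
  finally show ?thesis by simp
qed

lemma star_chsum: "star (chsum S \<chi>) = chsum S \<chi>"
proof -
  have "star (chsum S \<chi>) = (\<Sum>g\<in>S. sng (- g) (\<chi> g))"
    by (simp add: chsum_def star_sum star_sng)
  also have "\<dots> = (\<Sum>g\<in>S. sng g (\<chi> g))"
    by (rule sum.reindex_bij_witness[of _ uminus uminus]) (use uminus_S chi_uminus in auto)
  finally show ?thesis by (simp add: chsum_def)
qed

lemma card_pos: "real (card S) > 0"
  using finite_S zero_S by (auto simp: card_gt_0_iff)

lemma keys_chsum: "supp (chsum S \<chi>) \<subseteq> S"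
  unfolding chsum_def using keys_sum[of _ S] by (force split: if_splits)

end

section \<open>Row and column groups\<close>

definition symgrp :: "nat \<Rightarrow> natperm set" where "symgrp n = {g. prm g permutes {..<n}}"
definition rowgrp :: "nat list \<Rightarrow> natperm set" where "rowgrp la = {g. prm g \<in> Rt la}"
definition colgrp :: "nat list \<Rightarrow> natperm set" where "colgrp la = {g. prm g \<in> Ct la}"
definition sg :: "natperm \<Rightarrow> real" where "sg g = of_int (sign (prm g))"

lemma inj_prm: "inj prm"
  by (simp add: inj_def prm_inject)

lemma finite_prm_vimage: "finite {f. P f} \<Longrightarrow> finite {g. P (prm g)}"
  using finite_vimageI[OF _ inj_prm, of "{f. P f}"] by (simp add: vimage_def)

lemma finite_symgrp: "finite (symgrp n)"
  unfolding symgrp_def by (rule finite_prm_vimage) (simp add: finite_permutations)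

lemma sg_hom: "g \<in> symgrp n \<Longrightarrow> h \<in> symgrp n \<Longrightarrow> sg (g + h) = sg g * sg h"
proof -
  assume "g \<in> symgrp n" "h \<in> symgrp n"
  hence "permutation (prm g)" "permutation (prm h)" by (auto simp: symgrp_def permutation_permutes)
  thus ?thesis by (simp add: sg_def sign_compose)
qed

lemma sg_pm: "sg g = 1 \<or> sg g = -1"
  by (cases "prm g" rule: sign_cases) (auto simp: sg_def)

text \<open>The row groups, the column groups and the full symmetric group are all instances: take
  \<open>row_of\<close>, \<open>col_of\<close> or a constant for \<open>\<kappa>\<close>.\<close>

lemma signed_group_preserving:
  "signed_group {g. prm g permutes {..<n} \<and> (\<forall>\<alpha><n. \<kappa> (prm g \<alpha>) = \<kappa> \<alpha>)} sg" (is "signed_group ?S sg")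
  "signed_group {g. prm g permutes {..<n} \<and> (\<forall>\<alpha><n. \<kappa> (prm g \<alpha>) = \<kappa> \<alpha>)} (\<lambda>_. 1)"
proof -
  have sub: "?S \<subseteq> symgrp n" by (auto simp: symgrp_def)
  have fin: "finite ?S" using sub finite_symgrp finite_subset by blast
  have plus: "g + h \<in> ?S" if "g \<in> ?S" "h \<in> ?S" for g h
    using that by (auto simp: permutes_compose permutes_in_image[of _ "{..<n}", simplified])
  have um: "- g \<in> ?S" if "g \<in> ?S" for g
  proof -
    have p: "inv (prm g) permutes {..<n}" using that by (auto intro: permutes_inv)
    have "\<kappa> (inv (prm g) \<alpha>) = \<kappa> \<alpha>" if "\<alpha> < n" for \<alpha>
      using \<open>g \<in> ?S\<close> permutes_in_image[OF p, of \<alpha>] that by (force dest: spec[of _ "inv (prm g) \<alpha>"])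
    with p show ?thesis by auto
  qed
  have zero: "0 \<in> ?S" by simp
  show "signed_group ?S sg"
  proof
    show "sg (g + h) = sg g * sg h" if "g \<in> ?S" "h \<in> ?S" for g h
      using that sub sg_hom by blast
  qed (use fin plus um zero sg_pm in blast)+
  show "signed_group ?S (\<lambda>_. 1)"
  proof
    show "finite ?S" by (rule fin)
    show "0 \<in> ?S" by (rule zero)
    show "g + h \<in> ?S" if "g \<in> ?S" "h \<in> ?S" for g h using that by (rule plus)
    show "- g \<in> ?S" if "g \<in> ?S" for g using that by (rule um)
  qed simp_all
qed

lemma symgrp_signed: "signed_group (symgrp n) sg"
  using signed_group_preserving(1)[of n "\<lambda>_. 0"] by (simp add: symgrp_def)

lemma rowgrp_signed: "signed_group (rowgrp la) (\<lambda>_. 1)"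
  using signed_group_preserving(2)[of "sum_list la" "row_of la"] by (simp add: rowgrp_def Rt_def)

lemma colgrp_signed: "signed_group (colgrp la) sg"
  using signed_group_preserving(1)[of "sum_list la" "col_of la"] by (simp add: colgrp_def Ct_def)

lemma rowgrp_sub: "rowgrp la \<subseteq> symgrp (sum_list la)" and colgrp_sub: "colgrp la \<subseteq> symgrp (sum_list la)"
  by (auto simp: rowgrp_def colgrp_def symgrp_def Rt_def Ct_def)

definition rowsym :: "nat list \<Rightarrow> galg" where "rowsym la = chsum (rowgrp la) (\<lambda>_. 1)"
definition colalt :: "nat list \<Rightarrow> galg" where "colalt la = chsum (colgrp la) sg"

interpretation symgrp: signed_group "symgrp n" sg for n by (rule symgrp_signed)
interpretation rowgrp: signed_group "rowgrp la" "\<lambda>_. 1" for la by (rule rowgrp_signed)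
interpretation colgrp: signed_group "colgrp la" sg for la by (rule colgrp_signed)

lemma symgrp_plus: "g \<in> symgrp n \<Longrightarrow> h \<in> symgrp n \<Longrightarrow> g + h \<in> symgrp n"
  and symgrp_uminus: "g \<in> symgrp n \<Longrightarrow> - g \<in> symgrp n"
  and symgrp_zero: "0 \<in> symgrp n"
  using symgrp.plus_S symgrp.uminus_S
    symgrp.zero_S by blast+

lemma symgrp_less: "g \<in> symgrp n \<Longrightarrow> prm g \<alpha> < n \<longleftrightarrow> \<alpha> < n" "g \<in> symgrp n \<Longrightarrow> inv (prm g) \<alpha> < n \<longleftrightarrow> \<alpha> < n"
  using permutes_in_image[of "prm g" "{..<n}"] permutes_in_image[of "inv (prm g)" "{..<n}"]
  by (auto simp: symgrp_def permutes_inv)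

section \<open>The cells of a shape\<close>

definition cell :: "nat list \<Rightarrow> nat \<Rightarrow> nat \<Rightarrow> nat" where "cell la r c = sum_list (take r la) + c"

lemma sum_list_take_mono: "r \<le> s \<Longrightarrow> sum_list (take r la) \<le> sum_list (take s (la :: nat list))"
  by (metis le_add1 le_iff_add sum_list_append take_add)

lemma sum_list_take_Suc: "r < length la \<Longrightarrow> sum_list (take (Suc r) la) = sum_list (take r la) + la ! r"
  for la :: "nat list"
  by (simp add: take_Suc_conv_app_nth)

lemma row_col:
  assumes "\<alpha> < sum_list la"
  shows row_less: "row_of la \<alpha> < length la" and col_less: "col_of la \<alpha> < la ! row_of la \<alpha>"
    and cell_row_col: "cell la (row_of la \<alpha>) (col_of la \<alpha>) = \<alpha>"
proof -
  let ?P = "\<lambda>r. \<alpha> < sum_list (take (Suc r) la)"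
  have ne: "la \<noteq> []" using assms by auto
  hence ex: "?P (length la - 1)" using assms by simp
  have P: "?P (row_of la \<alpha>)" unfolding row_of_def by (rule LeastI[of ?P, OF ex])
  have "row_of la \<alpha> \<le> length la - 1" unfolding row_of_def by (rule Least_le[of ?P, OF ex])
  thus r: "row_of la \<alpha> < length la" using ne by (cases la) auto
  have le: "sum_list (take (row_of la \<alpha>) la) \<le> \<alpha>"
  proof (cases "row_of la \<alpha>")
    case (Suc s)
    hence "\<not> ?P s" using not_less_Least[of s ?P] by (simp add: row_of_def)
    thus ?thesis using Suc by simp
  qed simp
  show "col_of la \<alpha> < la ! row_of la \<alpha>"
    using P le sum_list_take_Suc[OF r] by (simp add: col_of_def)
  show "cell la (row_of la \<alpha>) (col_of la \<alpha>) = \<alpha>"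
    using le by (simp add: cell_def col_of_def)
qed

lemma cell:
  assumes "r < length la" "c < la ! r"
  shows cell_less: "cell la r c < sum_list la" and row_cell: "row_of la (cell la r c) = r"
    and col_cell: "col_of la (cell la r c) = c"
proof -
  have "cell la r c < sum_list (take (Suc r) la)"
    using assms by (simp add: cell_def sum_list_take_Suc)
  moreover have "sum_list (take (Suc r) la) \<le> sum_list la"
    using sum_list_take_mono[of "Suc r" "length la" la] assms by simp
  ultimately show "cell la r c < sum_list la" by simp
  show row: "row_of la (cell la r c) = r"
    unfolding row_of_def
  proof (rule Least_equality)
    show "cell la r c < sum_list (take (Suc r) la)" by fact
  next
    fix s assume s: "cell la r c < sum_list (take (Suc s) la)"
    show "r \<le> s"
    proof (rule ccontr)
      assume "\<not> r \<le> s"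
      hence "sum_list (take (Suc s) la) \<le> sum_list (take r la)" by (intro sum_list_take_mono) simp
      thus False using s by (simp add: cell_def)
    qed
  qed
  show "col_of la (cell la r c) = c" by (simp add: col_of_def row) (simp add: cell_def)
qed

lemma row_col_inj:
  "\<alpha> < sum_list la \<Longrightarrow> \<beta> < sum_list la \<Longrightarrow> row_of la \<alpha> = row_of la \<beta> \<Longrightarrow> col_of la \<alpha> = col_of la \<beta> \<Longrightarrow> \<alpha> = \<beta>"
  by (metis cell_row_col)

section \<open>Counting cells by rows and columns; transversal permutations\<close>

lemma card_row:
  assumes "r < length la"
  shows "card {\<alpha>. \<alpha> < sum_list la \<and> row_of la \<alpha> = r \<and> Q (col_of la \<alpha>)} = card {c. c < la ! r \<and> Q c}"
proof -
  have "bij_betw (cell la r) {c. c < la ! r \<and> Q c} {\<alpha>. \<alpha> < sum_list la \<and> row_of la \<alpha> = r \<and> Q (col_of la \<alpha>)}"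
    by (rule bij_betw_byWitness[where f' = "col_of la"])
       (use cell[OF assms] row_col[of _ la] in \<open>force+\<close>)
  thus ?thesis by (simp add: bij_betw_same_card)
qed

lemma card_by_rows:
  "card {\<alpha>. \<alpha> < sum_list la \<and> Q \<alpha>} = (\<Sum>r<length la. card {\<alpha>. \<alpha> < sum_list la \<and> row_of la \<alpha> = r \<and> Q \<alpha>})"
proof -
  have "card (\<Union>r\<in>{..<length la}. {\<alpha>. \<alpha> < sum_list la \<and> row_of la \<alpha> = r \<and> Q \<alpha>}) =
     (\<Sum>r<length la. card {\<alpha>. \<alpha> < sum_list la \<and> row_of la \<alpha> = r \<and> Q \<alpha>})"
    by (rule card_UN_disjoint) auto
  moreover have "(\<Union>r\<in>{..<length la}. {\<alpha>. \<alpha> < sum_list la \<and> row_of la \<alpha> = r \<and> Q \<alpha>}) = {\<alpha>. \<alpha> < sum_list la \<and> Q \<alpha>}"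
    using row_less by auto
  ultimately show ?thesis by simp
qed

text \<open>These are the partial sums of the conjugate shape, so comparing them for all
  \<open>m\<close> compares the conjugate shapes in the dominance order.\<close>

definition colsum :: "nat list \<Rightarrow> nat \<Rightarrow> nat" where
  "colsum la m = (\<Sum>r<length la. min (la ! r) m)"

lemma card_col_less: "card {\<alpha>. \<alpha> < sum_list la \<and> col_of la \<alpha> < m} = colsum la m"
  unfolding card_by_rows[of la "\<lambda>\<alpha>. col_of la \<alpha> < m"] colsum_def
proof (rule sum.cong)
  fix r assume "r \<in> {..<length la}"
  moreover have "{c. c < la ! r \<and> c < m} = {..<min (la ! r) m}" by auto
  ultimately show "card {\<alpha>. \<alpha> < sum_list la \<and> row_of la \<alpha> = r \<and> col_of la \<alpha> < m} = min (la ! r) m"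
    using card_row[of r la "\<lambda>c. c < m"] by simp
qed simp

lemma card_col_less_perm:
  assumes "g \<in> symgrp (sum_list la)"
  shows "card {\<alpha>. \<alpha> < sum_list la \<and> col_of la (inv (prm g) \<alpha>) < m} = colsum la m"
proof -
  have "bij_betw (prm g) {\<alpha>. \<alpha> < sum_list la \<and> col_of la \<alpha> < m}
     {\<alpha>. \<alpha> < sum_list la \<and> col_of la (inv (prm g) \<alpha>) < m}"
    by (rule bij_betw_byWitness[where f' = "inv (prm g)"])
       (auto simp: symgrp_less[OF assms])
  from bij_betw_same_card[OF this] show ?thesis by (simp add: card_col_less)
qed

text \<open>Position \<open>\<alpha>\<close> lies in column \<open>c\<close> of the
  \<open>la\<close>-tableau translated by \<open>g\<close> exactly when
  \<open>inv (prm g) \<alpha>\<close> lies in column \<open>c\<close> of \<open>la\<close>. So rows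
  of \<open>nu\<close> and translated columns of \<open>la\<close> share at most one entry.\<close>

definition transversal :: "nat list \<Rightarrow> nat list \<Rightarrow> natperm \<Rightarrow> bool" where
  "transversal nu la g \<longleftrightarrow> (\<forall>\<alpha><sum_list nu. \<forall>\<beta><sum_list nu. row_of nu \<alpha> = row_of nu \<beta> \<longrightarrow>
     col_of la (inv (prm g) \<alpha>) = col_of la (inv (prm g) \<beta>) \<longrightarrow> \<alpha> = \<beta>)"

lemma transversal_row_le:
  assumes tr: "transversal nu la g" and r: "r < length nu"
  shows "card {\<alpha>. \<alpha> < sum_list nu \<and> row_of nu \<alpha> = r \<and> col_of la (inv (prm g) \<alpha>) < m} \<le> min (nu ! r) m" (is "card ?S \<le> _")
proof -
  have "card ?S \<le> card {\<alpha>. \<alpha> < sum_list nu \<and> row_of nu \<alpha> = r \<and> True}"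
    by (rule card_mono) auto
  also have "\<dots> = nu ! r" by (subst card_row[OF r]) simp
  finally have 1: "card ?S \<le> nu ! r" .
  have "card ?S \<le> card {..<m}"
    by (rule card_inj_on_le[of "\<lambda>\<alpha>. col_of la (inv (prm g) \<alpha>)"])
       (use tr in \<open>auto simp: inj_on_def transversal_def\<close>)
  with 1 show ?thesis by simp
qed

text \<open>The first \<open>m\<close> translated columns contain \<open>colsum la m\<close>
  entries, and a row of \<open>nu\<close> holds at most one entry of each of them. Summing the
  bounds over the rows gives the claim.\<close>

lemma transversal_dominance:
  assumes tr: "transversal nu la g" and g: "g \<in> symgrp (sum_list la)" and eq: "sum_list nu = sum_list la"
  shows "colsum la m \<le> colsum nu m"
proof -
  have "colsum la m = card {\<alpha>. \<alpha> < sum_list nu \<and> col_of la (inv (prm g) \<alpha>) < m}"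
    using card_col_less_perm[OF g] eq by simp
  also have "\<dots> \<le> colsum nu m"
    unfolding card_by_rows[of nu "\<lambda>\<alpha>. col_of la (inv (prm g) \<alpha>) < m"] colsum_def
    by (rule sum_mono) (use transversal_row_le[OF tr] in simp)
  finally show ?thesis .
qed

text \<open>For \<open>nu = la\<close> the bounds of \<open>transversal_row_le\<close> sum to an
  equality, so each is sharp and every entry has its translated column inside its own row. Sliding
  the entries along their rows into these columns is a row permutation that turns \<open>g\<close>
  into a column permutation.\<close>

lemma transversal_factor:
  assumes tr: "transversal la la g" and g: "g \<in> symgrp (sum_list la)"
  obtains \<sigma> \<tau> where "\<sigma> \<in> rowgrp la" "\<tau> \<in> colgrp la" "g = \<sigma> + \<tau>"
proof -
  define \<kappa> where "\<kappa> \<alpha> = col_of la (inv (prm g) \<alpha>)" for \<alpha>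
  let ?n = "sum_list la"
  let ?R = "\<lambda>r m. {\<alpha>. \<alpha> < ?n \<and> row_of la \<alpha> = r \<and> \<kappa> \<alpha> < m}"
  have eq: "card (?R r m) = min (la ! r) m" if r: "r < length la" for r m
  proof -
    have "(\<Sum>r<length la. card (?R r m)) = (\<Sum>r<length la. min (la ! r) m)"
      using card_col_less_perm[OF g, of m] unfolding \<kappa>_def card_by_rows[of la "\<lambda>\<alpha>. col_of la (inv (prm g) \<alpha>) < m"] colsum_def .
    thus ?thesis
      by (rule sum_mono_inv) (use transversal_row_le[OF tr] r in \<open>auto simp: \<kappa>_def\<close>)
  qed
  \<comment> \<open>Sharpness with \<open>m\<close> equal to the row length: all entries of the row
    are counted.\<close>
  have kl: "\<kappa> \<alpha> < la ! row_of la \<alpha>" if a: "\<alpha> < ?n" for \<alpha>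
  proof -
    let ?r = "row_of la \<alpha>"
    have "card (?R ?r (la ! ?r)) = la ! ?r" using eq[OF row_less[OF a]] by simp
    moreover have "card {\<alpha>. \<alpha> < ?n \<and> row_of la \<alpha> = ?r \<and> True} = la ! ?r"
      by (subst card_row[OF row_less[OF a]]) simp
    ultimately have "?R ?r (la ! ?r) = {\<alpha>. \<alpha> < ?n \<and> row_of la \<alpha> = ?r \<and> True}"
      by (intro card_subset_eq) auto
    thus ?thesis using a by auto
  qed
  define s where "s \<alpha> = (if \<alpha> < ?n then cell la (row_of la \<alpha>) (\<kappa> \<alpha>) else \<alpha>)" for \<alpha>
  have s: "s \<alpha> < ?n" "row_of la (s \<alpha>) = row_of la \<alpha>" "col_of la (s \<alpha>) = \<kappa> \<alpha>" if "\<alpha> < ?n" for \<alpha>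
    using cell[OF row_less[OF that] kl[OF that]] that by (auto simp: s_def)
  have inj: "inj_on s {..<?n}"
  proof (rule inj_onI)
    fix x y assume xy: "x \<in> {..<?n}" "y \<in> {..<?n}" "s x = s y"
    hence "row_of la x = row_of la y" "\<kappa> x = \<kappa> y" using s(2,3) by (metis lessThan_iff)+
    thus "x = y" using tr xy(1,2) by (auto simp: transversal_def \<kappa>_def)
  qed
  have perm: "s permutes {..<?n}"
  proof (rule bij_imp_permutes)
    show "bij_betw s {..<?n} {..<?n}"
      unfolding bij_betw_def using endo_inj_surj[OF _ _ inj] inj s(1) by auto
  qed (auto simp: s_def)
  define h where "h = Natperm s"
  have h: "prm h = s" unfolding h_def using perm by (rule prm_Natperm)
  have hR: "h \<in> rowgrp la" using perm s(2) by (simp add: rowgrp_def Rt_def h)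
  have hS: "h \<in> symgrp ?n" using perm by (simp add: symgrp_def h)
  \<comment> \<open>\<open>s\<close> puts the entry \<open>prm g \<alpha>\<close> into the column of
    \<open>\<alpha>\<close>.\<close>
  have "h + g \<in> colgrp la"
  proof -
    have "s \<circ> prm g permutes {..<?n}" using symgrp_plus[OF hS g] by (simp add: symgrp_def h)
    moreover have "col_of la (s (prm g \<alpha>)) = col_of la \<alpha>" if "\<alpha> < ?n" for \<alpha>
      using s(3)[of "prm g \<alpha>"] symgrp_less(1)[OF g, of \<alpha>] that by (simp add: \<kappa>_def)
    ultimately show ?thesis by (simp add: colgrp_def Ct_def h)
  qed
  moreover have "- h \<in> rowgrp la" using hR rowgrp.uminus_S by blast
  ultimately show ?thesis using that[of "- h" "h + g"] by (simp flip: add.assoc)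
qed

section \<open>Products of row and column sums\<close>

lemma neg_self_zero: "x = - x \<Longrightarrow> x = (0 :: galg)"
proof -
  assume "x = - x"
  hence "x + x = 0" by (metis add.right_inverse)
  hence "scal 2 * x = 0" by (simp add: mult_2)
  thus ?thesis by (rule scal_mult_eq_0) simp
qed

definition swp :: "nat \<Rightarrow> nat \<Rightarrow> natperm" where "swp i j = Natperm (Transposition.transpose i j)"

lemma prm_swp: "prm (swp i j) = Transposition.transpose i j"
  unfolding swp_def by (rule prm_Natperm[of _ "{i, j}"]) (simp add: permutes_swap_id)

lemma sg_swp: "i \<noteq> j \<Longrightarrow> sg (swp i j) = -1"
  by (simp add: sg_def prm_swp sign_swap_id)

lemma swp_rowgrp: "i < sum_list la \<Longrightarrow> j < sum_list la \<Longrightarrow> row_of la i = row_of la j \<Longrightarrow> swp i j \<in> rowgrp la"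
  by (simp add: rowgrp_def Rt_def prm_swp permutes_swap_id) (auto simp: Transposition.transpose_def)

lemma swp_colgrp: "i < sum_list la \<Longrightarrow> j < sum_list la \<Longrightarrow> col_of la i = col_of la j \<Longrightarrow> swp i j \<in> colgrp la"
  by (simp add: colgrp_def Ct_def prm_swp permutes_swap_id) (auto simp: Transposition.transpose_def)

lemma swp_conj: "swp i j + g = g + swp (inv (prm g) i) (inv (prm g) j)"
proof -
  have "prm (swp i j + g) = prm (g + swp (inv (prm g) i) (inv (prm g) j))"
    by (rule ext) (auto simp: prm_swp Transposition.transpose_def)
  thus ?thesis by (simp only: prm_inject)
qed

text \<open>A row transposition of \<open>i\<close> and \<open>j\<close> is absorbed by the row sum.
  Moved past \<open>g\<close> it becomes a column transposition and yields the sign -1, so the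
  product equals its own negative.\<close>

lemma row_col_vanish:
  assumes ntr: "\<not> transversal nu la g" and g: "g \<in> symgrp (sum_list la)" and eq: "sum_list nu = sum_list la"
  shows "rowsym nu * sng g 1 * colalt la = 0"
proof -
  from ntr obtain i j where ij: "i < sum_list nu" "j < sum_list nu" "row_of nu i = row_of nu j"
    "col_of la (inv (prm g) i) = col_of la (inv (prm g) j)" "i \<noteq> j"
    by (auto simp: transversal_def)
  let ?i = "inv (prm g) i" and ?j = "inv (prm g) j"
  have lt: "?i < sum_list la" "?j < sum_list la" using ij eq symgrp_less(2)[OF g] by auto
  have "?i \<noteq> ?j" using ij(5) by (metis prm_uminus_prm(2))
  hence s: "sg (swp ?i ?j) = -1" by (rule sg_swp)
  have r: "rowsym nu * sng (swp i j) 1 = rowsym nu"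
    unfolding rowsym_def using rowgrp.right_mult[OF swp_rowgrp[OF ij(1-3)]] by simp
  have c: "sng (swp ?i ?j) 1 * colalt la = - colalt la"
    unfolding colalt_def using colgrp.left_mult[OF swp_colgrp[OF lt ij(4)]]
    by (simp add: s single_uminus)
  have "rowsym nu * sng g 1 * colalt la = rowsym nu * (sng (swp i j) 1 * sng g 1) * colalt la"
    by (simp add: r flip: mult.assoc)
  also have "\<dots> = rowsym nu * (sng g 1 * sng (swp ?i ?j) 1) * colalt la"
    by (simp add: mult_single swp_conj)
  also have "\<dots> = - (rowsym nu * sng g 1 * colalt la)"
    by (simp add: mult.assoc c)
  finally show ?thesis by (rule neg_self_zero)
qed

text \<open>By linearity one group element suffices: if it is not transversal the product vanishes,
  otherwise it is a row permutation times a column permutation and both are absorbed.\<close>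

lemma row_col_scalar:
  assumes "supp x \<subseteq> symgrp (sum_list la)"
  shows "\<exists>c. rowsym la * x * colalt la = scal c * (rowsym la * colalt la)"
proof -
  have 1: "\<exists>c. rowsym la * sng g 1 * colalt la = scal c * (rowsym la * colalt la)" if g: "g \<in> symgrp (sum_list la)" for g
  proof (cases "transversal la la g")
    case True
    then obtain \<sigma> \<tau> where st: "\<sigma> \<in> rowgrp la" "\<tau> \<in> colgrp la" "g = \<sigma> + \<tau>" using transversal_factor g by blast
    have "rowsym la * sng g 1 * colalt la = (rowsym la * sng \<sigma> 1) * (sng \<tau> 1 * colalt la)"
      by (simp add: st(3) mult.assoc) (simp add: mult_single flip: mult.assoc)
    also have "\<dots> = scal (sg \<tau>) * (rowsym la * colalt la)"
      using rowgrp.right_mult[OF st(1)] colgrp.left_mult[OF st(2)]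
      by (simp add: rowsym_def colalt_def scal_commute_left)
    finally show ?thesis by blast
  qed (use row_col_vanish[OF _ g] in \<open>auto intro!: exI[of _ 0]\<close>)
  then obtain c where c: "\<And>g. g \<in> symgrp (sum_list la) \<Longrightarrow> rowsym la * sng g 1 * colalt la = scal (c g) * (rowsym la * colalt la)"
    by metis
  have s: "sng g d = scal d * sng g 1" for g d by (simp add: mult_single)
  have "rowsym la * x * colalt la = rowsym la * (\<Sum>g\<in>symgrp (sum_list la). sng g (coef x g)) * colalt la"
    using galg_eq_sum[OF finite_symgrp assms] by simp
  also have "\<dots> = (\<Sum>g\<in>symgrp (sum_list la). scal (coef x g) * (rowsym la * sng g 1 * colalt la))"
    by (subst s) (simp add: sum_distrib_left sum_distrib_right scal_commute_left mult.assoc)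
  also have "\<dots> = (\<Sum>g\<in>symgrp (sum_list la). scal (coef x g * c g)) * (rowsym la * colalt la)"
    by (simp add: c sum_distrib_right mult_single flip: mult.assoc)
  also have "(\<Sum>g\<in>symgrp (sum_list la). scal (coef x g * c g)) = scal (\<Sum>g\<in>symgrp (sum_list la). coef x g * c g)"
    by (rule poly_mapping_eqI) (simp add: Poly_Mapping.lookup_sum lookup_single when_def)
  finally show ?thesis by blast
qed

text \<open>By \<open>transversal_dominance\<close> a strict drop of a single column sum excludes
  every transversal.\<close>

lemma row_col_vanish':
  assumes "supp x \<subseteq> symgrp (sum_list la)" and eq: "sum_list nu = sum_list la"
    and lt: "colsum nu m < colsum la m"
  shows "rowsym nu * x * colalt la = 0"
proof -
  have 1: "rowsym nu * sng g 1 * colalt la = 0" if g: "g \<in> symgrp (sum_list la)" for g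
    using row_col_vanish[OF _ g eq] transversal_dominance[OF _ g eq, of m] lt by fastforce
  have s: "sng g d = scal d * sng g 1" for g d by (simp add: mult_single)
  have "rowsym nu * x * colalt la = rowsym nu * (\<Sum>g\<in>symgrp (sum_list la). sng g (coef x g)) * colalt la"
    using galg_eq_sum[OF finite_symgrp assms(1)] by simp
  also have "\<dots> = (\<Sum>g\<in>symgrp (sum_list la). scal (coef x g) * (rowsym nu * sng g 1 * colalt la))"
    by (subst s) (simp add: sum_distrib_left sum_distrib_right scal_commute_left mult.assoc)
  finally show ?thesis by (simp add: 1)
qed

section \<open>A linear order on partitions compatible with dominance\<close>

text \<open>First differences in \<open>m\<close> count the rows longer than \<open>m\<close>,
  second differences the rows of a given length. This multiset recovers the partition, because
  partitions are sorted.\<close>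

lemma colsum_determines:
  assumes "is_partition la" "is_partition nu" "\<And>m. colsum la m = colsum nu m"
  shows "la = nu"
proof -
  have diff: "colsum la (Suc m) = colsum la m + card {r. r < length la \<and> m < la ! r}" for la m
  proof -
    have "colsum la (Suc m) = (\<Sum>r<length la. min (la ! r) m + (if m < la ! r then 1 else 0))"
      unfolding colsum_def by (rule sum.cong) auto
    thus ?thesis by (simp add: sum.distrib colsum_def sum.If_cases Int_def)
  qed
  have cc: "card {r. r < length la \<and> m < la ! r} = card {r. r < length nu \<and> m < nu ! r}" for m
    using assms(3)[of m] assms(3)[of "Suc m"] diff[of la m] diff[of nu m] by simp
  have cnt: "count (mset la) (Suc m) + card {r. r < length la \<and> Suc m < la ! r} = card {r. r < length la \<and> m < la ! r}" for la m
  proof -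
    have "count (mset la) (Suc m) = card {r. r < length la \<and> la ! r = Suc m}"
      by (simp add: count_mset count_list_eq_length_filter length_filter_conv_card eq_commute)
    moreover have "card ({r. r < length la \<and> la ! r = Suc m} \<union> {r. r < length la \<and> Suc m < la ! r}) =
       card {r. r < length la \<and> la ! r = Suc m} + card {r. r < length la \<and> Suc m < la ! r}"
      by (rule card_Un_disjoint) auto
    moreover have "{r. r < length la \<and> la ! r = Suc m} \<union> {r. r < length la \<and> Suc m < la ! r} = {r. r < length la \<and> m < la ! r}"
      by auto
    ultimately show ?thesis by simp
  qed
  have "count (mset la) m = count (mset nu) m" for m
  proof (cases m)
    case 0
    have "0 \<notin> set la" "0 \<notin> set nu" using assms by (auto simp: is_partition_def)
    thus ?thesis using 0 by (metis count_mset_0_iff)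
  next
    case (Suc k)
    thus ?thesis using cnt[of la k] cnt[of nu k] cc[of k] cc[of "Suc k"] by simp
  qed
  hence "mset (rev la) = mset (rev nu)" by (simp add: multiset_eq_iff)
  moreover have "sorted (rev xs)" if "is_partition xs" for xs
    using that by (simp add: is_partition_def sorted_wrt_rev sorted_wrt_iff_nth_Suc_transp[OF transp_on_ge])
  ultimately have "rev la = rev nu" using assms by (metis properties_for_sort)
  thus ?thesis by simp
qed

text \<open>A numerical substitute for a linear extension of dominance: among partitions of one
  size, if all column sums of one are at most those of another and the totals agree, the two are
  equal.\<close>

definition total_colsum :: "nat list \<Rightarrow> nat" where
  "total_colsum la = (\<Sum>m\<le>sum_list la. colsum la m)"

lemma nth_le_sum_list: "r < length la \<Longrightarrow> la ! r \<le> sum_list (la :: nat list)"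
  by (simp add: elem_le_sum_list)

lemma row_col_vanish_order:
  assumes "supp x \<subseteq> symgrp (sum_list la)" and eq: "sum_list nu = sum_list la"
    and part: "is_partition la" "is_partition nu" and ne: "nu \<noteq> la" and le: "total_colsum nu \<le> total_colsum la"
  shows "rowsym nu * x * colalt la = 0"
proof -
  have "\<exists>m. colsum nu m < colsum la m"
  proof (rule ccontr)
    assume "\<not> ?thesis"
    hence all: "colsum la m \<le> colsum nu m" for m by (simp add: not_less)
    hence "(\<Sum>m\<le>sum_list la. colsum la m) = (\<Sum>m\<le>sum_list la. colsum nu m)"
      using le by (intro antisym[OF sum_mono]) (simp_all add: total_colsum_def eq)
    hence small: "colsum la m = colsum nu m" if "m \<le> sum_list la" for m
      by (rule sum_mono_inv) (use that all in auto)
    \<comment> \<open>No row is longer than the size, so column sums are constant from there on and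
      agreement up to the size suffices.\<close>
    have big: "colsum xs m = colsum xs (min m (sum_list xs))" for xs m
      unfolding colsum_def by (rule sum.cong) (use nth_le_sum_list[of _ xs] in fastforce)+
    have "colsum la m = colsum nu m" for m
      using small[of "min m (sum_list la)"] big[of la m] big[of nu m] eq by simp
    with colsum_determines part ne show False by metis
  qed
  thus ?thesis using row_col_vanish'[OF assms(1) eq] by blast
qed

section \<open>The hyperoctahedral group\<close>

definition mate :: "nat \<Rightarrow> nat" where "mate \<alpha> = (if even \<alpha> then \<alpha> + 1 else \<alpha> - 1)"

lemma mate_mate [simp]: "mate (mate \<alpha>) = \<alpha>"
  by (auto simp: mate_def elim: oddE)

lemma mate_neq [simp]: "mate \<alpha> \<noteq> \<alpha>"
  by (auto simp: mate_def elim: oddE)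

lemma even_mate [simp]: "even (mate \<alpha>) \<longleftrightarrow> odd \<alpha>"
  by (auto simp: mate_def)

lemma mate_less: "even n \<Longrightarrow> mate \<alpha> < n \<longleftrightarrow> \<alpha> < n"
  by (auto simp: mate_def elim!: evenE oddE)

lemma mate_add: "even m \<Longrightarrow> mate (m + c) = m + mate c"
  by (auto simp: mate_def elim: oddE)

definition hypgrp :: "nat \<Rightarrow> natperm set" where
  "hypgrp k = {g \<in> symgrp (2 * k). prm g \<circ> mate = mate \<circ> prm g}"

definition hypsum :: "nat \<Rightarrow> galg" where "hypsum k = chsum (hypgrp k) (\<lambda>_. 1)"

lemma hypgrp_sub: "hypgrp k \<subseteq> symgrp (2 * k)"
  by (auto simp: hypgrp_def)

lemma hypgrp_commute: "g \<in> hypgrp k \<Longrightarrow> prm g (mate \<alpha>) = mate (prm g \<alpha>)"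
  by (auto simp: hypgrp_def fun_eq_iff)

lemma hypgrpI: "g \<in> symgrp (2 * k) \<Longrightarrow> (\<And>\<alpha>. \<alpha> < 2 * k \<Longrightarrow> prm g (mate \<alpha>) = mate (prm g \<alpha>)) \<Longrightarrow> g \<in> hypgrp k"
proof -
  assume g: "g \<in> symgrp (2 * k)" and h: "\<And>\<alpha>. \<alpha> < 2 * k \<Longrightarrow> prm g (mate \<alpha>) = mate (prm g \<alpha>)"
  have "prm g (mate \<alpha>) = mate (prm g \<alpha>)" for \<alpha>
  proof (cases "\<alpha> < 2 * k")
    case False
    hence "\<not> mate \<alpha> < 2 * k" by (simp add: mate_less)
    thus ?thesis using g False by (simp add: symgrp_def permutes_not_in)
  qed (rule h)
  thus ?thesis using g by (auto simp: hypgrp_def)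
qed

lemma hypgrp_signed: "signed_group (hypgrp k) (\<lambda>_. 1)"
proof
  show "finite (hypgrp k)" using finite_subset[OF hypgrp_sub finite_symgrp] .
  show "0 \<in> hypgrp k" by (simp add: hypgrp_def symgrp_zero)
  show "g + h \<in> hypgrp k" if "g \<in> hypgrp k" "h \<in> hypgrp k" for g h
    using that by (auto simp: hypgrp_def symgrp_plus fun_eq_iff)
  show "- g \<in> hypgrp k" if "g \<in> hypgrp k" for g
  proof (rule hypgrpI)
    show "- g \<in> symgrp (2 * k)" using that by (simp add: hypgrp_def symgrp_uminus)
    fix \<alpha>
    show "prm (- g) (mate \<alpha>) = mate (prm (- g) \<alpha>)"
      using hypgrp_commute[OF that, of "inv (prm g) \<alpha>"] by (simp, metis prm_uminus_prm(1))
  qed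
qed simp_all

interpretation hypgrp: signed_group "hypgrp k" "\<lambda>_. 1" for k by (rule hypgrp_signed)

lemma keys_mult_symgrp:
  "supp x \<subseteq> symgrp n \<Longrightarrow> supp y \<subseteq> symgrp n \<Longrightarrow> supp (x * y) \<subseteq> symgrp n"
  using keys_mult[of x y] symgrp_plus by fast

lemma keys_basic:
  "supp (rowsym la) \<subseteq> symgrp (sum_list la)"
  "supp (colalt la) \<subseteq> symgrp (sum_list la)"
  "supp (hypsum k) \<subseteq> symgrp (2 * k)"
  using rowgrp.keys_chsum colgrp.keys_chsum
    hypgrp.keys_chsum rowgrp_sub colgrp_sub hypgrp_sub
  unfolding rowsym_def colalt_def hypsum_def by blast+

lemma star_basic: "star (rowsym la) = rowsym la" "star (colalt la) = colalt la" "star (hypsum k) = hypsum k"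
  unfolding rowsym_def colalt_def hypsum_def
  by (rule rowgrp.star_chsum colgrp.star_chsum hypgrp.star_chsum)+

lemma finite_even_partitions: "finite (even_partitions n)"
proof (rule finite_subset)
  show "even_partitions n \<subseteq> {xs. set xs \<subseteq> {..n} \<and> length xs \<le> n}"
  proof
    fix la assume "la \<in> even_partitions n"
    hence la: "sum_list la = n" "\<forall>x\<in>set la. 0 < x" by (auto simp: even_partitions_def is_partition_def)
    have "length la \<le> sum_list la" using la(2) by (induction la) auto
    thus "la \<in> {xs. set xs \<subseteq> {..n} \<and> length xs \<le> n}"
      using la(1) member_le_sum_list[of _ la] by auto
  qed
qed (rule finite_lists_length_le, simp)

text \<open>Rows of even length start at even positions, so mates are neighbouring cells of one
  row.\<close>

lemma mate_row_col:
  assumes la: "la \<in> even_partitions (2 * k)" and a: "\<alpha> < 2 * k"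
  shows "row_of la (mate \<alpha>) = row_of la \<alpha>" "col_of la (mate \<alpha>) = mate (col_of la \<alpha>)"
    "even (col_of la \<alpha>) \<longleftrightarrow> even \<alpha>"
proof -
  let ?r = "row_of la \<alpha>" and ?c = "col_of la \<alpha>"
  have n: "sum_list la = 2 * k" and ev: "\<forall>x\<in>set la. even x" using la by (auto simp: even_partitions_def)
  have "even (sum_list xs)" if "\<forall>x\<in>set xs. even x" for xs :: "nat list"
    using that by (induction xs) auto
  hence off: "even (sum_list (take ?r la))" using ev by (meson in_set_takeD)
  have r: "?r < length la" and c: "?c < la ! ?r" and cell: "cell la ?r ?c = \<alpha>"
    using row_col[of \<alpha> la] a n by auto
  have "even (la ! ?r)" using ev r by auto
  hence mc: "mate ?c < la ! ?r" using c by (simp add: mate_less)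
  have "mate \<alpha> = mate (cell la ?r ?c)" by (simp add: cell)
  also have "\<dots> = cell la ?r (mate ?c)" using mate_add[OF off] by (simp add: cell_def)
  finally have m: "mate \<alpha> = cell la ?r (mate ?c)" .
  show "row_of la (mate \<alpha>) = ?r" "col_of la (mate \<alpha>) = mate ?c"
    unfolding m using row_cell[OF r mc] col_cell[OF r mc] by auto
  show "even ?c \<longleftrightarrow> even \<alpha>" using off cell by (metis cell_def even_add)
qed

lemma permutes_lessThanI:
  fixes n :: nat
  assumes "\<And>x. x < n \<Longrightarrow> s x < n" "inj_on s {..<n}" "\<And>x. \<not> x < n \<Longrightarrow> s x = x"
  shows "s permutes {..<n}"
proof (rule bij_imp_permutes)
  show "bij_betw s {..<n} {..<n}"
    unfolding bij_betw_def using endo_inj_surj[OF finite_lessThan _ assms(2)] assms(1,2) by blast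
qed (use assms(3) in auto)

text \<open>A column permutation respects the parity of positions here, and commuting with
  \<open>mate\<close> makes its action on odd positions a copy of that on even ones. So it is a
  product of two conjugate permutations, which have equal sign.\<close>

lemma sg_col_hyp:
  assumes la: "la \<in> even_partitions (2 * k)" and C: "\<tau> \<in> colgrp la" and H: "\<tau> \<in> hypgrp k"
  shows "sg \<tau> = 1"
proof -
  let ?n = "2 * k" let ?t = "prm \<tau>"
  have n: "sum_list la = ?n" using la by (auto simp: even_partitions_def)
  have S: "\<tau> \<in> symgrp ?n" using H hypgrp_sub by blast
  have par: "even (?t \<alpha>) \<longleftrightarrow> even \<alpha>" for \<alpha>
  proof (cases "\<alpha> < ?n")
    case True
    hence "col_of la (?t \<alpha>) = col_of la \<alpha>" using C n by (auto simp: colgrp_def Ct_def)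
    thus ?thesis using mate_row_col(3)[OF la True] mate_row_col(3)[OF la, of "?t \<alpha>"] True
        symgrp_less(1)[OF S] by simp
  next
    case False thus ?thesis using S by (simp add: symgrp_def permutes_not_in)
  qed
  have outside: "?t \<alpha> = \<alpha>" if "\<not> \<alpha> < ?n" for \<alpha>
    using S that by (simp add: symgrp_def permutes_not_in)
  define e where "e \<alpha> = (if even \<alpha> then ?t \<alpha> else \<alpha>)" for \<alpha>
  \<comment> \<open>The matching is cut off so that it is a finite permutation, to which
    multiplicativity of the sign applies.\<close>
  define m where "m \<alpha> = (if \<alpha> < ?n then mate \<alpha> else \<alpha>)" for \<alpha>
  have ti: "?t x = ?t y \<longleftrightarrow> x = y" for x y by (metis prm_uminus_prm(1))
  have eperm: "e permutes {..<?n}"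
    by (rule permutes_lessThanI) (auto simp: e_def symgrp_less[OF S] outside inj_on_def ti split: if_splits dest: par[THEN iffD1] par[THEN iffD2])
  have mperm: "m permutes {..<?n}"
    by (rule permutes_lessThanI) (auto simp: m_def mate_less inj_on_def dest: arg_cong[of _ _ mate])
  have eq: "?t = e \<circ> (m \<circ> e \<circ> m)"
  proof
    fix \<alpha>
    show "?t \<alpha> = (e \<circ> (m \<circ> e \<circ> m)) \<alpha>"
    proof (cases "\<alpha> < ?n")
      case True
      thus ?thesis using hypgrp_commute[OF H, of \<alpha>] par[of \<alpha>] symgrp_less(1)[OF S, of \<alpha>]
        by (auto simp: e_def m_def mate_less par)
    qed (simp add: e_def m_def outside)
  qed
  have perms: "permutation e" "permutation m"
    using eperm mperm by (auto simp: permutation_permutes)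
  hence "sign ?t = sign e * (sign m * sign e * sign m)"
    unfolding eq by (simp add: sign_compose permutation_compose)
  also have "\<dots> = (sign e * sign e) * (sign m * sign m)" by (simp only: mult_ac)
  also have "\<dots> = 1" by (simp only: sign_idempotent mult_1)
  finally show ?thesis by (simp add: sg_def)
qed

text \<open>The column permutation is applied last and keeps columns, so \<open>\<sigma>\<close>
  moves columns as \<open>h\<close> does and respects pairs of neighbouring columns. As it also
  keeps rows, it commutes with \<open>mate\<close>, and then so does
  \<open>\<tau> = h + - \<sigma>\<close>.\<close>

lemma col_part_in_hypgrp:
  assumes la: "la \<in> even_partitions (2 * k)" and h: "h \<in> hypgrp k" and s: "\<sigma> \<in> rowgrp la" and t: "\<tau> \<in> colgrp la"
    and eq: "h = \<tau> + \<sigma>"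
  shows "\<tau> \<in> hypgrp k"
proof -
  have n: "sum_list la = 2 * k" using la by (auto simp: even_partitions_def)
  have S: "\<sigma> \<in> symgrp (2 * k)" "\<tau> \<in> symgrp (2 * k)" using s t rowgrp_sub[of la] colgrp_sub[of la] n by auto
  have row: "row_of la (prm \<sigma> \<alpha>) = row_of la \<alpha>" if "\<alpha> < 2 * k" for \<alpha> using s that n by (auto simp: rowgrp_def Rt_def)
  have col: "col_of la (prm \<tau> \<alpha>) = col_of la \<alpha>" if "\<alpha> < 2 * k" for \<alpha> using t that n by (auto simp: colgrp_def Ct_def)
  have hc: "col_of la (prm h \<alpha>) = col_of la (prm \<sigma> \<alpha>)" if "\<alpha> < 2 * k" for \<alpha>
    using col[of "prm \<sigma> \<alpha>"] that symgrp_less(1)[OF S(1)] by (simp add: eq)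
  have "\<sigma> \<in> hypgrp k"
  proof (rule hypgrpI[OF S(1)])
    fix \<alpha> assume a: "\<alpha> < 2 * k"
    have ma: "mate \<alpha> < 2 * k" using a by (simp add: mate_less)
    have sa: "prm \<sigma> \<alpha> < 2 * k" using a symgrp_less(1)[OF S(1)] by simp
    have ha: "prm h \<alpha> < 2 * k" using a h hypgrp_sub symgrp_less(1) by blast
    have "col_of la (prm \<sigma> (mate \<alpha>)) = col_of la (prm h (mate \<alpha>))" using hc[OF ma] by simp
    also have "\<dots> = mate (col_of la (prm h \<alpha>))" using hypgrp_commute[OF h] mate_row_col(2)[OF la ha] by simp
    also have "\<dots> = col_of la (mate (prm \<sigma> \<alpha>))" using hc[OF a] mate_row_col(2)[OF la sa] by simp
    finally have c: "col_of la (prm \<sigma> (mate \<alpha>)) = col_of la (mate (prm \<sigma> \<alpha>))" .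
    have r: "row_of la (prm \<sigma> (mate \<alpha>)) = row_of la (mate (prm \<sigma> \<alpha>))"
      using row[OF ma] row[OF a] mate_row_col(1)[OF la a] mate_row_col(1)[OF la sa] by simp
    show "prm \<sigma> (mate \<alpha>) = mate (prm \<sigma> \<alpha>)"
      by (rule row_col_inj[OF _ _ r c]) (use ma sa n symgrp_less(1)[OF S(1)] in \<open>auto simp: mate_less\<close>)
  qed
  moreover have "\<tau> = h + - \<sigma>" by (simp add: eq add.assoc)
  ultimately show ?thesis
    using h hypgrp.plus_S hypgrp.uminus_S by metis
qed

section \<open>Nonvanishing and independence of products of e, a and b\<close>

lemma hyp_row_col_nonzero:
  assumes la: "la \<in> even_partitions (2 * k)"
  shows "hypsum k * rowsym la * colalt la \<noteq> 0"
proof -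
  let ?f = "\<lambda>h \<sigma> \<tau>. if h + \<sigma> + \<tau> = 0 then sg \<tau> else 0"
  have fin: "finite (hypgrp k)" "finite (rowgrp la)" "finite (colgrp la)"
    using hypgrp.finite_S rowgrp.finite_S colgrp.finite_S by auto
  have z: "0 \<in> hypgrp k" "0 \<in> rowgrp la" "0 \<in> colgrp la"
    using hypgrp.zero_S rowgrp.zero_S colgrp.zero_S by auto
  have one: "sg \<tau> = 1" if "h \<in> hypgrp k" "\<sigma> \<in> rowgrp la" "\<tau> \<in> colgrp la" "h + \<sigma> + \<tau> = 0" for h \<sigma> \<tau>
  proof -
    have "h = - \<tau> + - \<sigma>" using that(4) by (metis add.assoc add_eq_0_iff2 minus_add)
    moreover have "- \<tau> \<in> colgrp la" "- \<sigma> \<in> rowgrp la"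
      using that rowgrp.uminus_S colgrp.uminus_S by auto
    ultimately have "- \<tau> \<in> hypgrp k" using col_part_in_hypgrp[OF la that(1)] by blast
    hence "\<tau> \<in> hypgrp k" using hypgrp.uminus_S by fastforce
    thus ?thesis using sg_col_hyp[OF la that(3)] by blast
  qed
  have "coef (hypsum k * rowsym la * colalt la) 0 = (\<Sum>h\<in>hypgrp k. \<Sum>\<sigma>\<in>rowgrp la. \<Sum>\<tau>\<in>colgrp la. ?f h \<sigma> \<tau>)"
    unfolding hypsum_def rowsym_def colalt_def chsum_def sum_product
    by (simp add: sum_distrib_left sum_distrib_right mult_single Poly_Mapping.lookup_sum lookup_single when_def)
       (intro sum.cong[OF refl] sum.swap)
  also have "\<dots> = (\<Sum>h\<in>hypgrp k. \<Sum>\<sigma>\<in>rowgrp la. \<Sum>\<tau>\<in>colgrp la. if h + \<sigma> + \<tau> = 0 then 1 else 0)"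
    by (intro sum.cong refl) (auto simp: one)
  \<comment> \<open>All summands are now nonnegative, and the triple of identities alone gives
    1.\<close>
  also have "\<dots> \<ge> (\<Sum>h\<in>{0 :: natperm}. \<Sum>\<sigma>\<in>{0 :: natperm}. \<Sum>\<tau>\<in>{0 :: natperm}. if h + \<sigma> + \<tau> = 0 then 1 else 0)"
    by (intro order.trans[OF sum_mono sum_mono2] order.trans[OF sum_mono2[OF _ _ sum_nonneg]] sum_nonneg)
       (use fin z in \<open>auto intro: sum_nonneg\<close>)
  finally show ?thesis by auto
qed

text \<open>The scalar exists by \<open>row_col_scalar\<close>. With x = e a b, the product star x *
  x = b a e e a b equals |H| \<mu> b a b; it is not zero, hence neither is \<mu>.\<close>

lemma row_hyp_row_col:
  assumes la: "la \<in> even_partitions (2 * k)"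
  obtains \<mu> where "\<mu> \<noteq> 0" "rowsym la * hypsum k * rowsym la * colalt la = scal \<mu> * (rowsym la * colalt la)"
proof -
  have n: "sum_list la = 2 * k" using la by (auto simp: even_partitions_def)
  let ?x = "hypsum k * rowsym la * colalt la"
  have "supp (hypsum k * rowsym la) \<subseteq> symgrp (sum_list la)"
    using keys_mult_symgrp keys_basic n by metis
  from row_col_scalar[OF this] obtain \<mu> where mu: "rowsym la * (hypsum k * rowsym la) * colalt la = scal \<mu> * (rowsym la * colalt la)"
    by blast
  have "star ?x * ?x = colalt la * rowsym la * ((hypsum k * hypsum k) * (rowsym la * colalt la))"
    by (simp add: star_mult star_basic mult.assoc)
  also have "hypsum k * hypsum k = scal (real (card (hypgrp k))) * hypsum k"
    unfolding hypsum_def by (rule hypgrp.square)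
  also have "colalt la * rowsym la * (scal (real (card (hypgrp k))) * hypsum k * (rowsym la * colalt la)) =
     scal (real (card (hypgrp k))) * (colalt la * (rowsym la * (hypsum k * rowsym la) * colalt la))"
    by (simp add: mult.assoc scal_commute_left del: single_of_nat)
  also have "\<dots> = scal (real (card (hypgrp k))) * (colalt la * (scal \<mu> * (rowsym la * colalt la)))"
    by (simp only: mu)
  finally have "\<mu> \<noteq> 0" using star_mult_self_nonzero[OF hyp_row_col_nonzero[OF la]] by (intro notI) simp
  with mu that show ?thesis by (simp add: mult.assoc)
qed

text \<open>Biinvariant under H; up to a scalar it is the zonal spherical function of the shape for
  the Gelfand pair of S_2k and H.\<close>

definition zonal :: "nat \<Rightarrow> nat list \<Rightarrow> galg" where
  "zonal k la = hypsum k * rowsym la * colalt la * rowsym la * hypsum k"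

lemma zonal_nonzero:
  assumes la: "la \<in> even_partitions (2 * k)" shows "zonal k la \<noteq> 0"
proof
  let ?x = "hypsum k * rowsym la * colalt la"
  assume z: "zonal k la = 0"
  have "star (star ?x) * star ?x = hypsum k * rowsym la * (colalt la * colalt la) * rowsym la * hypsum k"
    by (simp add: star_star star_mult star_basic mult.assoc)
  also have "colalt la * colalt la = scal (real (card (colgrp la))) * colalt la"
    unfolding colalt_def by (rule colgrp.square)
  also have "hypsum k * rowsym la * (scal (real (card (colgrp la))) * colalt la) * rowsym la * hypsum k =
     scal (real (card (colgrp la))) * zonal k la"
    by (simp add: zonal_def mult.assoc scal_commute_left del: single_of_nat)
  finally have "star (star ?x) * star ?x = 0" by (simp add: z)
  hence "star ?x = 0" using star_mult_self_nonzero by blast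
  hence "star (star ?x) = star 0" by simp
  hence "?x = 0" by (simp add: star_star star_def[of 0])
  thus False using hyp_row_col_nonzero[OF la] by blast
qed

section \<open>Linear algebra of finite families\<close>

context vector_space
begin

lemma family_independent:
  assumes "finite I" and ind: "\<And>c. (\<Sum>i\<in>I. c i *s v i) = 0 \<Longrightarrow> \<forall>i\<in>I. c i = 0"
  shows "inj_on v I" "independent (v ` I)"
proof -
  show inj: "inj_on v I"
  proof (rule inj_onI, rule ccontr)
    fix i j assume ij: "i \<in> I" "j \<in> I" "v i = v j" "i \<noteq> j"
    let ?c = "\<lambda>x. if x = i then 1 else if x = j then - 1 else 0"
    have "(\<Sum>x\<in>I. ?c x *s v x) = (\<Sum>x\<in>{i, j}. ?c x *s v x)"
      by (rule sum.mono_neutral_right) (use assms ij in auto)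
    also have "\<dots> = 1 *s v i + (- 1) *s v j" using ij(4) by auto
    also have "\<dots> = 0" by (simp add: ij(3))
    finally show False using ind[of ?c] ij by auto
  qed
  show "independent (v ` I)"
  proof
    assume "dependent (v ` I)"
    then obtain u where u: "\<exists>w\<in>v ` I. u w \<noteq> 0" "(\<Sum>w\<in>v ` I. u w *s w) = 0"
      using dependent_finite[of "v ` I"] assms(1) by auto
    from u(2) have "(\<Sum>i\<in>I. u (v i) *s v i) = 0" by (simp add: sum.reindex[OF inj])
    from ind[OF this] u(1) show False by auto
  qed
qed

lemma spanning_by_card:
  assumes "finite I" "finite E" and ind: "\<And>c. (\<Sum>i\<in>I. c i *s v i) = 0 \<Longrightarrow> \<forall>i\<in>I. c i = 0"
    and sub: "\<And>i. i \<in> I \<Longrightarrow> v i \<in> span E" and card: "card E \<le> card I" and x: "x \<in> span E"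
  obtains c where "x = (\<Sum>i\<in>I. c i *s v i)"
proof -
  have inj: "inj_on v I" and indep: "independent (v ` I)" using family_independent assms(1) ind by blast+
  have "x \<in> span (v ` I)"
  proof (rule ccontr)
    assume nx: "x \<notin> span (v ` I)"
    have "independent (insert x (v ` I))" using independent_insertI[OF nx indep] .
    moreover have "insert x (v ` I) \<subseteq> span E" using sub x by auto
    ultimately have "card (insert x (v ` I)) \<le> card E" using independent_span_bound[OF assms(2)] by blast
    moreover have "x \<notin> v ` I" using nx span_base by blast
    ultimately show False using card assms(1) card_image[OF inj] by simp
  qed
  then obtain u where "x = (\<Sum>w\<in>v ` I. u w *s w)" using span_finite[of "v ` I"] assms(1) by auto
  hence "x = (\<Sum>i\<in>I. u (v i) *s v i)" by (simp add: sum.reindex[OF inj])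
  thus ?thesis using that[of "u \<circ> v"] by simp
qed

end

text \<open>Let \<open>nu\<close> have least \<open>total_colsum\<close> among the shapes with
  nonzero coefficient. Multiplying by \<open>rowsym nu\<close> from the left kills all other terms,
  and the nonzero scalar of \<open>row_hyp_row_col\<close> keeps the term of \<open>nu\<close>
  alive.\<close>

lemma zonal_independent:
  assumes "(\<Sum>la\<in>even_partitions (2 * k). scal (c la) * zonal k la) = 0"
  shows "\<forall>la\<in>even_partitions (2 * k). c la = 0"
proof (rule ccontr)
  let ?E = "even_partitions (2 * k)"
  let ?N = "{la \<in> ?E. c la \<noteq> 0}"
  assume "\<not> ?thesis"
  then obtain la where "la \<in> ?N" by auto
  from ex_has_least_nat[of "\<lambda>la. la \<in> ?N", OF this]
  obtain nu where nu: "nu \<in> ?N" "\<And>la. la \<in> ?N \<Longrightarrow> total_colsum nu \<le> total_colsum la" by blast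
  from nu have nuE: "nu \<in> ?E" "c nu \<noteq> 0" by auto
  obtain \<mu> where mu: "\<mu> \<noteq> 0" "rowsym nu * hypsum k * rowsym nu * colalt nu = scal \<mu> * (rowsym nu * colalt nu)"
    using row_hyp_row_col[OF nuE(1)] by blast
  have zero: "rowsym nu * (scal (c la) * zonal k la) = 0" if la: "la \<in> ?E" "la \<noteq> nu" for la
  proof (cases "c la = 0")
    case False
    have "rowsym nu * (hypsum k * rowsym la) * colalt la = 0"
    proof (rule row_col_vanish_order)
      show "supp (hypsum k * rowsym la) \<subseteq> symgrp (sum_list la)"
        using keys_mult_symgrp[OF keys_basic(3), of "rowsym la" k] keys_basic(1)[of la] la by (auto simp: even_partitions_def)
      show "total_colsum nu \<le> total_colsum la" using nu(2)[of la] la(1) False by simp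
    qed (use la nuE in \<open>auto simp: even_partitions_def\<close>)
    hence "rowsym nu * (hypsum k * (rowsym la * colalt la)) = 0" by (simp add: mult.assoc)
    hence "rowsym nu * (hypsum k * (rowsym la * colalt la)) * y = 0" for y by (simp only: mult_zero_left)
    hence "rowsym nu * (hypsum k * (rowsym la * (colalt la * y))) = 0" for y by (simp only: mult.assoc)
    thus ?thesis by (simp add: zonal_def mult.assoc scal_commute_left)
  qed simp
  have "0 = rowsym nu * (\<Sum>la\<in>?E. scal (c la) * zonal k la)" by (simp only: assms mult_zero_right)
  also have "\<dots> = (\<Sum>la\<in>?E. rowsym nu * (scal (c la) * zonal k la))" by (rule sum_distrib_left)
  also have "\<dots> = (\<Sum>la\<in>{nu}. rowsym nu * (scal (c la) * zonal k la))"
    by (rule sum.mono_neutral_right) (use finite_even_partitions nuE zero in auto)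
  also have "\<dots> = scal (c nu) * ((rowsym nu * hypsum k * rowsym nu * colalt nu) * (rowsym nu * hypsum k))"
    by (simp add: zonal_def mult.assoc scal_commute_left)
  also have "\<dots> = scal (c nu) * (scal \<mu> * (rowsym nu * colalt nu * (rowsym nu * hypsum k)))"
    by (simp only: mu(2)) (simp only: mult.assoc)
  finally have "rowsym nu * colalt nu * (rowsym nu * hypsum k) = 0"
    using scal_mult_eq_0 mu(1) nuE(2) by metis
  \<comment> \<open>One more factor \<open>hypsum k\<close> on the left restores the zonal
    element.\<close>
  hence "zonal k nu = 0" by (simp add: zonal_def mult.assoc)
  thus False using zonal_nonzero nuE(1) by blast
qed

section \<open>Double cosets of the hyperoctahedral group\<close>

text \<open>The second matching on the positions of a cycle of length \<open>m\<close>: it joins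
  \<open>2i+1\<close> to \<open>2i+2\<close> cyclically, so the last position \<open>m - 1\<close>
  is joined to 0. The first matching on positions is \<open>mate\<close>.\<close>

definition cyc_nbr :: "nat \<Rightarrow> nat \<Rightarrow> nat" where
  "cyc_nbr m i = (if even i then (if i = 0 then m - 1 else i - 1) else if Suc i = m then 0 else Suc i)"

text \<open>A cycle of the union of two perfect matchings, listed so that the first matching pairs the entries
  at \<open>2i\<close> and \<open>2i+1\<close>; a doubled edge is a cycle of length 2.\<close>

definition alt_cycle :: "(nat \<Rightarrow> nat) \<Rightarrow> (nat \<Rightarrow> nat) \<Rightarrow> nat list \<Rightarrow> bool" where
  "alt_cycle s s' c \<longleftrightarrow> c \<noteq> [] \<and> even (length c) \<and>
     (\<forall>i<length c. s (c ! i) = c ! mate i \<and> s' (c ! i) = c ! cyc_nbr (length c) i)"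

definition matching_on :: "nat set \<Rightarrow> (nat \<Rightarrow> nat) \<Rightarrow> bool" where
  "matching_on A s \<longleftrightarrow> (\<forall>x\<in>A. s x \<in> A \<and> s (s x) = x \<and> s x \<noteq> x)"

lemma cyc_nbr_less: "even m \<Longrightarrow> i < m \<Longrightarrow> cyc_nbr m i < m"
  by (auto simp: cyc_nbr_def)

text \<open>A longest alternating path beginning and ending with an edge of \<open>s\<close> closes
  up. The \<open>s'\<close>-partner of its last vertex lies on it, since otherwise two vertices
  could be appended; and all inner vertices already have their \<open>s'\<close>-partners on the
  path, so only the first vertex is left.\<close>

lemma alt_cycle_exists:
  assumes fin: "finite A" and s: "matching_on A s" and s': "matching_on A s'" and a: "a \<in> A"
  shows "\<exists>c. alt_cycle s s' c \<and> distinct c \<and> set c \<subseteq> A"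
proof -
  define path where "path c \<longleftrightarrow> c \<noteq> [] \<and> even (length c) \<and> distinct c \<and> set c \<subseteq> A \<and>
     (\<forall>i<length c. s (c ! i) = c ! mate i) \<and> (\<forall>i. odd i \<longrightarrow> Suc i < length c \<longrightarrow> s' (c ! i) = c ! Suc i)" for c
  have "path [a, s a]"
    using s a by (auto simp: path_def matching_on_def mate_def less_Suc_eq nth_Cons split: nat.splits)
  moreover have "\<forall>c. path c \<longrightarrow> length c < Suc (card A)"
    using fin by (auto simp: path_def less_Suc_eq_le) (metis card_mono distinct_card)
  ultimately obtain c where c: "path c" and max: "\<And>d. path d \<Longrightarrow> length d \<le> length c"
    using ex_has_greatest_nat[of path "[a, s a]" length] by blast
  define m where "m = length c"
  have m: "m > 0" "even m" "distinct c" "set c \<subseteq> A" using c by (auto simp: path_def m_def)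
  have cs: "s (c ! i) = c ! mate i" if "i < m" for i using c that by (auto simp: path_def m_def)
  have cs': "s' (c ! i) = c ! Suc i" if "odd i" "Suc i < m" for i using c that by (auto simp: path_def m_def)
  have inA: "c ! i \<in> A" if "i < m" for i using m that by (auto simp: m_def)
  have closed: "s x \<in> set c" if x: "x \<in> set c" for x
  proof -
    obtain i where i: "i < m" "x = c ! i" using x by (auto simp: in_set_conv_nth m_def)
    thus ?thesis using cs[OF i(1)] mate_less[OF m(2), of i] by (simp add: m_def)
  qed
  define y where "y = s' (c ! (m - 1))"
  have l: "m - 1 < m" using m by simp
  have yA: "y \<in> A" "s' y = c ! (m - 1)" "y \<noteq> c ! (m - 1)"
    using s' inA[OF l] by (auto simp: matching_on_def y_def)
  have "y \<in> set c"
  proof (rule ccontr)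
    assume y: "y \<notin> set c"
    have sy: "s y \<notin> set c" using closed[of "s y"] y s yA by (auto simp: matching_on_def)
    have "path (c @ [y, s y])"
      unfolding path_def
    proof (intro conjI allI impI)
      show "distinct (c @ [y, s y])" using m y sy s yA by (auto simp: matching_on_def)
      show "set (c @ [y, s y]) \<subseteq> A" using m yA s by (auto simp: matching_on_def)
      fix i
      show "s ((c @ [y, s y]) ! i) = (c @ [y, s y]) ! mate i" if "i < length (c @ [y, s y])"
      proof (cases "i < m")
        case True
        thus ?thesis using cs[OF True] mate_less[OF m(2), of i] by (simp add: nth_append m_def)
      next
        case False
        hence "i = m \<or> i = Suc m" using that by (auto simp: m_def)
        moreover have "mate m = Suc m" "mate (Suc m) = m" using m(2) by (auto simp: mate_def)
        ultimately show ?thesis using s yA by (auto simp: nth_append m_def matching_on_def)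
      qed
      show "s' ((c @ [y, s y]) ! i) = (c @ [y, s y]) ! Suc i" if "odd i" "Suc i < length (c @ [y, s y])"
      proof (cases "Suc i < m")
        case True
        thus ?thesis using cs'[OF that(1) True] by (simp add: nth_append m_def)
      next
        case False
        hence "Suc i = m" using that m(2) by (auto simp: m_def less_Suc_eq)
        hence "i = m - 1" "i < length c" "Suc i = length c" by (auto simp: m_def)
        thus ?thesis by (simp add: nth_append y_def)
      qed
    qed (use m in \<open>auto simp: m_def\<close>)
    from max[OF this] show False by simp
  qed
  then obtain j where j: "j < m" "y = c ! j" by (auto simp: in_set_conv_nth m_def)
  have nth: "c ! i = c ! i' \<Longrightarrow> i < m \<Longrightarrow> i' < m \<Longrightarrow> i = i'" for i i'
    using m(3) by (simp add: nth_eq_iff_index_eq m_def)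
  have s'inv: "s' (s' (c ! i)) = c ! i" if "i < m" for i using s' inA[OF that] by (auto simp: matching_on_def)
  have "j = 0"
  proof (rule ccontr)
    assume j0: "j \<noteq> 0"
    show False
    proof (cases "even j")
      case True
      hence "odd (j - 1)" "Suc (j - 1) = j" using j0 by auto
      hence "s' (c ! (j - 1)) = y" using cs'[of "j - 1"] j by simp
      hence "c ! (j - 1) = c ! (m - 1)" using s'inv[of "j - 1"] j yA(2) by simp
      hence "j - 1 = m - 1" by (rule nth) (use j in auto)
      thus False using j j0 by simp
    next
      case False
      have "j \<noteq> m - 1" using j yA(3) by auto
      hence sj: "Suc j < m" using j by simp
      hence "c ! Suc j = c ! (m - 1)" using cs'[OF False sj] yA(2) j by simp
      hence "Suc j = m - 1" by (rule nth) (use sj in auto)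
      thus False using False m(1,2) by (metis One_nat_def Suc_pred even_Suc)
    qed
  qed
  hence y0: "y = c ! 0" using j by simp
  have "s' (c ! i) = c ! cyc_nbr m i" if i: "i < m" for i
  proof (cases "even i")
    case True
    show ?thesis
    proof (cases "i = 0")
      case False
      hence "odd (i - 1)" "Suc (i - 1) = i" using True by auto
      hence "s' (c ! (i - 1)) = c ! i" using cs'[of "i - 1"] i by simp
      thus ?thesis using s'inv[of "i - 1"] i True False by (simp add: cyc_nbr_def)
    qed (use yA(2) y0 in \<open>simp add: cyc_nbr_def\<close>)
  next
    case False
    show ?thesis
    proof (cases "Suc i = m")
      case True
      thus ?thesis using y0 False by (auto simp: y_def cyc_nbr_def)
    qed (use cs'[OF False] i False in \<open>simp add: cyc_nbr_def\<close>)
  qed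
  hence "alt_cycle s s' c" using m cs by (auto simp: alt_cycle_def m_def)
  thus ?thesis using m by blast
qed

lemma alt_cycles_exist:
  assumes "finite A" "matching_on A s" "matching_on A s'"
  shows "\<exists>cs. (\<forall>c\<in>set cs. alt_cycle s s' c) \<and> distinct (concat cs) \<and> set (concat cs) = A"
  using assms
proof (induction A rule: finite_psubset_induct)
  case (psubset A)
  show ?case
  proof (cases "A = {}")
    case True thus ?thesis by (intro exI[of _ "[]"]) simp
  next
    case False
    then obtain a where "a \<in> A" by blast
    then obtain c where c: "alt_cycle s s' c" "distinct c" "set c \<subseteq> A"
      using alt_cycle_exists psubset by metis
    have cl: "s x \<in> set c" "s' x \<in> set c" if x: "x \<in> set c" for x
    proof -
      obtain i where i: "i < length c" "x = c ! i" using x by (auto simp: in_set_conv_nth)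
      thus "s x \<in> set c" "s' x \<in> set c"
        using c(1) mate_less[of "length c" i] cyc_nbr_less[of "length c" i] by (auto simp: alt_cycle_def)
    qed
    have m: "matching_on (A - set c) s" "matching_on (A - set c) s'"
      using psubset.prems cl by (auto simp: matching_on_def) metis+
    have "A - set c \<subset> A" using c by (cases c) (auto simp: alt_cycle_def)
    from psubset.IH[OF this m] obtain cs where cs: "\<forall>c\<in>set cs. alt_cycle s s' c" "distinct (concat cs)" "set (concat cs) = A - set c"
      by blast
    show ?thesis by (intro exI[of _ "c # cs"]) (use c cs in auto)
  qed
qed

text \<open>The second matching is the translate of the first by \<open>x\<close>. Multiplying
  \<open>x\<close> by H on the right leaves it unchanged, and on the left relabels both matchings
  alike; so the cycle lengths depend only on the double coset.\<close>

definition coset_type :: "nat \<Rightarrow> natperm \<Rightarrow> nat list \<Rightarrow> bool" where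
  "coset_type k x la \<longleftrightarrow> (\<exists>cs. map length cs = la \<and> distinct (concat cs) \<and> set (concat cs) = {..<2 * k} \<and>
     (\<forall>c\<in>set cs. alt_cycle mate (prm x \<circ> mate \<circ> inv (prm x)) c))"

lemma coset_type_exists:
  assumes x: "x \<in> symgrp (2 * k)"
  shows "\<exists>la\<in>even_partitions (2 * k). coset_type k x la"
proof -
  let ?s' = "prm x \<circ> mate \<circ> inv (prm x)"
  have "matching_on {..<2 * k} mate" by (auto simp: matching_on_def mate_less)
  moreover have "matching_on {..<2 * k} ?s'"
    by (auto simp: matching_on_def mate_less symgrp_less[OF x]) (metis mate_neq prm_uminus_prm(1))
  ultimately obtain cs where cs: "\<forall>c\<in>set cs. alt_cycle mate ?s' c" "distinct (concat cs)" "set (concat cs) = {..<2 * k}"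
    using alt_cycles_exist[of "{..<2 * k}"] by blast
  define ds where "ds = rev (sort_key length cs)"
  have mds: "mset ds = mset cs" by (simp add: ds_def)
  have sds: "set ds = set cs" by (simp add: ds_def)
  have "mset (concat ds) = mset (concat cs)"
    by (simp add: mset_concat flip: sum_mset_sum_list) (simp add: mds)
  hence dd: "distinct (concat ds)" using cs(2) mset_eq_imp_distinct_iff by blast
  have sd: "set (concat ds) = {..<2 * k}" using cs(3) sds by simp
  have "is_partition (map length ds)"
  proof -
    have "sorted (map length (rev ds))" by (simp add: ds_def)
    hence "sorted_wrt (\<ge>) (map length ds)" by (simp add: sorted_wrt_rev flip: rev_map)
    moreover have "\<forall>c\<in>set ds. c \<noteq> []" using cs(1) sds by (auto simp: alt_cycle_def)
    ultimately show ?thesis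
      by (auto simp: is_partition_def sorted_wrt_iff_nth_Suc_transp[OF transp_on_ge])
  qed
  moreover have "sum_list (map length ds) = 2 * k"
    using distinct_card[OF dd] sd by (simp add: length_concat)
  moreover have "\<forall>c\<in>set ds. even (length c)" using cs(1) sds by (auto simp: alt_cycle_def)
  ultimately have "map length ds \<in> even_partitions (2 * k)" by (auto simp: even_partitions_def)
  moreover have "coset_type k x (map length ds)"
    unfolding coset_type_def using dd sd cs(1) sds by blast
  ultimately show ?thesis by blast
qed

text \<open>Cycles written one after the other are the rows of a shape, so \<open>row_of\<close> and
  \<open>col_of\<close> locate the entries.\<close>

lemma concat_cell: "r < length cs \<Longrightarrow> j < length (cs ! r) \<Longrightarrow> concat cs ! cell (map length cs) r j = cs ! r ! j"
proof (induction cs arbitrary: r)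
  case (Cons c cs)
  show ?case
  proof (cases r)
    case (Suc q)
    have "cell (map length (c # cs)) r j = length c + cell (map length cs) q j"
      by (simp add: Suc cell_def)
    thus ?thesis using Cons Suc by (simp add: nth_append)
  qed (use Cons in \<open>simp add: cell_def nth_append\<close>)
qed simp

lemma alt_cycle_concat:
  assumes cs: "\<forall>c\<in>set cs. alt_cycle s s' c" and i: "i < sum_list (map length cs)"
  defines "la \<equiv> map length cs"
  shows "cell la (row_of la i) (mate (col_of la i)) < sum_list la \<and>
      s (concat cs ! i) = concat cs ! cell la (row_of la i) (mate (col_of la i))"
    "cell la (row_of la i) (cyc_nbr (la ! row_of la i) (col_of la i)) < sum_list la \<and>
      s' (concat cs ! i) = concat cs ! cell la (row_of la i) (cyc_nbr (la ! row_of la i) (col_of la i))"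
proof -
  let ?r = "row_of la i" and ?c = "col_of la i"
  have r: "?r < length cs" and c: "?c < length (cs ! ?r)" and cell: "cell la ?r ?c = i"
    using row_col[of i la] i by (auto simp: la_def)
  have alt: "alt_cycle s s' (cs ! ?r)" using cs r by auto
  hence ev: "even (length (cs ! ?r))" by (simp add: alt_cycle_def)
  have lr: "?r < length la" "la ! ?r = length (cs ! ?r)" using r by (auto simp: la_def)
  have c1: "mate ?c < length (cs ! ?r)" using c mate_less[OF ev] by simp
  have c2: "cyc_nbr (la ! ?r) ?c < length (cs ! ?r)" using cyc_nbr_less[OF ev c] lr by simp
  have ci: "concat cs ! i = cs ! ?r ! ?c" using concat_cell[OF r c] cell by (simp add: la_def)
  show "cell la ?r (mate ?c) < sum_list la \<and> s (concat cs ! i) = concat cs ! cell la ?r (mate ?c)"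
    using cell_less[of ?r la "mate ?c"] lr c1 concat_cell[OF r c1] alt c ci by (simp add: alt_cycle_def la_def)
  show "cell la ?r (cyc_nbr (la ! ?r) ?c) < sum_list la \<and>
      s' (concat cs ! i) = concat cs ! cell la ?r (cyc_nbr (la ! ?r) ?c)"
    using cell_less[of ?r la "cyc_nbr (la ! ?r) ?c"] lr c2 concat_cell[OF r c2] alt c ci by (simp add: alt_cycle_def la_def)
qed

text \<open>Pairing the cycles entry by entry gives a permutation \<open>g\<close> that respects the
  first matching and carries the second one of \<open>x\<close> to that of \<open>y\<close>. So
  \<open>g\<close> and \<open>h = - y + g + x\<close> both lie in H, and
  \<open>g + x = y + h\<close>; e absorbs \<open>g\<close> on the left and \<open>h\<close> on the
  right.\<close>

lemma coset_type_eq: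
  assumes x: "x \<in> symgrp (2 * k)" and y: "y \<in> symgrp (2 * k)" and tx: "coset_type k x la" and ty: "coset_type k y la"
  shows "hypsum k * sng x 1 * hypsum k = hypsum k * sng y 1 * hypsum k"
proof -
  let ?n = "2 * k"
  let ?sx = "prm x \<circ> mate \<circ> inv (prm x)" and ?sy = "prm y \<circ> mate \<circ> inv (prm y)"
  obtain cs where cs: "map length cs = la" "distinct (concat cs)" "set (concat cs) = {..<?n}" "\<forall>c\<in>set cs. alt_cycle mate ?sx c"
    using tx by (auto simp: coset_type_def)
  obtain ds where ds: "map length ds = la" "distinct (concat ds)" "set (concat ds) = {..<?n}" "\<forall>c\<in>set ds. alt_cycle mate ?sy c"
    using ty by (auto simp: coset_type_def)
  define xs where "xs = concat cs"
  define ys where "ys = concat ds"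
  have len: "length xs = ?n" "length ys = ?n"
    using distinct_card[OF cs(2)] distinct_card[OF ds(2)] cs(3) ds(3) by (auto simp: xs_def ys_def)
  have sl: "sum_list la = ?n" using len cs(1) by (simp add: xs_def length_concat)
  define f where "f \<alpha> = (if \<alpha> < ?n then ys ! (THE i. i < ?n \<and> xs ! i = \<alpha>) else \<alpha>)" for \<alpha>
  have xlt: "xs ! i < ?n" "ys ! i < ?n" if "i < ?n" for i
    using cs(3) ds(3) len that nth_mem by (metis lessThan_iff xs_def ys_def)+
  have fx: "f (xs ! i) = ys ! i" if "i < ?n" for i
  proof -
    have "(THE j. j < ?n \<and> xs ! j = xs ! i) = i"
      by (rule the_equality) (use that cs(2) len in \<open>auto simp: nth_eq_iff_index_eq xs_def\<close>)
    thus ?thesis using xlt that by (simp add: f_def)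
  qed
  have ex: "\<exists>i<?n. \<alpha> = xs ! i" if "\<alpha> < ?n" for \<alpha>
    using that cs(3) len by (metis in_set_conv_nth lessThan_iff xs_def)
  have fperm: "f permutes {..<?n}"
  proof (rule permutes_lessThanI)
    show "f \<alpha> < ?n" if "\<alpha> < ?n" for \<alpha> using ex[OF that] fx xlt by auto
    show "inj_on f {..<?n}"
    proof (rule inj_onI)
      fix \<alpha> \<beta> assume "\<alpha> \<in> {..<?n}" "\<beta> \<in> {..<?n}" and e: "f \<alpha> = f \<beta>"
      then obtain i j where ij: "i < ?n" "\<alpha> = xs ! i" "j < ?n" "\<beta> = xs ! j" using ex by blast
      hence "i = j" using e ds(2) len fx by (simp add: nth_eq_iff_index_eq ys_def)
      thus "\<alpha> = \<beta>" using ij by simp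
    qed
  qed (simp add: f_def)
  define g where "g = Natperm f"
  have pg: "prm g = f" unfolding g_def using fperm by (rule prm_Natperm)
  have gS: "g \<in> symgrp ?n" using fperm by (simp add: symgrp_def pg)
  have gm: "f (mate \<alpha>) = mate (f \<alpha>)" if "\<alpha> < ?n" for \<alpha>
  proof -
    obtain i where i: "i < ?n" "\<alpha> = xs ! i" using ex[OF \<open>\<alpha> < ?n\<close>] by blast
    show ?thesis
      using alt_cycle_concat(1)[OF cs(4), of i] alt_cycle_concat(1)[OF ds(4), of i] i cs(1) ds(1) sl fx
      by (simp flip: xs_def ys_def)
  qed
  have gs: "f (?sx \<alpha>) = ?sy (f \<alpha>)" if "\<alpha> < ?n" for \<alpha>
  proof -
    obtain i where i: "i < ?n" "\<alpha> = xs ! i" using ex[OF \<open>\<alpha> < ?n\<close>] by blast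
    show ?thesis
      using alt_cycle_concat(2)[OF cs(4), of i] alt_cycle_concat(2)[OF ds(4), of i] i cs(1) ds(1) sl fx
      by (simp flip: xs_def ys_def)
  qed
  have gH: "g \<in> hypgrp k" using hypgrpI[OF gS] gm by (simp add: pg)
  define h where "h = - y + g + x"
  have hH: "h \<in> hypgrp k"
  proof (rule hypgrpI)
    show "h \<in> symgrp ?n" using x y gS by (simp add: h_def symgrp_plus symgrp_uminus)
    fix \<alpha> assume a: "\<alpha> < ?n"
    have xa: "prm x \<alpha> < ?n" using symgrp_less(1)[OF x] a by simp
    have "f (prm x (mate \<alpha>)) = prm y (mate (inv (prm y) (f (prm x \<alpha>))))"
      using gs[OF xa] by simp
    thus "prm h (mate \<alpha>) = mate (prm h \<alpha>)" by (simp add: h_def pg)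
  qed
  have "hypsum k * sng x 1 * hypsum k = (hypsum k * sng g 1) * sng x 1 * hypsum k"
    using hypgrp.right_mult[OF gH] by (simp add: hypsum_def)
  also have "\<dots> = hypsum k * sng (y + h) 1 * hypsum k"
    by (simp add: h_def mult.assoc) (simp add: mult_single add.assoc flip: mult.assoc)
  also have "\<dots> = hypsum k * sng y 1 * (sng h 1 * hypsum k)"
    by (simp add: mult.assoc) (simp add: mult_single flip: mult.assoc)
  also have "sng h 1 * hypsum k = hypsum k"
    using hypgrp.left_mult[OF hH] by (simp add: hypsum_def)
  finally show ?thesis .
qed

text \<open>The elements e x e span all biinvariant elements and take at most one value per even
  partition. The zonal elements are as many, biinvariant and independent, so they span as well; and
  e itself is biinvariant.\<close>

lemma hypsum_decomposition:
  obtains c where "hypsum k = (\<Sum>la\<in>even_partitions (2 * k). scal (c la) * zonal k la)"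
proof -
  let ?P = "even_partitions (2 * k)"
  define E where "E = (\<lambda>x. hypsum k * sng x 1 * hypsum k) ` symgrp (2 * k)"
  have finE: "finite E" by (simp add: E_def finite_symgrp)
  define rp where "rp la = (SOME x. x \<in> symgrp (2 * k) \<and> coset_type k x la)" for la
  have "E \<subseteq> (\<lambda>la. hypsum k * sng (rp la) 1 * hypsum k) ` ?P"
  proof
    fix e assume "e \<in> E"
    then obtain x where x: "x \<in> symgrp (2 * k)" "e = hypsum k * sng x 1 * hypsum k" by (auto simp: E_def)
    obtain la where la: "la \<in> ?P" "coset_type k x la" using coset_type_exists[OF x(1)] by blast
    have "rp la \<in> symgrp (2 * k) \<and> coset_type k (rp la) la"
      unfolding rp_def by (rule someI[of _ x]) (use x la in blast)
    hence "e = hypsum k * sng (rp la) 1 * hypsum k" using coset_type_eq x la by metis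
    thus "e \<in> (\<lambda>la. hypsum k * sng (rp la) 1 * hypsum k) ` ?P" using la(1) by blast
  qed
  hence cardE: "card E \<le> card ?P"
    using surj_card_le[OF finite_even_partitions] by blast
  have inspan: "hypsum k * y * hypsum k \<in> ga.span E" if "supp y \<subseteq> symgrp (2 * k)" for y
  proof -
    have "hypsum k * y * hypsum k = hypsum k * (\<Sum>g\<in>symgrp (2 * k). sng g (coef y g)) * hypsum k"
      using galg_eq_sum[OF finite_symgrp that] by simp
    also have "\<dots> = (\<Sum>g\<in>symgrp (2 * k). scal (coef y g) * (hypsum k * sng g 1 * hypsum k))"
    proof -
      have s: "sng g d = scal d * sng g 1" for g d by (simp add: mult_single)
      show ?thesis by (subst s) (simp add: sum_distrib_left sum_distrib_right scal_commute_left mult.assoc)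
    qed
    also have "\<dots> \<in> ga.span E"
      by (rule ga.span_sum, rule ga.span_scale, rule ga.span_base) (auto simp: E_def)
    finally show ?thesis .
  qed
  have "zonal k la \<in> ga.span E" if "la \<in> ?P" for la
  proof -
    have "supp (rowsym la * colalt la * rowsym la) \<subseteq> symgrp (2 * k)"
      using that keys_basic(1,2)[of la] by (intro keys_mult_symgrp) (auto simp: even_partitions_def)
    from inspan[OF this] show ?thesis by (simp add: zonal_def mult.assoc)
  qed
  moreover have "hypsum k * 1 * hypsum k \<in> ga.span E"
    by (rule inspan) (simp add: symgrp_zero)
  moreover have "hypsum k * 1 * hypsum k = scal (real (card (hypgrp k))) * hypsum k"
    using hypgrp.square by (simp add: hypsum_def)
  ultimately have sp: "\<And>la. la \<in> ?P \<Longrightarrow> zonal k la \<in> ga.span E" "scal (real (card (hypgrp k))) * hypsum k \<in> ga.span E"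
    by auto
  have cp: "real (card (hypgrp k)) \<noteq> 0" using hypgrp.card_pos[of k] by simp
  have "scal (inverse (real (card (hypgrp k)))) * (scal (real (card (hypgrp k))) * hypsum k) \<in> ga.span E"
    by (rule ga.span_scale) (rule sp(2))
  hence "hypsum k \<in> ga.span E" using cp by (simp add: mult_single del: single_of_nat flip: mult.assoc)
  from ga.spanning_by_card[OF finite_even_partitions finE zonal_independent sp(1) cardE this, of "\<lambda>la. la"] that
  show ?thesis by blast
qed

section \<open>Koszul signs\<close>

definition tri :: "nat \<Rightarrow> (nat \<times> nat) set" where "tri n = {(\<alpha>, \<beta>). \<alpha> < \<beta> \<and> \<beta> < n}"

lemma finite_tri [simp]: "finite (tri n)"
  by (rule finite_subset[of _ "{..<n} \<times> {..<n}"]) (auto simp: tri_def)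

abbreviation msgn :: "bool \<Rightarrow> complex" where "msgn b \<equiv> (if b then - 1 else 1)"

lemma msgn_card: "finite S \<Longrightarrow> (- 1) ^ card {x \<in> S. Q x} = (\<Prod>x\<in>S. msgn (Q x))"
  by (simp add: prod.If_cases Int_def conj_commute)

text \<open>\<open>od\<close> gives the parity of the item at its old place \<open>\<alpha>\<close>,
  which moves to \<open>\<rho> \<alpha>\<close>. A product over pairs, unlike the parity of a
  cardinality, can be split and reindexed.\<close>

definition koszul :: "(nat \<Rightarrow> bool) \<Rightarrow> nat \<Rightarrow> (nat \<Rightarrow> nat) \<Rightarrow> complex" where
  "koszul od n \<rho> = (\<Prod>(\<alpha>, \<beta>)\<in>tri n. msgn (\<rho> \<beta> < \<rho> \<alpha> \<and> od \<alpha> \<and> od \<beta>))"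

lemma koszul_card: "koszul od n \<rho> = (- 1) ^ card {(\<alpha>, \<beta>). \<alpha> < \<beta> \<and> \<beta> < n \<and> \<rho> \<beta> < \<rho> \<alpha> \<and> od \<alpha> \<and> od \<beta>}"
proof -
  have "{(\<alpha>, \<beta>). \<alpha> < \<beta> \<and> \<beta> < n \<and> \<rho> \<beta> < \<rho> \<alpha> \<and> od \<alpha> \<and> od \<beta>} =
    {z \<in> tri n. \<rho> (snd z) < \<rho> (fst z) \<and> od (fst z) \<and> od (snd z)}"
    by (auto simp: tri_def)
  thus ?thesis by (simp add: msgn_card koszul_def case_prod_beta)
qed

lemma csign_koszul: "csign p I \<rho> = koszul (\<lambda>\<alpha>. oddi p (I ! \<rho> \<alpha>)) (length I) \<rho>"
  by (simp add: csign_def koszul_card)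

lemma koszul_cong: "(\<And>\<alpha>. \<alpha> < n \<Longrightarrow> od \<alpha> = od' \<alpha>) \<Longrightarrow> (\<And>\<alpha>. \<alpha> < n \<Longrightarrow> \<rho> \<alpha> = \<rho>' \<alpha>) \<Longrightarrow> koszul od n \<rho> = koszul od' n \<rho>'"
  unfolding koszul_def by (rule prod.cong) (auto simp: tri_def)

text \<open>A permutation permutes the two-element subsets; \<open>m\<close> below sends an
  increasing pair to its image put back in increasing order.\<close>

lemma prod_tri_symmetric:
  fixes F :: "nat \<Rightarrow> nat \<Rightarrow> 'a :: comm_monoid_mult"
  assumes \<rho>: "\<rho> permutes {..<n}" and sym: "\<And>\<alpha> \<beta>. F \<alpha> \<beta> = F \<beta> \<alpha>"
  shows "(\<Prod>(\<alpha>, \<beta>)\<in>tri n. F (\<rho> \<alpha>) (\<rho> \<beta>)) = (\<Prod>(\<alpha>, \<beta>)\<in>tri n. F \<alpha> \<beta>)"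
proof -
  define m where "m \<rho> = (\<lambda>(\<alpha>, \<beta>). (min (\<rho> \<alpha>) (\<rho> \<beta>), max (\<rho> \<alpha>) (\<rho> \<beta> :: nat)))" for \<rho> :: "nat \<Rightarrow> nat"
  have m: "m \<rho> z \<in> tri n \<and> m (inv \<rho>) (m \<rho> z) = z" if "\<rho> permutes {..<n}" "z \<in> tri n" for \<rho> z
  proof -
    obtain \<alpha> \<beta> where z: "z = (\<alpha>, \<beta>)" "\<alpha> < \<beta>" "\<beta> < n" using \<open>z \<in> tri n\<close> by (auto simp: tri_def)
    have lt: "\<rho> \<alpha> < n" "\<rho> \<beta> < n" using permutes_in_image[OF \<open>\<rho> permutes {..<n}\<close>] z by auto
    have "\<rho> \<alpha> \<noteq> \<rho> \<beta>" using z permutes_inj[OF \<open>\<rho> permutes {..<n}\<close>] by (metis inj_eq less_irrefl)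
    thus ?thesis using z lt permutes_inverses(2)[OF \<open>\<rho> permutes {..<n}\<close>]
      by (auto simp: m_def tri_def min_def max_def)
  qed
  have inv2: "inv (inv \<rho>) = \<rho>" using \<rho> by (simp add: permutes_inv_inv)
  show ?thesis
    by (rule prod.reindex_bij_witness[of _ "m (inv \<rho>)" "m \<rho>"])
       (use m[OF \<rho>] m[OF permutes_inv[OF \<rho>]] inv2 in \<open>auto simp: m_def min_def max_def sym\<close>)
qed

text \<open>A pair is inverted by the composite when exactly one of the two steps inverts it. The
  sign of the second step is written as a symmetric function \<open>F\<close> of the pair, so that
  it can be reindexed by \<open>\<rho>'\<close>.\<close>

lemma koszul_comp:
  assumes \<rho>': "\<rho>' permutes {..<n}" and \<rho>: "inj \<rho>"
  shows "koszul od n (\<rho> \<circ> \<rho>') = koszul od n \<rho>' * koszul (od \<circ> inv \<rho>') n \<rho>"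
proof -
  define F where "F \<alpha> \<beta> = msgn (\<rho> (max \<alpha> \<beta>) < \<rho> (min \<alpha> \<beta>) \<and> od (inv \<rho>' \<alpha>) \<and> od (inv \<rho>' \<beta>))" for \<alpha> \<beta>
  have "koszul (od \<circ> inv \<rho>') n \<rho> = (\<Prod>(\<alpha>, \<beta>)\<in>tri n. F \<alpha> \<beta>)"
    unfolding koszul_def by (rule prod.cong) (auto simp: F_def tri_def min_def max_def)
  also have "\<dots> = (\<Prod>(\<alpha>, \<beta>)\<in>tri n. F (\<rho>' \<alpha>) (\<rho>' \<beta>))"
    by (rule prod_tri_symmetric[OF \<rho>', symmetric]) (auto simp: F_def min.commute max.commute)
  finally have "koszul od n \<rho>' * koszul (od \<circ> inv \<rho>') n \<rho> =
     (\<Prod>z\<in>tri n. (case z of (\<alpha>, \<beta>) \<Rightarrow> msgn (\<rho>' \<beta> < \<rho>' \<alpha> \<and> od \<alpha> \<and> od \<beta>)) * (case z of (\<alpha>, \<beta>) \<Rightarrow> F (\<rho>' \<alpha>) (\<rho>' \<beta>)))"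
    by (simp add: koszul_def prod.distrib)
  also have "\<dots> = koszul od n (\<rho> \<circ> \<rho>')"
    unfolding koszul_def
  proof (rule prod.cong[OF refl], clarify)
    fix \<alpha> \<beta> assume "(\<alpha>, \<beta>) \<in> tri n"
    hence ab: "\<alpha> \<noteq> \<beta>" by (auto simp: tri_def)
    have inv: "inv \<rho>' (\<rho>' x) = x" for x using permutes_inverses(2)[OF \<rho>'] .
    have ne: "\<rho>' \<alpha> \<noteq> \<rho>' \<beta>" using ab inv by metis
    hence "\<rho> (\<rho>' \<alpha>) \<noteq> \<rho> (\<rho>' \<beta>)" using \<rho> by (simp add: inj_eq)
    thus "msgn (\<rho>' \<beta> < \<rho>' \<alpha> \<and> od \<alpha> \<and> od \<beta>) * F (\<rho>' \<alpha>) (\<rho>' \<beta>) = msgn ((\<rho> \<circ> \<rho>') \<beta> < (\<rho> \<circ> \<rho>') \<alpha> \<and> od \<alpha> \<and> od \<beta>)"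
      using ne by (auto simp: F_def inv min_def max_def)
  qed
  finally show ?thesis by simp
qed

lemma koszul_fixing: "(\<And>\<alpha>. \<alpha> < n \<Longrightarrow> od \<alpha> \<Longrightarrow> \<rho> \<alpha> = \<alpha>) \<Longrightarrow> koszul od n \<rho> = 1"
  unfolding koszul_def by (rule prod.neutral) (auto simp: tri_def)

text \<open>Besides the pair itself, every odd item strictly between contributes two
  inversions.\<close>

lemma koszul_transpose:
  assumes "a < b" "b < n" "od a" "od b"
  shows "koszul od n (Transposition.transpose a b) = -1"
proof -
  let ?C = "{c. a < c \<and> c < b \<and> od c}"
  have "{(\<alpha>, \<beta>). \<alpha> < \<beta> \<and> \<beta> < n \<and> Transposition.transpose a b \<beta> < Transposition.transpose a b \<alpha> \<and> od \<alpha> \<and> od \<beta>} =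
     insert (a, b) (Pair a ` ?C \<union> (\<lambda>c. (c, b)) ` ?C)" (is "?L = ?R")
  proof (rule set_eqI, clarify)
    fix \<alpha> \<beta>
    show "(\<alpha>, \<beta>) \<in> ?L \<longleftrightarrow> (\<alpha>, \<beta>) \<in> ?R"
      using assms by (auto simp: Transposition.transpose_def split: if_splits)
  qed
  moreover have "card ?R = Suc (card ?C + card ?C)"
  proof -
    have fin: "finite ?C" by simp
    have "card (Pair a ` ?C \<union> (\<lambda>c. (c, b)) ` ?C) = card (Pair a ` ?C) + card ((\<lambda>c. (c, b)) ` ?C)"
      by (rule card_Un_disjoint) auto
    also have "\<dots> = card ?C + card ?C" by (subst (1 2) card_image) (auto simp: inj_on_def)
    finally show ?thesis using fin by (subst card_insert_disjoint) auto
  qed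
  ultimately show ?thesis by (simp add: koszul_card)
qed

lemma koszul_sign:
  assumes "\<rho> permutes S" "S = {\<alpha>. \<alpha> < n \<and> od \<alpha>}"
  shows "koszul od n \<rho> = of_int (sign \<rho>)"
proof -
  have fin: "finite S" using assms(2) by simp
  have sub: "S \<subseteq> {..<n}" using assms(2) by auto
  from fin assms(1) show ?thesis
  proof (induction rule: permutes_rev_induct)
    case id
    show ?case by (simp add: koszul_fixing)
  next
    case (swap a b \<rho>)
    let ?t = "Transposition.transpose a b"
    have pt: "?t permutes S" using swap by (simp add: permutes_swap_id)
    have tn: "?t permutes {..<n}" using pt sub permutes_subset by blast
    have "koszul od n (\<rho> \<circ> ?t) = koszul od n ?t * koszul (od \<circ> inv ?t) n \<rho>"
      by (rule koszul_comp[OF tn permutes_inj[OF swap.hyps(4)]])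
    also have "koszul (od \<circ> inv ?t) n \<rho> = koszul od n \<rho>"
      by (rule koszul_cong) (use swap assms(2) in \<open>auto simp: Transposition.transpose_def\<close>)
    also have "koszul od n ?t = -1"
    proof (cases "a < b")
      case True thus ?thesis using koszul_transpose[of a b n od] swap assms(2) by auto
    next
      case False
      hence "b < a" using swap by auto
      thus ?thesis using koszul_transpose[of b a n od] swap assms(2) by (auto simp: transpose_commute)
    qed
    also have "- 1 * koszul od n \<rho> = of_int (sign (\<rho> \<circ> ?t))"
    proof -
      have "permutation \<rho>" "permutation ?t" using swap.hyps(4) fin pt by (auto simp: permutation_permutes)
      thus ?thesis using swap by (simp add: sign_compose sign_swap_id)
    qed
    finally show ?case .
  qed
qed

text \<open>Only pairs containing \<open>b\<close> change. An odd item counts when it passes the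
  item at \<open>b\<close>, and this sign is the product of a sign for standing before
  \<open>b\<close> and a sign for landing before \<open>\<rho> b\<close>.\<close>

lemma koszul_toggle:
  assumes b: "b < n" and \<rho>: "\<rho> permutes {..<n}" and od: "od b" "\<not> od' b" "\<And>\<gamma>. \<gamma> \<noteq> b \<Longrightarrow> od' \<gamma> = od \<gamma>"
  shows "koszul od n \<rho> = koszul od' n \<rho> * (\<Prod>\<gamma><b. msgn (od \<gamma>)) * (\<Prod>\<gamma><\<rho> b. msgn (od (inv \<rho> \<gamma>)))"
proof -
  define P where "P = (\<lambda>\<gamma>. (\<gamma>, b)) ` {..<b} \<union> Pair b ` {b<..<n}"
  define Q where "Q = tri n - P"
  have PQ: "tri n = P \<union> Q" "P \<inter> Q = {}" "finite P" "finite Q"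
    using b by (auto simp: P_def Q_def tri_def simp del: finite_tri)
      (rule finite_subset[OF _ finite_tri[of n]], auto simp: tri_def)
  let ?f = "\<lambda>od (\<alpha>, \<beta>). msgn (\<rho> \<beta> < \<rho> \<alpha> \<and> od \<alpha> \<and> od \<beta>)"
  have split: "koszul od n \<rho> = prod (?f od) P * prod (?f od) Q" for od
    unfolding koszul_def PQ(1) by (rule prod.union_disjoint) (use PQ in auto)
  have Qeq: "prod (?f od) Q = prod (?f od') Q"
  proof (rule prod.cong[OF refl], clarify)
    fix \<alpha> \<beta> assume "(\<alpha>, \<beta>) \<in> Q"
    hence "\<alpha> \<noteq> b" "\<beta> \<noteq> b" by (auto simp: Q_def P_def tri_def image_iff)
    thus "msgn (\<rho> \<beta> < \<rho> \<alpha> \<and> od \<alpha> \<and> od \<beta>) = msgn (\<rho> \<beta> < \<rho> \<alpha> \<and> od' \<alpha> \<and> od' \<beta>)"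
      by (simp add: od(3))
  qed
  have P1: "prod (?f od') P = 1"
    by (rule prod.neutral) (use od in \<open>auto simp: P_def\<close>)
  have "prod (?f od) P = prod (?f od) ((\<lambda>\<gamma>. (\<gamma>, b)) ` {..<b}) * prod (?f od) (Pair b ` {b<..<n})"
    unfolding P_def by (rule prod.union_disjoint) auto
  also have "\<dots> = (\<Prod>\<gamma><b. msgn (\<rho> b < \<rho> \<gamma> \<and> od \<gamma>)) * (\<Prod>\<gamma>\<in>{b<..<n}. msgn (\<rho> \<gamma> < \<rho> b \<and> od \<gamma>))"
    by (subst (1 2) prod.reindex) (auto simp: inj_on_def od(1))
  finally have P2: "prod (?f od) P = (\<Prod>\<gamma><b. msgn (\<rho> b < \<rho> \<gamma> \<and> od \<gamma>)) * (\<Prod>\<gamma>\<in>{b<..<n}. msgn (\<rho> \<gamma> < \<rho> b \<and> od \<gamma>))" .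
  have "\<rho> b < n" using permutes_in_image[OF \<rho>, of b] b by simp
  have rl: "\<rho> \<gamma> < n \<longleftrightarrow> \<gamma> < n" for \<gamma> using permutes_in_image[OF \<rho>, of \<gamma>] by simp
  have "(\<Prod>\<gamma><\<rho> b. msgn (od (inv \<rho> \<gamma>))) = (\<Prod>\<gamma>\<in>{\<gamma>. \<gamma> < n \<and> \<rho> \<gamma> < \<rho> b}. msgn (od \<gamma>))"
    by (rule prod.reindex_bij_witness[of _ \<rho> "inv \<rho>"])
       (use permutes_inverses[OF \<rho>] rl \<open>\<rho> b < n\<close> in \<open>auto intro: order.strict_trans\<close>, metis order.strict_trans)
  also have "\<dots> = (\<Prod>\<gamma><n. msgn (\<rho> \<gamma> < \<rho> b \<and> od \<gamma>))"
    by (rule prod.mono_neutral_cong_left) auto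
  also have "{..<n} = {..<b} \<union> {b} \<union> {b<..<n}" using b by auto
  also have "(\<Prod>\<gamma>\<in>{..<b} \<union> {b} \<union> {b<..<n}. msgn (\<rho> \<gamma> < \<rho> b \<and> od \<gamma>)) =
     (\<Prod>\<gamma><b. msgn (\<rho> \<gamma> < \<rho> b \<and> od \<gamma>)) * (\<Prod>\<gamma>\<in>{b<..<n}. msgn (\<rho> \<gamma> < \<rho> b \<and> od \<gamma>))"
  proof -
    have "{..<b} \<inter> {b<..<n} = {}" by auto
    thus ?thesis by (simp add: prod.union_disjoint)
  qed
  finally have R: "(\<Prod>\<gamma><\<rho> b. msgn (od (inv \<rho> \<gamma>))) = \<dots>" .
  have "(\<Prod>\<gamma><b. msgn (\<rho> b < \<rho> \<gamma> \<and> od \<gamma>)) = (\<Prod>\<gamma><b. msgn (od \<gamma>)) * (\<Prod>\<gamma><b. msgn (\<rho> \<gamma> < \<rho> b \<and> od \<gamma>))"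
    unfolding prod.distrib[symmetric]
  proof (rule prod.cong[OF refl])
    fix \<gamma> assume "\<gamma> \<in> {..<b}"
    hence "\<rho> \<gamma> \<noteq> \<rho> b" using permutes_inj[OF \<rho>] by (metis inj_eq lessThan_iff less_irrefl)
    thus "msgn (\<rho> b < \<rho> \<gamma> \<and> od \<gamma>) = msgn (od \<gamma>) * msgn (\<rho> \<gamma> < \<rho> b \<and> od \<gamma>)" by auto
  qed
  with R P2 have "prod (?f od) P = (\<Prod>\<gamma><b. msgn (od \<gamma>)) * (\<Prod>\<gamma><\<rho> b. msgn (od (inv \<rho> \<gamma>)))" by simp
  thus ?thesis using split[of od] split[of od'] Qeq P1 by simp
qed

section \<open>The action of the group algebra on tensors\<close>

interpretation fn: vector_space "smul :: complex \<Rightarrow> ('x \<Rightarrow> complex) \<Rightarrow> ('x \<Rightarrow> complex)"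
  by unfold_locales (auto simp: smul_def algebra_simps fun_eq_iff)

lemma smul_apply [simp]: "smul c f x = c * f x"
  by (simp add: smul_def)

lemma smul_neg_self: "f = smul (- 1) f \<Longrightarrow> f = 0"
proof -
  assume "f = smul (- 1) f"
  hence "f x = - f x" for x by (metis smul_apply mult_minus1)
  thus ?thesis by (simp add: fun_eq_iff)
qed

lemma sum_apply [simp]: "(\<Sum>i\<in>A. f i) x = (\<Sum>i\<in>A. f i x)" for f :: "'i \<Rightarrow> 'x \<Rightarrow> complex"
  by (induction A rule: infinite_finite_induct) auto

definition tens :: "nat \<Rightarrow> nat \<Rightarrow> nat \<Rightarrow> (nat list \<Rightarrow> complex) set" where
  "tens p q n = {f. \<forall>J. J \<notin> seqs p q n \<longrightarrow> f J = 0}"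

text \<open>Coefficient functions are pulled back, which makes this a left action; on basis tensors
  it is the signed action underlying \<open>young_vec\<close> (see
  \<open>pop_delta\<close>).\<close>

definition pop :: "nat \<Rightarrow> nat \<Rightarrow> natperm \<Rightarrow> (nat list \<Rightarrow> complex) \<Rightarrow> (nat list \<Rightarrow> complex)" where
  "pop p n g f = (\<lambda>J. if length J = n
     then koszul (\<lambda>\<alpha>. oddi p (J ! \<alpha>)) n (inv (prm g)) * f (permute_list (prm g) J) else 0)"

text \<open>Summing over all of \<open>symgrp n\<close> rather than over the support makes linearity
  in \<open>x\<close> immediate. Terms outside the group are dropped, hence the support conditions
  of \<open>act_mult\<close>.\<close>

definition act :: "nat \<Rightarrow> nat \<Rightarrow> galg \<Rightarrow> (nat list \<Rightarrow> complex) \<Rightarrow> (nat list \<Rightarrow> complex)" where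
  "act p n x f = (\<Sum>g\<in>symgrp n. smul (of_real (coef x g)) (pop p n g f))"

lemma finite_seqs: "finite (seqs p q n)"
  using finite_lists_length_eq[of "{..<p + q}" n] by (simp add: seqs_def conj_commute)

lemma tens_delta: "I \<in> seqs p q n \<Longrightarrow> delta I \<in> tens p q n"
  by (auto simp: tens_def delta_def)

lemma subspace_tens: "fn.subspace (tens p q n)"
  by (auto simp: tens_def fn.subspace_def)

lemma tens_expand: "f \<in> tens p q n \<Longrightarrow> f = (\<Sum>I\<in>seqs p q n. smul (f I) (delta I))"
  by (rule ext) (auto simp: delta_def finite_seqs tens_def if_distrib cong: if_cong)

lemma permute_list_seqs: "g \<in> symgrp n \<Longrightarrow> length J = n \<Longrightarrow> permute_list (prm g) J \<in> seqs p q n \<longleftrightarrow> J \<in> seqs p q n"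
  by (auto simp: seqs_def symgrp_def)

lemma pop_tens: "g \<in> symgrp n \<Longrightarrow> f \<in> tens p q n \<Longrightarrow> pop p n g f \<in> tens p q n"
  using permute_list_seqs by (auto simp: tens_def pop_def)

text \<open>The sign of a product splits by \<open>koszul_comp\<close>, the second factor being that
  of the already permuted sequence.\<close>

lemma pop_plus:
  assumes g: "g \<in> symgrp n" and h: "h \<in> symgrp n"
  shows "pop p n (g + h) f = pop p n g (pop p n h f)"
proof
  fix J
  show "pop p n (g + h) f J = pop p n g (pop p n h f) J"
  proof (cases "length J = n")
    case True
    let ?o = "\<lambda>\<alpha>. oddi p (J ! \<alpha>)"
    have gp: "prm g permutes {..<n}" and hp: "prm h permutes {..<n}" using g h by (auto simp: symgrp_def)
    have ig: "inv (prm g) permutes {..<n}" using gp by (rule permutes_inv)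
    have inj: "inj (inv (prm h))" by (simp add: bij_is_inj bij_imp_bij_inv)
    have "koszul ?o n (inv (prm g \<circ> prm h)) = koszul ?o n (inv (prm h) \<circ> inv (prm g))"
      by (simp add: o_inv_distrib)
    also have "\<dots> = koszul ?o n (inv (prm g)) * koszul (?o \<circ> inv (inv (prm g))) n (inv (prm h))"
      by (rule koszul_comp[OF ig inj])
    also have "koszul (?o \<circ> inv (inv (prm g))) n (inv (prm h)) = koszul (\<lambda>\<alpha>. oddi p (permute_list (prm g) J ! \<alpha>)) n (inv (prm h))"
      by (rule koszul_cong) (use gp True in \<open>auto simp: permute_list_nth inv_inv_eq\<close>)
    finally show ?thesis using True hp permute_list_compose[of "prm h" J "prm g"] by (simp add: pop_def o_def)
  qed (simp add: pop_def)
qed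

lemma pop_delta:
  assumes g: "g \<in> symgrp n" and I: "length I = n"
  shows "pop p n g (delta I) = smul (csign p I (inv (prm g))) (delta (pact (prm g) I))"
proof
  fix J
  have gp: "prm g permutes {..<n}" using g by (auto simp: symgrp_def)
  have ip: "inv (prm g) permutes {..<n}" using gp by (rule permutes_inv)
  have pact: "pact (prm g) I = permute_list (inv (prm g)) I" using I by (simp add: pact_def permute_list_def)
  have eq: "permute_list (prm g) J = I \<longleftrightarrow> J = permute_list (inv (prm g)) I" if "length J = n"
  proof -
    have "permute_list (inv (prm g)) (permute_list (prm g) J) = J"
      using permute_list_compose[of "inv (prm g)" J "prm g"] ip that by (simp add: surj_iff[THEN iffD1] bij_is_surj)
    moreover have "permute_list (prm g) (permute_list (inv (prm g)) I) = I"
      using permute_list_compose[of "prm g" I "inv (prm g)"] gp I by (simp add: bij_is_inj)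
    ultimately show ?thesis by metis
  qed
  show "pop p n g (delta I) J = smul (csign p I (inv (prm g))) (delta (pact (prm g) I)) J"
  proof (cases "J = permute_list (inv (prm g)) I")
    case True
    have "koszul (\<lambda>\<alpha>. oddi p (J ! \<alpha>)) n (inv (prm g)) = csign p I (inv (prm g))"
      unfolding csign_koszul I by (rule koszul_cong) (use True ip I in \<open>auto simp: permute_list_nth\<close>)
    thus ?thesis using True eq I by (simp add: pop_def delta_def pact)
  next
    case False
    thus ?thesis using eq by (auto simp: pop_def delta_def pact)
  qed
qed

lemma pop_add: "pop p n g (f + f') = pop p n g f + pop p n g f'"
  and pop_smul: "pop p n g (smul c f) = smul c (pop p n g f)"
  by (auto simp: pop_def fun_eq_iff algebra_simps)

lemma act_linear: "Vector_Spaces.linear smul smul (act p n x)"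
  by unfold_locales (simp_all add: act_def pop_add pop_smul fn.scale_right_distrib sum.distrib
      fn.scale_sum_right mult.commute)

lemmas act_add = Vector_Spaces.linear.axioms(3)[OF act_linear, THEN module_hom.add]
  and act_smul = Vector_Spaces.linear.axioms(3)[OF act_linear, THEN module_hom.scale]
  and act_sum = Vector_Spaces.linear.axioms(3)[OF act_linear, THEN module_hom.sum]
  and act_0 = Vector_Spaces.linear.axioms(3)[OF act_linear, THEN module_hom.zero]

lemma act_plus_left: "act p n (x + y) f = act p n x f + act p n y f"
  by (simp add: act_def Poly_Mapping.lookup_add fn.scale_left_distrib sum.distrib)

lemma act_zero_left: "act p n 0 f = 0"
  by (simp add: act_def)

lemma act_sum_left: "act p n (\<Sum>i\<in>A. x i) f = (\<Sum>i\<in>A. act p n (x i) f)"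
  by (induction A rule: infinite_finite_induct) (auto simp: act_plus_left act_zero_left)

lemma act_scal: "act p n (scal c * x) f = smul (of_real c) (act p n x f)"
  by (simp add: act_def coef_scal_mult fn.scale_sum_right)

lemma act_sng: "g \<in> symgrp n \<Longrightarrow> act p n (sng g c) f = smul (of_real c) (pop p n g f)"
proof -
  assume g: "g \<in> symgrp n"
  have "act p n (sng g c) f = (\<Sum>h\<in>symgrp n. if h = g then smul (of_real c) (pop p n g f) else 0)"
    unfolding act_def by (rule sum.cong) (auto simp: lookup_single when_def)
  thus ?thesis using g by (simp add: finite_symgrp)
qed

lemma act_tens: "f \<in> tens p q n \<Longrightarrow> act p n x f \<in> tens p q n"
  unfolding act_def using pop_tens by (intro fn.subspace_sum[OF subspace_tens] fn.subspace_scale[OF subspace_tens])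

lemma act_mult:
  assumes x: "supp x \<subseteq> symgrp n" and y: "supp y \<subseteq> symgrp n"
  shows "act p n (x * y) f = act p n x (act p n y f)"
proof -
  let ?S = "symgrp n"
  have "act p n (x * y) f = act p n ((\<Sum>g\<in>?S. sng g (coef x g)) * (\<Sum>h\<in>?S. sng h (coef y h))) f"
    using galg_eq_sum[OF finite_symgrp x] galg_eq_sum[OF finite_symgrp y] by simp
  also have "\<dots> = (\<Sum>g\<in>?S. \<Sum>h\<in>?S. act p n (sng (g + h) (coef x g * coef y h)) f)"
    by (simp add: sum_product act_sum_left mult_single)
  also have "\<dots> = (\<Sum>g\<in>?S. \<Sum>h\<in>?S. smul (of_real (coef x g)) (smul (of_real (coef y h)) (pop p n g (pop p n h f))))"
    by (intro sum.cong refl) (simp add: act_sng symgrp_plus pop_plus)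
  also have "\<dots> = (\<Sum>g\<in>?S. smul (of_real (coef x g)) (pop p n g (\<Sum>h\<in>?S. smul (of_real (coef y h)) (pop p n h f))))"
  proof (intro sum.cong refl)
    fix g
    have "pop p n g (\<Sum>h\<in>A. F h) = (\<Sum>h\<in>A. pop p n g (F h))" for A and F :: "natperm \<Rightarrow> nat list \<Rightarrow> complex"
      by (rule ext) (simp add: pop_def sum_distrib_left)
    thus "(\<Sum>h\<in>?S. smul (of_real (coef x g)) (smul (of_real (coef y h)) (pop p n g (pop p n h f)))) =
       smul (of_real (coef x g)) (pop p n g (\<Sum>h\<in>?S. smul (of_real (coef y h)) (pop p n h f)))"
      by (simp add: pop_smul fn.scale_sum_right)
  qed
  finally show ?thesis by (simp add: act_def)
qed

section \<open>The general linear Lie superalgebra commutes with permutations\<close>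

lemma Tact_linear: "Vector_Spaces.linear smul smul (Tact p a b)"
  by unfold_locales (auto simp: Tact_def fun_eq_iff algebra_simps sum_distrib_left simp flip: sum.distrib intro!: sum.cong)

lemma Tact_tens:
  assumes "f \<in> tens p q n" "a < p + q" "b < p + q" shows "Tact p a b f \<in> tens p q n"
proof -
  have "f (J[\<alpha> := b]) = 0" if "J \<notin> seqs p q n" "\<alpha> < length J" "J ! \<alpha> = a" for J \<alpha>
  proof -
    have "J[\<alpha> := b] \<notin> seqs p q n"
    proof
      assume s: "J[\<alpha> := b] \<in> seqs p q n"
      have "J ! \<beta> < p + q" if "\<beta> < length J" for \<beta>
      proof (cases "\<beta> = \<alpha>")
        case False
        hence "J[\<alpha> := b] ! \<beta> = J ! \<beta>" by simp
        moreover have "J[\<alpha> := b] ! \<beta> \<in> set (J[\<alpha> := b])" using that by (intro nth_mem) simp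
        ultimately show ?thesis using s by (auto simp: seqs_def)
      qed (use \<open>J ! \<alpha> = a\<close> assms(2) in simp)
      hence "J \<in> seqs p q n" using s by (auto simp: seqs_def set_conv_nth)
      thus False using that by blast
    qed
    thus ?thesis using assms by (auto simp: tens_def)
  qed
  thus ?thesis by (auto simp: tens_def Tact_def intro!: sum.neutral)
qed

lemma Esgn_prod: "Esgn p a b J \<alpha> = (if oddi p a \<noteq> oddi p b then (\<Prod>\<gamma><\<alpha>. msgn (oddi p (J ! \<gamma>))) else 1)"
  using msgn_card[of "{..<\<alpha>}" "\<lambda>\<gamma>. oddi p (J ! \<gamma>)"] by (simp add: Esgn_def)

text \<open>An odd operator toggles the parity of the letter at \<open>prm g \<alpha>\<close>. By
  \<open>koszul_toggle\<close> the Koszul sign then changes by the number of odd letters before that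
  place in \<open>J\<close> and before \<open>\<alpha>\<close> in the permuted sequence: exactly the
  two signs \<open>Esgn\<close>.\<close>

lemma koszul_Esgn:
  assumes g: "g \<in> symgrp n" and J: "length J = n" and \<alpha>: "\<alpha> < n" and a: "J ! prm g \<alpha> = a"
  shows "koszul (\<lambda>\<gamma>. oddi p (J ! \<gamma>)) n (inv (prm g)) * Esgn p a b (permute_list (prm g) J) \<alpha> =
     Esgn p a b J (prm g \<alpha>) * koszul (\<lambda>\<gamma>. oddi p (J[prm g \<alpha> := b] ! \<gamma>)) n (inv (prm g))"
proof -
  let ?\<beta> = "prm g \<alpha>" and ?\<rho> = "inv (prm g)"
  let ?o = "\<lambda>\<gamma>. oddi p (J ! \<gamma>)" and ?o' = "\<lambda>\<gamma>. oddi p (J[prm g \<alpha> := b] ! \<gamma>)"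
  have \<beta>: "?\<beta> < n" using symgrp_less(1)[OF g] \<alpha> by simp
  have gp: "prm g permutes {..<n}" using g by (simp add: symgrp_def)
  have \<rho>: "?\<rho> permutes {..<n}" using gp by (rule permutes_inv)
  show ?thesis
  proof (cases "oddi p a = oddi p b")
    case True
    hence "koszul ?o' n ?\<rho> = koszul ?o n ?\<rho>"
    proof (intro koszul_cong)
      show "?o' \<gamma> = ?o \<gamma>" for \<gamma>
        using True a J \<beta> by (cases "\<gamma> = prm g \<alpha>") auto
    qed simp
    thus ?thesis using True by (simp add: Esgn_def)
  next
    case False
    define A where "A = (\<Prod>\<gamma><?\<beta>. msgn (?o \<gamma>))"
    define B where "B = (\<Prod>\<gamma><\<alpha>. msgn (?o (prm g \<gamma>)))"
    have A2: "A * A = 1" and B2: "B * B = 1" unfolding A_def B_def by (simp_all flip: prod.distrib) (auto intro!: prod.neutral)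
    have A': "A = (\<Prod>\<gamma><?\<beta>. msgn (?o' \<gamma>))" unfolding A_def by (rule prod.cong) auto
    have B': "B = (\<Prod>\<gamma><\<alpha>. msgn (?o' (prm g \<gamma>)))"
      unfolding B_def
    proof (rule prod.cong[OF refl])
      fix \<gamma> assume "\<gamma> \<in> {..<\<alpha>}"
      hence "prm g \<alpha> \<noteq> prm g \<gamma>" by (metis lessThan_iff less_irrefl prm_uminus_prm(1))
      thus "msgn (?o (prm g \<gamma>)) = msgn (?o' (prm g \<gamma>))" by simp
    qed
    have E1: "Esgn p a b J ?\<beta> = A" using False by (simp add: Esgn_prod A_def)
    have E2: "Esgn p a b (permute_list (prm g) J) \<alpha> = B"
      using False gp J \<alpha> by (simp add: Esgn_prod B_def permute_list_nth)
    have ii: "inv ?\<rho> = prm g" by (simp add: inv_inv_eq)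
    \<comment> \<open>\<open>koszul_toggle\<close> goes from odd to even, so the two directions of
      the parity change are treated apart; the signs are their own inverses.\<close>
    have "koszul ?o n ?\<rho> = koszul ?o' n ?\<rho> * A * B"
    proof (cases "oddi p a")
      case True
      have "koszul ?o n ?\<rho> = koszul ?o' n ?\<rho> * (\<Prod>\<gamma><?\<beta>. msgn (?o \<gamma>)) * (\<Prod>\<gamma><?\<rho> ?\<beta>. msgn (?o (inv ?\<rho> \<gamma>)))"
        by (rule koszul_toggle[OF \<beta> \<rho>]) (use True False a J \<beta> in auto)
      thus ?thesis by (simp add: A_def B_def ii)
    next
      case False': False
      have "koszul ?o' n ?\<rho> = koszul ?o n ?\<rho> * (\<Prod>\<gamma><?\<beta>. msgn (?o' \<gamma>)) * (\<Prod>\<gamma><?\<rho> ?\<beta>. msgn (?o' (inv ?\<rho> \<gamma>)))"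
        by (rule koszul_toggle[OF \<beta> \<rho>]) (use False False' a J \<beta> in auto)
      hence "koszul ?o' n ?\<rho> = koszul ?o n ?\<rho> * A * B" by (simp add: A' B' ii)
      hence "koszul ?o' n ?\<rho> * A * B = koszul ?o n ?\<rho> * (A * A) * (B * B)" by (simp only: mult_ac)
      thus ?thesis by (simp add: A2 B2)
    qed
    hence "koszul ?o n ?\<rho> * B = A * koszul ?o' n ?\<rho> * (B * B)" by (simp only: mult_ac)
    thus ?thesis by (simp add: E1 E2 B2)
  qed
qed

lemma pop_Tact:
  assumes g: "g \<in> symgrp n"
  shows "pop p n g (Tact p a b f) = Tact p a b (pop p n g f)"
proof
  fix J
  show "pop p n g (Tact p a b f) J = Tact p a b (pop p n g f) J"
  proof (cases "length J = n")
    case J: True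
    let ?J' = "permute_list (prm g) J"
    let ?K = "\<lambda>J. koszul (\<lambda>\<alpha>. oddi p (J ! \<alpha>)) n (inv (prm g))"
    have gp: "prm g permutes {..<n}" using g by (simp add: symgrp_def)
    have upd: "permute_list (prm g) (J[prm g \<alpha> := b]) = ?J'[\<alpha> := b]" if "\<alpha> < n" for \<alpha>
    proof (rule nth_equalityI)
      fix i assume "i < length (permute_list (prm g) (J[prm g \<alpha> := b]))"
      hence i: "i < n" by (simp add: J)
      have "prm g \<alpha> = prm g i \<longleftrightarrow> \<alpha> = i" by (metis prm_uminus_prm(1))
      thus "permute_list (prm g) (J[prm g \<alpha> := b]) ! i = ?J'[\<alpha> := b] ! i"
        using gp J i that symgrp_less(1)[OF g] by (simp add: permute_list_nth nth_list_update)
    qed simp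
    have "pop p n g (Tact p a b f) J = (\<Sum>\<alpha><n. ?K J * (if ?J' ! \<alpha> = a then Esgn p a b ?J' \<alpha> * f (?J'[\<alpha> := b]) else 0))"
      by (simp add: pop_def J Tact_def sum_distrib_left)
    also have "\<dots> = (\<Sum>\<alpha><n. if J ! prm g \<alpha> = a then Esgn p a b J (prm g \<alpha>) * (?K (J[prm g \<alpha> := b]) * f (permute_list (prm g) (J[prm g \<alpha> := b]))) else 0)"
    proof (rule sum.cong[OF refl])
      fix \<alpha> assume "\<alpha> \<in> {..<n}"
      hence \<alpha>: "\<alpha> < n" by simp
      have "?J' ! \<alpha> = J ! prm g \<alpha>" using gp J \<alpha> by (simp add: permute_list_nth)
      thus "?K J * (if ?J' ! \<alpha> = a then Esgn p a b ?J' \<alpha> * f (?J'[\<alpha> := b]) else 0) =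
        (if J ! prm g \<alpha> = a then Esgn p a b J (prm g \<alpha>) * (?K (J[prm g \<alpha> := b]) * f (permute_list (prm g) (J[prm g \<alpha> := b]))) else 0)"
        using koszul_Esgn[OF g J \<alpha>, of a p b] upd[OF \<alpha>] by (simp flip: mult.assoc)
    qed
    also have "\<dots> = (\<Sum>\<beta><n. if J ! \<beta> = a then Esgn p a b J \<beta> * (?K (J[\<beta> := b]) * f (permute_list (prm g) (J[\<beta> := b]))) else 0)"
      by (rule sum.permute[OF gp, unfolded o_def, symmetric])
    also have "\<dots> = Tact p a b (pop p n g f) J"
      unfolding Tact_def J by (rule sum.cong) (simp_all add: pop_def J)
    finally show ?thesis .
  qed (simp add: pop_def Tact_def cong: if_cong)
qed

lemma act_Tact: "act p n x (Tact p a b f) = Tact p a b (act p n x f)"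
proof -
  interpret L: Vector_Spaces.linear smul smul "Tact p a b" by (rule Tact_linear)
  show ?thesis by (simp add: act_def pop_Tact L.sum L.scale)
qed

section \<open>Block permutations\<close>

text \<open>Normal form in the wreath product of S_2 with S_k; \<open>fl\<close> refers to a block
  by its index before the move.\<close>

definition blk :: "(nat \<Rightarrow> nat) \<Rightarrow> (nat \<Rightarrow> bool) \<Rightarrow> nat \<Rightarrow> nat" where
  "blk \<eta> fl \<alpha> = 2 * \<eta> (\<alpha> div 2) + (if fl (\<alpha> div 2) then 1 - \<alpha> mod 2 else \<alpha> mod 2)"

lemma blk_even [simp]: "blk \<eta> fl (2 * a) = 2 * \<eta> a + (if fl a then 1 else 0)"
  and blk_odd [simp]: "blk \<eta> fl (Suc (2 * a)) = 2 * \<eta> a + (if fl a then 0 else 1)"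
  by (simp_all add: blk_def)

lemma nat_halves: "(\<And>a. \<alpha> = 2 * a \<Longrightarrow> P) \<Longrightarrow> (\<And>a. \<alpha> = Suc (2 * a) \<Longrightarrow> P) \<Longrightarrow> P"
  by (metis evenE oddE Suc_eq_plus1)

lemma mate_double [simp]: "mate (2 * a) = Suc (2 * a)" "mate (Suc (2 * a)) = 2 * a"
  by (simp_all add: mate_def)

lemma hypgrp_blk:
  assumes g: "g \<in> hypgrp k"
  obtains \<eta> fl where "\<eta> permutes {..<k}" "\<And>\<alpha>. \<alpha> < 2 * k \<Longrightarrow> prm g \<alpha> = blk \<eta> fl \<alpha>"
proof -
  define \<eta> where "\<eta> a = (if a < k then prm g (2 * a) div 2 else a)" for a
  define fl where "fl a = odd (prm g (2 * a))" for a
  have S: "g \<in> symgrp (2 * k)" using g hypgrp_sub by blast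
  have lt: "prm g (2 * a) < 2 * k" if "a < k" for a using symgrp_less(1)[OF S, of "2 * a"] that by simp
  have inj: "prm g x = prm g y \<longleftrightarrow> x = y" for x y by (metis prm_uminus_prm(1))
  have "\<eta> permutes {..<k}"
  proof (rule permutes_lessThanI)
    show "\<eta> a < k" if "a < k" for a using lt[OF that] that by (simp add: \<eta>_def)
    show "inj_on \<eta> {..<k}"
    proof (rule inj_onI)
      fix a b assume "a \<in> {..<k}" "b \<in> {..<k}" "\<eta> a = \<eta> b"
      hence "prm g (2 * a) div 2 = prm g (2 * b) div 2" by (simp add: \<eta>_def)
      hence "prm g (2 * b) = prm g (2 * a) \<or> prm g (2 * b) = mate (prm g (2 * a))"
        unfolding mate_def by presburger
      hence "prm g (2 * b) = prm g (2 * a) \<or> prm g (2 * b) = prm g (Suc (2 * a))"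
        using hypgrp_commute[OF g, of "2 * a"] by simp
      thus "a = b" unfolding inj by presburger
    qed
  qed (simp add: \<eta>_def)
  moreover have "prm g \<alpha> = blk \<eta> fl \<alpha>" if "\<alpha> < 2 * k" for \<alpha>
  proof (rule nat_halves[of \<alpha>])
    fix a assume a: "\<alpha> = 2 * a"
    show ?thesis using a that by (simp add: \<eta>_def fl_def)
  next
    fix a assume a: "\<alpha> = Suc (2 * a)"
    have "prm g \<alpha> = mate (prm g (2 * a))" using hypgrp_commute[OF g, of "2 * a"] a by simp
    thus ?thesis using a that by (auto simp: \<eta>_def fl_def mate_def elim!: oddE evenE)
  qed
  ultimately show ?thesis using that by blast
qed

lemma blk_hypgrp:
  assumes \<eta>: "\<eta> permutes {..<k}"
  obtains g where "g \<in> hypgrp k" "\<And>\<alpha>. \<alpha> < 2 * k \<Longrightarrow> prm g \<alpha> = blk \<eta> fl \<alpha>"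
proof -
  define f where "f \<alpha> = (if \<alpha> < 2 * k then blk \<eta> fl \<alpha> else \<alpha>)" for \<alpha>
  have \<eta>l: "\<eta> a < k \<longleftrightarrow> a < k" for a using permutes_in_image[OF \<eta>, of a] by simp
  have \<eta>i: "\<eta> a = \<eta> b \<longleftrightarrow> a = b" for a b using permutes_inj[OF \<eta>] by (simp add: inj_eq)
  have bl: "blk \<eta> fl \<alpha> < 2 * k" if "\<alpha> < 2 * k" for \<alpha>
  proof -
    have "\<eta> (\<alpha> div 2) < k" using \<eta>l that by auto
    thus ?thesis by (auto simp: blk_def)
  qed
  have bi: "\<alpha> = \<beta>" if "blk \<eta> fl \<alpha> = blk \<eta> fl \<beta>" for \<alpha> \<beta>
  proof -
    have "blk \<eta> fl \<alpha> div 2 = blk \<eta> fl \<beta> div 2" using that by simp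
    hence "\<alpha> div 2 = \<beta> div 2" by (simp add: blk_def \<eta>i split: if_splits)
    moreover from this have "\<alpha> mod 2 = \<beta> mod 2" using that by (auto simp: blk_def split: if_splits)
    ultimately show ?thesis by (metis div_mod_decomp)
  qed
  have fp: "f permutes {..<2 * k}"
    by (rule permutes_lessThanI) (use bl bi in \<open>auto simp: f_def inj_on_def\<close>)
  have pf: "prm (Natperm f) = f" using fp by (rule prm_Natperm)
  have "Natperm f \<in> hypgrp k"
  proof (rule hypgrpI)
    show "Natperm f \<in> symgrp (2 * k)" using fp by (simp add: symgrp_def pf)
    fix \<alpha> assume \<alpha>: "\<alpha> < 2 * k"
    show "prm (Natperm f) (mate \<alpha>) = mate (prm (Natperm f) \<alpha>)"
      unfolding pf by (rule nat_halves[of \<alpha>]) (use \<alpha> in \<open>simp_all add: f_def mate_less\<close>)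
  qed
  thus ?thesis using that[of "Natperm f"] by (simp add: pf f_def)
qed

lemma prod_tri_Suc: "(\<Prod>(\<alpha>, \<beta>)\<in>tri (Suc n). F \<alpha> \<beta>) = (\<Prod>(\<alpha>, \<beta>)\<in>tri n. F \<alpha> \<beta>) * (\<Prod>\<alpha><n. F \<alpha> n :: complex)"
proof -
  have "tri (Suc n) = tri n \<union> (\<lambda>\<alpha>. (\<alpha>, n)) ` {..<n}" by (auto simp: tri_def less_Suc_eq)
  moreover have "tri n \<inter> (\<lambda>\<alpha>. (\<alpha>, n)) ` {..<n} = {}" by (auto simp: tri_def)
  ultimately show ?thesis
    by (simp add: prod.union_disjoint) (subst prod.reindex, auto simp: inj_on_def)
qed

lemma prod_double: "(\<Prod>\<alpha><2 * k. G \<alpha>) = (\<Prod>a<k. G (2 * a) * G (Suc (2 * a)) :: complex)"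
  by (induction k) (simp_all add: mult.assoc)

text \<open>A pair of positions is either a block or one of the four pairs between two
  blocks.\<close>

lemma prod_tri_double:
  "(\<Prod>(\<alpha>, \<beta>)\<in>tri (2 * k). F \<alpha> \<beta> :: complex) = (\<Prod>a<k. F (2 * a) (Suc (2 * a))) *
    (\<Prod>(a, b)\<in>tri k. F (2 * a) (2 * b) * F (2 * a) (Suc (2 * b)) * F (Suc (2 * a)) (2 * b) * F (Suc (2 * a)) (Suc (2 * b)))"
proof (induction k)
  case 0
  show ?case by (simp add: tri_def)
next
  case (Suc k)
  have "(\<Prod>(\<alpha>, \<beta>)\<in>tri (2 * Suc k). F \<alpha> \<beta>) =
     (\<Prod>(\<alpha>, \<beta>)\<in>tri (2 * k). F \<alpha> \<beta>) * (\<Prod>\<alpha><2 * k. F \<alpha> (2 * k)) * (\<Prod>\<alpha><2 * k. F \<alpha> (Suc (2 * k))) * F (2 * k) (Suc (2 * k))"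
    by (simp add: prod_tri_Suc mult.assoc)
  also have "\<dots> = (\<Prod>a<Suc k. F (2 * a) (Suc (2 * a))) *
    (\<Prod>(a, b)\<in>tri (Suc k). F (2 * a) (2 * b) * F (2 * a) (Suc (2 * b)) * F (Suc (2 * a)) (2 * b) * F (Suc (2 * a)) (Suc (2 * b)))"
    unfolding Suc prod_tri_Suc prod_double prod.distrib by simp
  finally show ?case .
qed

text \<open>A flip inverts the one pair inside its block. Two blocks passing each other invert four
  pairs, whose signs multiply to the sign of exchanging two generators of the corresponding
  parities.\<close>

lemma koszul_blk:
  assumes \<eta>: "\<eta> permutes {..<k}" and \<rho>: "\<And>\<alpha>. \<alpha> < 2 * k \<Longrightarrow> \<rho> \<alpha> = blk \<eta> fl \<alpha>"
  shows "koszul od (2 * k) \<rho> = (\<Prod>a<k. msgn (fl a \<and> od (2 * a) \<and> od (Suc (2 * a)))) *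
     koszul (\<lambda>a. od (2 * a) \<noteq> od (Suc (2 * a))) k \<eta>"
proof -
  have "koszul od (2 * k) \<rho> = koszul od (2 * k) (blk \<eta> fl)" by (rule koszul_cong) (use \<rho> in auto)
  also have "\<dots> = (\<Prod>a<k. msgn (fl a \<and> od (2 * a) \<and> od (Suc (2 * a)))) *
     koszul (\<lambda>a. od (2 * a) \<noteq> od (Suc (2 * a))) k \<eta>"
    unfolding koszul_def prod_tri_double
  proof (intro arg_cong2[of _ _ _ _ "(*)"] prod.cong refl)
    fix z assume "z \<in> tri k"
    then obtain a b where ab: "z = (a, b)" "a < b" by (auto simp: tri_def)
    have "\<eta> a \<noteq> \<eta> b" using ab permutes_inj[OF \<eta>] by (metis inj_eq less_irrefl)
    hence "(2 * \<eta> b + i < 2 * \<eta> a + j) = (\<eta> b < \<eta> a)" if "i < 2" "j < 2" for i j using that by presburger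
    from this[of 0 0] this[of 0 1] this[of 1 0] this[of 1 1]
    show "(case z of (a, b) \<Rightarrow> msgn (blk \<eta> fl (2 * b) < blk \<eta> fl (2 * a) \<and> od (2 * a) \<and> od (2 * b)) *
             msgn (blk \<eta> fl (Suc (2 * b)) < blk \<eta> fl (2 * a) \<and> od (2 * a) \<and> od (Suc (2 * b))) *
             msgn (blk \<eta> fl (2 * b) < blk \<eta> fl (Suc (2 * a)) \<and> od (Suc (2 * a)) \<and> od (2 * b)) *
             msgn (blk \<eta> fl (Suc (2 * b)) < blk \<eta> fl (Suc (2 * a)) \<and> od (Suc (2 * a)) \<and> od (Suc (2 * b)))) =
          (case z of (a, b) \<Rightarrow> msgn (\<eta> b < \<eta> a \<and> od (2 * a) \<noteq> od (Suc (2 * a)) \<and> od (2 * b) \<noteq> od (Suc (2 * b))))"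
      by (auto simp: ab)
  qed auto
  finally show ?thesis .
qed

section \<open>Monomials\<close>

definition gn :: "nat list \<Rightarrow> nat \<Rightarrow> nat \<times> nat" where "gn J a = npair (J ! (2 * a), J ! Suc (2 * a))"

definition mon :: "nat \<Rightarrow> nat list \<Rightarrow> (nat \<times> nat) multiset" where "mon k J = mset (map (gn J) [0..<k])"

definition odg :: "nat \<Rightarrow> nat list \<Rightarrow> nat \<Rightarrow> bool" where "odg p J a \<longleftrightarrow> oddi p (J ! (2 * a)) \<noteq> oddi p (J ! Suc (2 * a))"

text \<open>The monomials that vanish: a factor x_ii with \<open>i\<close> odd, or a repeated odd
  generator. Writing \<open>a \<noteq> b\<close> instead of \<open>a < b\<close> makes the condition
  visibly invariant under permuting blocks.\<close>

definition degenerate :: "nat \<Rightarrow> nat \<Rightarrow> nat list \<Rightarrow> bool" where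
  "degenerate p k J \<longleftrightarrow> (\<exists>a<k. J ! (2 * a) = J ! Suc (2 * a) \<and> oddi p (J ! (2 * a))) \<or>
     (\<exists>a<k. \<exists>b<k. a \<noteq> b \<and> gn J a = gn J b \<and> odg p J a)"

definition monsgn :: "nat \<Rightarrow> nat \<Rightarrow> nat list \<Rightarrow> complex" where
  "monsgn p k J = (\<Prod>a<k. msgn (J ! Suc (2 * a) < J ! (2 * a) \<and> oddi p (J ! (2 * a)) \<and> oddi p (J ! Suc (2 * a)))) *
     (\<Prod>(a, b)\<in>tri k. msgn (gn J b < gn J a \<and> odg p J a \<and> odg p J b))"

lemma gen_odd_gn: "gen_odd p (gn J a) = odg p J a"
  by (auto simp: gen_odd_def gn_def npair_def odg_def)

lemma odg_gn_cong: "gn J a = gn K b \<Longrightarrow> odg p J a = odg p K b"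
  by (simp flip: gen_odd_gn)

lemma Xmon_eq:
  assumes J: "length J = 2 * k"
  shows "Xmon p J = (if degenerate p k J then 0 else smul (monsgn p k J) (delta (mon k J)))"
proof -
  let ?ys = "map npair (pairs_of J)"
  have ys: "?ys = map (gn J) [0..<k]" by (simp add: pairs_of_def J gn_def)
  have len: "length ?ys = k" by (simp add: ys)
  have nth: "?ys ! a = gn J a" if "a < k" for a using that by (simp add: ys)
  have d1: "(\<exists>a<length ?ys. fst (?ys ! a) = snd (?ys ! a) \<and> oddi p (fst (?ys ! a))) \<longleftrightarrow>
     (\<exists>a<k. J ! (2 * a) = J ! Suc (2 * a) \<and> oddi p (J ! (2 * a)))"
    unfolding len by (rule ex_cong1, rule conj_cong[OF refl]) (auto simp: nth gn_def npair_def)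
  have "(\<exists>a b. a < b \<and> b < length ?ys \<and> ?ys ! a = ?ys ! b \<and> gen_odd p (?ys ! a)) \<longleftrightarrow>
     (\<exists>a b. a < b \<and> b < k \<and> gn J a = gn J b \<and> odg p J a)"
    unfolding len by (intro ex_cong1) (auto simp: nth gen_odd_gn[symmetric])
  also have "\<dots> \<longleftrightarrow> (\<exists>a<k. \<exists>b<k. a \<noteq> b \<and> gn J a = gn J b \<and> odg p J a)"
  proof
    assume "\<exists>a b. a < b \<and> b < k \<and> gn J a = gn J b \<and> odg p J a"
    thus "\<exists>a<k. \<exists>b<k. a \<noteq> b \<and> gn J a = gn J b \<and> odg p J a" using order.strict_trans by blast
  next
    assume "\<exists>a<k. \<exists>b<k. a \<noteq> b \<and> gn J a = gn J b \<and> odg p J a"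
    then obtain a b where ab: "a < k" "b < k" "a \<noteq> b" "gn J a = gn J b" "odg p J a" by blast
    have "odg p J b" using odg_gn_cong[OF ab(4)] ab(5) by blast
    thus "\<exists>a b. a < b \<and> b < k \<and> gn J a = gn J b \<and> odg p J a"
      using ab by (cases "a < b") (auto intro: exI[of _ b] exI[of _ a] simp: not_less_iff_gr_or_eq, metis)
  qed
  finally have d2: "(\<exists>a b. a < b \<and> b < length ?ys \<and> ?ys ! a = ?ys ! b \<and> gen_odd p (?ys ! a)) \<longleftrightarrow> \<dots>" .
  have "{(a, b). a < b \<and> b < length ?ys \<and> ?ys ! b < ?ys ! a \<and> gen_odd p (?ys ! a) \<and> gen_odd p (?ys ! b)} =
     {z \<in> tri k. gn J (snd z) < gn J (fst z) \<and> odg p J (fst z) \<and> odg p J (snd z)}"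
    unfolding len by (auto simp: tri_def nth gen_odd_gn)
  hence s2: "(- 1) ^ card {(a, b). a < b \<and> b < length ?ys \<and> ?ys ! b < ?ys ! a \<and> gen_odd p (?ys ! a) \<and> gen_odd p (?ys ! b)} =
     (\<Prod>(a, b)\<in>tri k. msgn (gn J b < gn J a \<and> odg p J a \<and> odg p J b))"
    by (simp add: msgn_card case_prod_beta)
  have s1: "(\<Prod>g\<leftarrow>pairs_of J. pair_sign p g) =
     (\<Prod>a<k. msgn (J ! Suc (2 * a) < J ! (2 * a) \<and> oddi p (J ! (2 * a)) \<and> oddi p (J ! Suc (2 * a))))"
    by (simp add: pairs_of_def J o_def pair_sign_def prod.distinct_set_conv_list[of "[0..<k]", symmetric] atLeast0LessThan)
  show ?thesis
    unfolding Xmon_def Let_def d1 d2 s1 s2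
    by (auto simp: degenerate_def monsgn_def delta_def fun_eq_iff mon_def ys simp del: map_map)
qed

text \<open>A flip inside a block is compensated by the normalisation sign of its generator, a permutation of
  blocks by the sorting sign.\<close>

lemma Xmon_hyp:
  assumes g: "g \<in> hypgrp k" and J: "length J = 2 * k"
  shows "smul (koszul (\<lambda>\<alpha>. oddi p (J ! \<alpha>)) (2 * k) (inv (prm g))) (Xmon p J) = Xmon p (permute_list (prm g) J)"
proof -
  let ?K = "permute_list (prm g) J" and ?\<rho> = "inv (prm g)"
  have K: "length ?K = 2 * k" using J by simp
  have gp: "prm g permutes {..<2 * k}" using g hypgrp_sub by (auto simp: symgrp_def)
  have "- g \<in> hypgrp k" using g hypgrp.uminus_S by blast
  then obtain \<eta> fl where \<eta>: "\<eta> permutes {..<k}" and \<rho>: "\<And>\<alpha>. \<alpha> < 2 * k \<Longrightarrow> ?\<rho> \<alpha> = blk \<eta> fl \<alpha>"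
    using hypgrp_blk[of "- g" k] by auto
  have \<eta>l: "\<eta> a < k \<longleftrightarrow> a < k" for a using permutes_in_image[OF \<eta>, of a] by simp
  have \<eta>i: "\<eta> a = \<eta> b \<longleftrightarrow> a = b" for a b using permutes_inj[OF \<eta>] by (simp add: inj_eq)
  have \<eta>s: "\<exists>b<k. a = \<eta> b" if "a < k" for a
    using that permutes_image[OF \<eta>] by (metis imageE lessThan_iff)
  have JK: "J ! \<alpha> = ?K ! blk \<eta> fl \<alpha>" if "\<alpha> < 2 * k" for \<alpha>
  proof -
    have "?\<rho> \<alpha> < 2 * k" using g hypgrp_sub symgrp_less(2) that by blast
    thus ?thesis using that gp J \<rho>[OF that] by (metis permute_list_nth prm_uminus_prm(2))
  qed
  have JK2: "(J ! (2 * a), J ! Suc (2 * a)) = (if fl a then (?K ! Suc (2 * \<eta> a), ?K ! (2 * \<eta> a)) else (?K ! (2 * \<eta> a), ?K ! Suc (2 * \<eta> a)))"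
    if "a < k" for a using JK[of "2 * a"] JK[of "Suc (2 * a)"] that by simp
  have gnJ: "gn J a = gn ?K (\<eta> a)" if "a < k" for a
    using JK2[OF that] by (auto simp: gn_def npair_def)
  have odJ: "odg p J a = odg p ?K (\<eta> a)" if "a < k" for a
    using gnJ[OF that] by (rule odg_gn_cong)
  have monJ: "mon k J = mon k ?K"
  proof -
    have "map (gn J) [0..<k] = permute_list \<eta> (map (gn ?K) [0..<k])"
      by (rule nth_equalityI) (use \<eta> \<eta>l in \<open>auto simp: permute_list_nth gnJ\<close>)
    thus ?thesis using \<eta> by (simp add: mon_def)
  qed
  have deg: "degenerate p k J \<longleftrightarrow> degenerate p k ?K"
  proof -
    have ex_perm: "(\<exists>a<k. R (\<eta> a)) \<longleftrightarrow> (\<exists>a<k. R a)" for R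
      using \<eta>l \<eta>s by metis
    have "(\<exists>a<k. J ! (2 * a) = J ! Suc (2 * a) \<and> oddi p (J ! (2 * a))) \<longleftrightarrow>
      (\<exists>a<k. ?K ! (2 * \<eta> a) = ?K ! Suc (2 * \<eta> a) \<and> oddi p (?K ! (2 * \<eta> a)))"
    proof (rule ex_cong1, rule conj_cong[OF refl])
      fix a assume "a < k"
      from JK2[OF this] show "(J ! (2 * a) = J ! Suc (2 * a) \<and> oddi p (J ! (2 * a))) =
        (?K ! (2 * \<eta> a) = ?K ! Suc (2 * \<eta> a) \<and> oddi p (?K ! (2 * \<eta> a)))" by (auto split: if_splits)
    qed
    also have "\<dots> \<longleftrightarrow> (\<exists>a<k. ?K ! (2 * a) = ?K ! Suc (2 * a) \<and> oddi p (?K ! (2 * a)))"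
      by (rule ex_perm)
    finally have 1: "(\<exists>a<k. J ! (2 * a) = J ! Suc (2 * a) \<and> oddi p (J ! (2 * a))) \<longleftrightarrow> \<dots>" .
    have "(\<exists>a<k. \<exists>b<k. a \<noteq> b \<and> gn J a = gn J b \<and> odg p J a) \<longleftrightarrow>
       (\<exists>a<k. \<exists>b<k. \<eta> a \<noteq> \<eta> b \<and> gn ?K (\<eta> a) = gn ?K (\<eta> b) \<and> odg p ?K (\<eta> a))"
      by (intro ex_cong1 conj_cong refl) (simp_all add: gnJ odJ \<eta>i)
    also have "\<dots> \<longleftrightarrow> (\<exists>a<k. \<exists>b<k. a \<noteq> b \<and> gn ?K a = gn ?K b \<and> odg p ?K a)"
      unfolding ex_perm[of "\<lambda>b. \<eta> _ \<noteq> b \<and> gn ?K (\<eta> _) = gn ?K b \<and> odg p ?K (\<eta> _)"] by (rule ex_perm)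
    finally show ?thesis using 1 by (simp add: degenerate_def)
  qed
  show ?thesis
  proof (cases "degenerate p k ?K")
    case True thus ?thesis using deg Xmon_eq[OF J] Xmon_eq[OF K] by simp
  next
    case nd: False
    let ?o = "\<lambda>\<alpha>. oddi p (J ! \<alpha>)"
    define P where "P K a = msgn (K ! Suc (2 * a) < K ! (2 * a) \<and> oddi p (K ! (2 * a)) \<and> oddi p (K ! Suc (2 * a)))" for K a
    define Q where "Q K a b = msgn (gn K b < gn K a \<and> odg p K a \<and> odg p K b)" for K a b
    have ms: "monsgn p k K = (\<Prod>a<k. P K a) * (\<Prod>(a, b)\<in>tri k. Q K a b)" for K
      by (simp add: monsgn_def P_def Q_def)
    \<comment> \<open>A flip reverses the comparison of the two letters of a block unless they are
      equal, and equal odd letters are excluded by nondegeneracy.\<close>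
    have P1: "msgn (fl a \<and> ?o (2 * a) \<and> ?o (Suc (2 * a))) * P J a = P ?K (\<eta> a)" if a: "a < k" for a
    proof -
      have "\<not> (?K ! (2 * \<eta> a) = ?K ! Suc (2 * \<eta> a) \<and> oddi p (?K ! (2 * \<eta> a)))"
        using nd a \<eta>l by (auto simp: degenerate_def)
      thus ?thesis using JK2[OF a] by (auto simp: P_def split: if_splits)
    qed
    have P2: "(\<Prod>a<k. msgn (fl a \<and> ?o (2 * a) \<and> ?o (Suc (2 * a)))) * (\<Prod>a<k. P J a) = (\<Prod>a<k. P ?K a)"
    proof -
      have "(\<Prod>a<k. msgn (fl a \<and> ?o (2 * a) \<and> ?o (Suc (2 * a)))) * (\<Prod>a<k. P J a) = (\<Prod>a<k. P ?K (\<eta> a))"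
        unfolding prod.distrib[symmetric] by (rule prod.cong) (use P1 in auto)
      also have "\<dots> = (\<Prod>a<k. P ?K a)" by (rule prod.permute[OF \<eta>, unfolded o_def, symmetric])
      finally show ?thesis .
    qed
    \<comment> \<open>The sorting sign of two blocks as a symmetric function of their indices, to be
      reindexed along \<open>\<eta>\<close>.\<close>
    define S where "S a b = msgn (gn ?K (max a b) < gn ?K (min a b) \<and> odg p ?K a \<and> odg p ?K b)" for a b
    have Q2: "koszul (odg p J) k \<eta> * (\<Prod>(a, b)\<in>tri k. Q J a b) = (\<Prod>(a, b)\<in>tri k. Q ?K a b)"
    proof -
      have "koszul (odg p J) k \<eta> * (\<Prod>(a, b)\<in>tri k. Q J a b) = (\<Prod>(a, b)\<in>tri k. S (\<eta> a) (\<eta> b))"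
        unfolding koszul_def prod.distrib[symmetric]
      proof (rule prod.cong[OF refl], clarify)
        fix a b assume "(a, b) \<in> tri k"
        hence ab: "a < b" "a < k" "b < k" by (auto simp: tri_def)
        have ne: "\<eta> a \<noteq> \<eta> b" using ab \<eta>i by simp
        have "gn ?K (\<eta> a) \<noteq> gn ?K (\<eta> b) \<or> \<not> odg p ?K (\<eta> a)"
          using nd ne ab \<eta>l unfolding degenerate_def by metis
        thus "msgn (\<eta> b < \<eta> a \<and> odg p J a \<and> odg p J b) * Q J a b = S (\<eta> a) (\<eta> b)"
          using ne by (auto simp: Q_def S_def odJ gnJ ab max_def min_def)
      qed
      also have "\<dots> = (\<Prod>(a, b)\<in>tri k. S a b)"
        by (rule prod_tri_symmetric[OF \<eta>]) (auto simp: S_def max.commute min.commute)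
      also have "\<dots> = (\<Prod>(a, b)\<in>tri k. Q ?K a b)"
        by (rule prod.cong) (auto simp: S_def Q_def tri_def max_def min_def)
      finally show ?thesis .
    qed
    have "koszul ?o (2 * k) ?\<rho> * monsgn p k J =
       ((\<Prod>a<k. msgn (fl a \<and> ?o (2 * a) \<and> ?o (Suc (2 * a)))) * (\<Prod>a<k. P J a)) * (koszul (odg p J) k \<eta> * (\<Prod>(a, b)\<in>tri k. Q J a b))"
    proof -
      have kb: "koszul ?o (2 * k) ?\<rho> = (\<Prod>a<k. msgn (fl a \<and> ?o (2 * a) \<and> ?o (Suc (2 * a)))) * koszul (odg p J) k \<eta>"
        using koszul_blk[OF \<eta>, of ?\<rho> fl ?o] \<rho> by (simp add: odg_def[abs_def])
      show ?thesis unfolding kb ms by (simp only: mult_ac)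
    qed
    also have "\<dots> = monsgn p k ?K" unfolding P2 Q2 ms ..
    finally show ?thesis using nd deg monJ Xmon_eq[OF J] Xmon_eq[OF K] by simp
  qed
qed

section \<open>The projection from tensors to polynomials\<close>

definition proj :: "nat \<Rightarrow> nat \<Rightarrow> nat \<Rightarrow> (nat list \<Rightarrow> complex) \<Rightarrow> ((nat \<times> nat) multiset \<Rightarrow> complex)" where
  "proj p q k f = (\<Sum>J\<in>seqs p q (2 * k). smul (f J) (Xmon p J))"

lemma proj_linear: "Vector_Spaces.linear smul smul (proj p q k)"
  by unfold_locales (simp_all add: proj_def fn.scale_left_distrib sum.distrib fn.scale_sum_right)

lemmas proj_add = Vector_Spaces.linear.axioms(3)[OF proj_linear, THEN module_hom.add]
  and proj_smul = Vector_Spaces.linear.axioms(3)[OF proj_linear, THEN module_hom.scale]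
  and proj_sum = Vector_Spaces.linear.axioms(3)[OF proj_linear, THEN module_hom.sum]
  and proj_0 = Vector_Spaces.linear.axioms(3)[OF proj_linear, THEN module_hom.zero]

lemma proj_delta: "J \<in> seqs p q (2 * k) \<Longrightarrow> proj p q k (delta J) = Xmon p J"
proof -
  assume J: "J \<in> seqs p q (2 * k)"
  have "proj p q k (delta J) = (\<Sum>K\<in>seqs p q (2 * k). if K = J then Xmon p J else 0)"
    unfolding proj_def by (rule sum.cong) (auto simp: delta_def)
  thus ?thesis using J by (simp add: finite_seqs)
qed

lemma proj_pop:
  assumes g: "g \<in> hypgrp k"
  shows "proj p q k (pop p (2 * k) g f) = proj p q k f"
proof -
  let ?n = "2 * k"
  have S: "g \<in> symgrp ?n" using g hypgrp_sub by blast
  have gp: "prm g permutes {..<?n}" "inv (prm g) permutes {..<?n}" using S symgrp_uminus[OF S] by (auto simp: symgrp_def)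
  have "proj p q k (pop p ?n g f) = (\<Sum>J\<in>seqs p q ?n. smul (f (permute_list (prm g) J)) (Xmon p (permute_list (prm g) J)))"
    unfolding proj_def
  proof (rule sum.cong[OF refl])
    fix J assume "J \<in> seqs p q ?n"
    hence J: "length J = ?n" by (simp add: seqs_def)
    show "smul (pop p ?n g f J) (Xmon p J) = smul (f (permute_list (prm g) J)) (Xmon p (permute_list (prm g) J))"
      unfolding Xmon_hyp[OF g J, symmetric] by (simp add: pop_def J mult.commute)
  qed
  also have "\<dots> = (\<Sum>J\<in>seqs p q ?n. smul (f J) (Xmon p J))"
  proof (rule sum.reindex_bij_witness[of _ "permute_list (inv (prm g))" "permute_list (prm g)"])
    fix J assume J: "J \<in> seqs p q ?n"
    hence l: "length J = ?n" by (simp add: seqs_def)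
    show "permute_list (inv (prm g)) (permute_list (prm g) J) = J"
      using permute_list_compose[of "inv (prm g)" J "prm g"] gp l by (simp add: surj_iff[THEN iffD1] bij_is_surj)
    show "permute_list (prm g) (permute_list (inv (prm g)) J) = J"
      using permute_list_compose[of "prm g" J "inv (prm g)"] gp l by (simp add: bij_is_inj)
    show "permute_list (prm g) J \<in> seqs p q ?n" "permute_list (inv (prm g)) J \<in> seqs p q ?n"
      using J permute_list_seqs[OF S l] permute_list_seqs[OF symgrp_uminus[OF S] l] by auto
  qed simp
  finally show ?thesis by (simp add: proj_def)
qed

section \<open>Averaging over H and the kernel of the projection\<close>

lemma act_hypsum: "act p (2 * k) (hypsum k) f = (\<Sum>g\<in>hypgrp k. pop p (2 * k) g f)"
proof -
  have "act p (2 * k) (hypsum k) f = (\<Sum>g\<in>hypgrp k. act p (2 * k) (sng g 1) f)"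
    by (simp add: hypsum_def chsum_def act_sum_left)
  also have "\<dots> = (\<Sum>g\<in>hypgrp k. pop p (2 * k) g f)"
    by (rule sum.cong) (use hypgrp_sub in \<open>auto simp: act_sng subset_iff\<close>)
  finally show ?thesis .
qed

lemma proj_hypsum: "proj p q k (act p (2 * k) (hypsum k) f) = smul (of_nat (card (hypgrp k))) (proj p q k f)"
  by (simp add: act_hypsum proj_sum proj_pop sum_constant_scale) (simp add: fun_eq_iff)

lemma hypsum_pop: "g \<in> hypgrp k \<Longrightarrow> act p (2 * k) (hypsum k) (pop p (2 * k) g f) = act p (2 * k) (hypsum k) f"
proof -
  assume g: "g \<in> hypgrp k"
  hence S: "g \<in> symgrp (2 * k)" using hypgrp_sub by blast
  have "act p (2 * k) (hypsum k) (pop p (2 * k) g f) = act p (2 * k) (hypsum k) (act p (2 * k) (sng g 1) f)"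
    by (simp add: act_sng[OF S])
  also have "\<dots> = act p (2 * k) (hypsum k * sng g 1) f"
    by (rule act_mult[symmetric]) (use keys_basic(3) S in auto)
  also have "hypsum k * sng g 1 = hypsum k"
    using hypgrp.right_mult[OF g] by (simp add: hypsum_def)
  finally show ?thesis .
qed

text \<open>Some element of H fixes \<open>J\<close> with Koszul sign -1: the flip of a block with
  two equal odd letters, or the exchange of two blocks with the same odd generator. Averaging then
  gives a tensor equal to its negative.\<close>

lemma hypsum_degenerate:
  assumes J: "length J = 2 * k" and deg: "degenerate p k J"
  shows "act p (2 * k) (hypsum k) (delta J) = 0"
proof -
  let ?n = "2 * k"
  have key: "act p ?n (hypsum k) (delta J) = 0"
    if \<eta>: "\<eta> permutes {..<k}" and fix_J: "\<And>\<alpha>. \<alpha> < ?n \<Longrightarrow> J ! blk \<eta> fl \<alpha> = J ! \<alpha>"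
      and sgn: "(\<Prod>a<k. msgn (fl a \<and> oddi p (J ! (2 * a)) \<and> oddi p (J ! Suc (2 * a)))) * koszul (odg p J) k \<eta> = -1" for \<eta> fl
  proof -
    obtain g where g: "g \<in> hypgrp k" "\<And>\<alpha>. \<alpha> < ?n \<Longrightarrow> prm g \<alpha> = blk \<eta> fl \<alpha>" using blk_hypgrp[OF \<eta>] by metis
    have mg: "- g \<in> hypgrp k" using g hypgrp.uminus_S by blast
    hence S: "- g \<in> symgrp ?n" using hypgrp_sub by blast
    have ii: "inv (inv (prm g)) = prm g" by (simp add: inv_inv_eq)
    have "pact (prm (- g)) J = J"
      by (rule nth_equalityI) (use g(2) fix_J J in \<open>auto simp: pact_def ii\<close>)
    moreover have "csign p J (inv (prm (- g))) = -1"
    proof -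
      have "csign p J (inv (prm (- g))) = koszul (\<lambda>\<alpha>. oddi p (J ! \<alpha>)) ?n (prm g)"
        unfolding csign_koszul J by (rule koszul_cong) (use g(2) fix_J in \<open>auto simp: ii\<close>)
      also have "\<dots> = -1" using koszul_blk[OF \<eta> g(2), of "\<lambda>\<alpha>. oddi p (J ! \<alpha>)"] sgn by (simp add: odg_def[abs_def])
      finally show ?thesis .
    qed
    ultimately have "pop p ?n (- g) (delta J) = smul (-1) (delta J)" using pop_delta[OF S J] by simp
    hence "act p ?n (hypsum k) (delta J) = smul (- 1) (act p ?n (hypsum k) (delta J))"
      using hypsum_pop[OF mg] by (metis act_smul)
    thus ?thesis by (rule smul_neg_self)
  qed
  from deg[unfolded degenerate_def] show ?thesis
  proof (elim disjE exE conjE)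
    fix a assume a: "a < k" "J ! (2 * a) = J ! Suc (2 * a)" "oddi p (J ! (2 * a))"
    show ?thesis
    proof (rule key[of id "\<lambda>c. c = a"])
      show "J ! blk id (\<lambda>c. c = a) \<alpha> = J ! \<alpha>" for \<alpha>
        by (rule nat_halves[of \<alpha>]) (use a in auto)
      have "(\<Prod>c<k. msgn (c = a \<and> oddi p (J ! (2 * c)) \<and> oddi p (J ! Suc (2 * c)))) = (\<Prod>c<k. if c = a then -1 else 1)"
        by (rule prod.cong) (use a in auto)
      thus "(\<Prod>c<k. msgn (c = a \<and> oddi p (J ! (2 * c)) \<and> oddi p (J ! Suc (2 * c)))) * koszul (odg p J) k id = - 1"
        using a by (simp add: koszul_fixing)
    qed (simp add: permutes_id)
  next
    fix a b assume ab: "a < k" "b < k" "a \<noteq> b" "gn J a = gn J b" "odg p J a"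
    have odb: "odg p J b" using ab odg_gn_cong by metis
    let ?t = "Transposition.transpose a b"
    \<comment> \<open>Equal generators may come from opposite orders of their letters; then both
      blocks are flipped as well. The two letters have different parity, so these flips cost no
      sign.\<close>
    let ?fl = "\<lambda>c. (c = a \<or> c = b) \<and> J ! (2 * a) \<noteq> J ! (2 * b)"
    have cases: "(J ! (2 * a) = J ! (2 * b) \<and> J ! Suc (2 * a) = J ! Suc (2 * b)) \<or>
       (J ! (2 * a) \<noteq> J ! (2 * b) \<and> J ! (2 * a) = J ! Suc (2 * b) \<and> J ! Suc (2 * a) = J ! (2 * b))"
      using ab(4) by (auto simp: gn_def npair_def split: if_splits)
    show ?thesis
    proof (rule key[of ?t ?fl])
      show "?t permutes {..<k}" using ab by (simp add: permutes_swap_id)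
      show "J ! blk ?t ?fl \<alpha> = J ! \<alpha>" for \<alpha>
        by (rule nat_halves[of \<alpha>]) (use cases in \<open>auto simp: Transposition.transpose_def\<close>)
      have "koszul (odg p J) k ?t = -1"
        using koszul_transpose[of a b k "odg p J"] koszul_transpose[of b a k "odg p J"] ab odb
        by (cases "a < b") (auto simp: transpose_commute)
      moreover have "(\<Prod>c<k. msgn (?fl c \<and> oddi p (J ! (2 * c)) \<and> oddi p (J ! Suc (2 * c)))) = 1"
        by (rule prod.neutral) (use ab(5) odb in \<open>auto simp: odg_def\<close>)
      ultimately show "(\<Prod>c<k. msgn (?fl c \<and> oddi p (J ! (2 * c)) \<and> oddi p (J ! Suc (2 * c)))) * koszul (odg p J) k ?t = - 1"
        by simp
    qed
  qed
qed

lemma nth_concat_pairs: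
  "a < length zs \<Longrightarrow> concat (map (\<lambda>g. [fst g, snd g]) zs) ! (2 * a) = fst (zs ! a)"
  "a < length zs \<Longrightarrow> concat (map (\<lambda>g. [fst g, snd g]) zs) ! Suc (2 * a) = snd (zs ! a)"
  by (induction zs arbitrary: a) (auto simp: nth_Cons split: nat.splits)

lemma length_concat_pairs: "length (concat (map (\<lambda>g. [fst g, snd g]) zs)) = 2 * length zs"
  by (induction zs) auto

text \<open>\<open>\<eta>\<close> sorts the blocks and the flips order the letters inside them, so
  an element of H leads from \<open>J\<close> to the representative, whose normalising signs are all
  trivial.\<close>

lemma rep_mon_props:
  assumes J: "J \<in> seqs p q (2 * k)"
  shows rep_mon_perm: "\<exists>g\<in>hypgrp k. permute_list (prm g) J = rep_mon (mon k J)"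
    and rep_mon_seqs: "rep_mon (mon k J) \<in> seqs p q (2 * k)"
    and mon_rep_mon: "mon k (rep_mon (mon k J)) = mon k J"
    and monsgn_rep_mon: "monsgn p k (rep_mon (mon k J)) = 1"
proof -
  have l: "length J = 2 * k" using J by (simp add: seqs_def)
  define ys where "ys = map (gn J) [0..<k]"
  define zs where "zs = sorted_list_of_multiset (mon k J)"
  have mz: "mset zs = mset ys" by (simp add: zs_def ys_def mon_def)
  then obtain \<eta> where \<eta>: "\<eta> permutes {..<length ys}" "permute_list \<eta> ys = zs" by (rule mset_eq_permutation)
  have lz: "length zs = k" using mz by (metis ys_def length_map length_upt mset_eq_length diff_zero)
  have \<eta>k: "\<eta> permutes {..<k}" using \<eta>(1) by (simp add: ys_def)
  have \<eta>l: "\<eta> a < k \<longleftrightarrow> a < k" for a using permutes_in_image[OF \<eta>k, of a] by simp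
  have zn: "zs ! a = gn J (\<eta> a)" if "a < k" for a
    using permute_list_nth[OF \<eta>(1), of a] \<eta>(2) that \<eta>l by (simp add: ys_def)
  have rep: "rep_mon (mon k J) = concat (map (\<lambda>g. [fst g, snd g]) zs)" by (simp add: rep_mon_def zs_def)
  let ?K = "rep_mon (mon k J)"
  have lK: "length ?K = 2 * k" by (simp only: rep length_concat_pairs lz)
  have K1: "?K ! (2 * a) = fst (zs ! a)" "?K ! Suc (2 * a) = snd (zs ! a)" if "a < k" for a
    using nth_concat_pairs[of a zs] that lz by (simp_all only: rep)
  obtain g where g: "g \<in> hypgrp k" "\<And>\<alpha>. \<alpha> < 2 * k \<Longrightarrow> prm g \<alpha> = blk \<eta> (\<lambda>a. J ! Suc (2 * \<eta> a) < J ! (2 * \<eta> a)) \<alpha>"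
    using blk_hypgrp[OF \<eta>k] by metis
  have gp: "prm g permutes {..<2 * k}" using g hypgrp_sub by (auto simp: symgrp_def)
  have perm: "permute_list (prm g) J = ?K"
  proof (rule nth_equalityI)
    fix \<alpha> assume "\<alpha> < length (permute_list (prm g) J)"
    hence \<alpha>: "\<alpha> < 2 * k" using l by simp
    have "permute_list (prm g) J ! \<alpha> = J ! prm g \<alpha>" using gp l \<alpha> by (simp add: permute_list_nth)
    also have "\<dots> = ?K ! \<alpha>"
      by (rule nat_halves[of \<alpha>]) (use \<alpha> g(2) in \<open>auto simp: K1 zn gn_def npair_def\<close>)
    finally show "permute_list (prm g) J ! \<alpha> = ?K ! \<alpha>" .
  qed (simp add: l lK)
  show "\<exists>g\<in>hypgrp k. permute_list (prm g) J = ?K" using g(1) perm by blast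
  show "?K \<in> seqs p q (2 * k)"
    using permute_list_seqs[of g "2 * k" J p q] g(1) hypgrp_sub l J perm by auto
  have gK: "gn ?K a = zs ! a" if "a < k" for a
    using K1[OF that] zn[OF that] by (auto simp: gn_def npair_def)
  have "map (gn ?K) [0..<k] = zs" by (rule nth_equalityI) (auto simp: lz gK)
  thus "mon k ?K = mon k J" using mz by (simp add: mon_def ys_def)
  have "sorted zs" by (simp add: zs_def)
  hence srt: "\<not> zs ! b < zs ! a" if "a < b" "b < k" for a b
    using that lz by (simp add: sorted_iff_nth_mono not_less)
  have nrm: "\<not> ?K ! Suc (2 * a) < ?K ! (2 * a)" if "a < k" for a
    using K1[OF that] zn[OF that] by (auto simp: gn_def npair_def)
  have "(\<Prod>a<k. msgn (?K ! Suc (2 * a) < ?K ! (2 * a) \<and> oddi p (?K ! (2 * a)) \<and> oddi p (?K ! Suc (2 * a)))) = 1"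
    by (rule prod.neutral) (use nrm in auto)
  moreover have "(\<Prod>(a, b)\<in>tri k. msgn (gn ?K b < gn ?K a \<and> odg p ?K a \<and> odg p ?K b)) = 1"
    by (rule prod.neutral) (use srt gK in \<open>auto simp: tri_def\<close>)
  ultimately show "monsgn p k ?K = 1" by (simp add: monsgn_def)
qed

text \<open>Up to the factor \<open>card (hypgrp k)\<close> this is a section of the projection, with invariant values.\<close>

definition sect :: "nat \<Rightarrow> nat \<Rightarrow> nat \<Rightarrow> ((nat \<times> nat) multiset \<Rightarrow> complex) \<Rightarrow> (nat list \<Rightarrow> complex)" where
  "sect p q k F = (\<Sum>m\<in>mon k ` seqs p q (2 * k). smul (F m) (act p (2 * k) (hypsum k) (delta (rep_mon m))))"

lemma sect_linear: "Vector_Spaces.linear smul smul (sect p q k)"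
  by unfold_locales (simp_all add: sect_def fn.scale_left_distrib sum.distrib fn.scale_sum_right)

text \<open>An element of H carries the tensor of \<open>J\<close> to \<open>c\<close> times that of
  its representative. Projecting shows that the monomial of \<open>J\<close> has the same
  coefficient \<open>c\<close>, and averaging absorbs that element. For degenerate \<open>J\<close>
  both sides vanish.\<close>

lemma sect_Xmon:
  assumes J: "J \<in> seqs p q (2 * k)"
  shows "sect p q k (Xmon p J) = act p (2 * k) (hypsum k) (delta J)"
proof -
  let ?n = "2 * k" and ?K = "rep_mon (mon k J)"
  have l: "length J = ?n" using J by (simp add: seqs_def)
  show ?thesis
  proof (cases "degenerate p k J")
    case True
    thus ?thesis using Xmon_eq[OF l] hypsum_degenerate[OF l] by (simp add: sect_def)
  next
    case False
    obtain g where g: "g \<in> hypgrp k" "permute_list (prm g) J = ?K" using rep_mon_perm[OF J] by blast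
    have mg: "- g \<in> hypgrp k" using g hypgrp.uminus_S by blast
    hence S: "- g \<in> symgrp ?n" using hypgrp_sub by blast
    have ii: "inv (inv (prm g)) = prm g" by (simp add: inv_inv_eq)
    have "pact (prm (- g)) J = ?K" using g(2) by (simp add: pact_def permute_list_def ii)
    then obtain c where c: "pop p ?n (- g) (delta J) = smul c (delta ?K)" using pop_delta[OF S l] by metis
    have K: "?K \<in> seqs p q ?n" by (rule rep_mon_seqs[OF J])
    have XJ: "Xmon p J = smul c (Xmon p ?K)"
      using proj_pop[OF mg, of p q "delta J"] by (simp only: c proj_smul proj_delta[OF J] proj_delta[OF K])
    have "Xmon p J \<noteq> 0"
    proof
      assume "Xmon p J = 0"
      hence "monsgn p k J = 0" using Xmon_eq[OF l] False by (simp add: fun_eq_iff delta_def split: if_splits)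
      thus False by (auto simp: monsgn_def prod_zero_iff split: if_splits)
    qed
    hence "Xmon p ?K \<noteq> 0" using XJ by auto
    hence "Xmon p ?K = delta (mon k J)"
      using Xmon_eq[of ?K k p] K by (auto simp: seqs_def mon_rep_mon[OF J] monsgn_rep_mon[OF J] split: if_splits)
    hence X: "Xmon p J = smul c (delta (mon k J))" using XJ by simp
    have "sect p q k (Xmon p J) = (\<Sum>m\<in>mon k ` seqs p q ?n. if m = mon k J then smul c (act p ?n (hypsum k) (delta ?K)) else 0)"
      unfolding sect_def X by (rule sum.cong) (auto simp: delta_def)
    also have "\<dots> = smul c (act p ?n (hypsum k) (delta ?K))" using J by (simp add: finite_seqs)
    also have "\<dots> = act p ?n (hypsum k) (pop p ?n (- g) (delta J))" by (simp add: c act_smul)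
    also have "\<dots> = act p ?n (hypsum k) (delta J)" by (rule hypsum_pop[OF mg])
    finally show ?thesis .
  qed
qed

text \<open>The projection of a tensor thus determines its average under H; with
  \<open>proj_hypsum\<close> this identifies the kernels of the projection and of e on
  tensors.\<close>

lemma sect_proj:
  assumes "f \<in> tens p q (2 * k)"
  shows "sect p q k (proj p q k f) = act p (2 * k) (hypsum k) f"
proof -
  interpret L: Vector_Spaces.linear smul smul "sect p q k" by (rule sect_linear)
  have "sect p q k (proj p q k f) = (\<Sum>J\<in>seqs p q (2 * k). smul (f J) (act p (2 * k) (hypsum k) (delta J)))"
    by (simp add: proj_def L.sum L.scale sect_Xmon)
  also have "\<dots> = act p (2 * k) (hypsum k) (\<Sum>J\<in>seqs p q (2 * k). smul (f J) (delta J))"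
    by (simp add: act_sum act_smul)
  finally show ?thesis using tens_expand[OF assms] by simp
qed

lemma Tact_delta:
  "Tact p a b (delta J) = (\<Sum>\<alpha><length J. if J ! \<alpha> = b then smul (Esgn p a b J \<alpha>) (delta (J[\<alpha> := a])) else 0)"
proof
  fix K
  have "(if K ! \<alpha> = a then Esgn p a b K \<alpha> * delta J (K[\<alpha> := b]) else 0) =
     (if J ! \<alpha> = b then smul (Esgn p a b J \<alpha>) (delta (J[\<alpha> := a])) else 0) K" if "length K = length J" "\<alpha> < length J" for \<alpha>
  proof (cases "K ! \<alpha> = a \<and> J ! \<alpha> = b \<and> K[\<alpha> := b] = J")
    case True
    hence JK: "K = J[\<alpha> := a]" by (metis list_update_id list_update_overwrite)
    have "Esgn p a b K \<alpha> = Esgn p a b J \<alpha>" unfolding Esgn_prod JK by (auto intro!: prod.cong)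
    thus ?thesis using True JK by (simp add: delta_def)
  next
    case False
    have "\<not> (K ! \<alpha> = a \<and> K[\<alpha> := b] = J)" using False that by auto
    moreover have "\<not> (J ! \<alpha> = b \<and> K = J[\<alpha> := a])" using False that by auto
    ultimately show ?thesis by (auto simp: delta_def)
  qed
  moreover have "Tact p a b (delta J) K = 0"
    "(\<Sum>\<alpha><length J. if J ! \<alpha> = b then smul (Esgn p a b J \<alpha>) (delta (J[\<alpha> := a])) else 0) K = 0" if "length K \<noteq> length J"
  proof -
    have "K[\<alpha> := b] \<noteq> J" "K \<noteq> J[\<alpha> := a]" for \<alpha> using that by auto
    thus "Tact p a b (delta J) K = 0"
      "(\<Sum>\<alpha><length J. if J ! \<alpha> = b then smul (Esgn p a b J \<alpha>) (delta (J[\<alpha> := a])) else 0) K = 0"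
      unfolding Tact_def sum_apply by (auto simp: delta_def intro!: sum.neutral)
  qed
  ultimately show "Tact p a b (delta J) K = (\<Sum>\<alpha><length J. if J ! \<alpha> = b then smul (Esgn p a b J \<alpha>) (delta (J[\<alpha> := a])) else 0) K"
    by (cases "length K = length J") (auto simp: Tact_def sum_apply simp del: smul_apply intro!: sum.cong)
qed

lemma XE_proj:
  assumes J: "J \<in> seqs p q (2 * k)" and a: "a < p + q"
  shows "XE p a b J = proj p q k (Tact p a b (delta J))"
proof -
  have "J[\<alpha> := a] \<in> seqs p q (2 * k)" for \<alpha>
    using J a set_update_subset_insert[of J \<alpha> a] by (auto simp: seqs_def)
  thus ?thesis unfolding Tact_delta XE_def proj_sum
    by (intro sum.cong refl) (auto simp: proj_smul proj_delta proj_0)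
qed

text \<open>\<open>Pact\<close> works with one chosen representative per monomial. After
  multiplication by |H| the representatives may be averaged over H, which commutes with
  \<open>Tact\<close>; the averaged combination is \<open>sect\<close> of the projection, that is,
  the average of \<open>f\<close>.\<close>

lemma Pact_proj:
  assumes f: "f \<in> tens p q (2 * k)" and ab: "a < p + q" "b < p + q"
  shows "Pact p a b (proj p q k f) = proj p q k (Tact p a b f)"
proof -
  interpret T: Vector_Spaces.linear smul smul "Tact p a b" by (rule Tact_linear)
  let ?M = "mon k ` seqs p q (2 * k)" and ?h = "act p (2 * k) (hypsum k)" and ?c = "of_nat (card (hypgrp k)) :: complex"
  let ?F = "proj p q k f"
  have supp: "?F m = 0" if "m \<notin> ?M" for m
  proof -
    have "Xmon p J m = 0" if "J \<in> seqs p q (2 * k)" for J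
      using \<open>m \<notin> ?M\<close> that by (subst Xmon_eq[of J k]) (auto simp: seqs_def delta_def)
    thus ?thesis by (simp add: proj_def)
  qed
  have rep: "rep_mon m \<in> seqs p q (2 * k)" if "m \<in> ?M" for m using that rep_mon_seqs by auto
  have "Pact p a b ?F = (\<Sum>m\<in>?M. smul (?F m) (XE p a b (rep_mon m)))"
    unfolding Pact_def by (rule sum.mono_neutral_left) (use supp finite_seqs in auto)
  also have "\<dots> = (\<Sum>m\<in>?M. smul (?F m) (proj p q k (Tact p a b (delta (rep_mon m)))))"
    by (rule sum.cong[OF refl]) (use XE_proj[OF rep ab(1)] in simp)
  finally have "smul ?c (Pact p a b ?F) = (\<Sum>m\<in>?M. smul (?F m) (proj p q k (?h (Tact p a b (delta (rep_mon m))))))"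
    by (simp add: fn.scale_sum_right proj_hypsum mult.commute[of _ ?c] del: sum_apply)
  also have "\<dots> = proj p q k (Tact p a b (sect p q k ?F))"
    by (simp add: sect_def T.sum T.scale proj_sum proj_smul act_Tact)
  also have "\<dots> = smul ?c (proj p q k (Tact p a b f))"
    by (simp add: sect_proj[OF f] proj_hypsum flip: act_Tact)
  finally have "smul ?c (Pact p a b ?F) = smul ?c (proj p q k (Tact p a b f))" .
  moreover have "?c \<noteq> 0" using hypgrp.card_pos[of k] by simp
  ultimately show ?thesis by (simp add: fn.scale_cancel_left)
qed

section \<open>Young symmetrised tensors\<close>

lemma nth_pact: "\<alpha> < length I \<Longrightarrow> pact \<sigma> I ! \<alpha> = I ! inv \<sigma> \<alpha>"
  by (simp add: pact_def)

lemma length_pact [simp]: "length (pact \<sigma> I) = length I"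
  by (simp add: pact_def)

lemma pact_plus:
  assumes "g \<in> symgrp n" "h \<in> symgrp n" "length I = n"
  shows "pact (prm (g + h)) I = pact (prm g) (pact (prm h) I)"
  by (rule nth_equalityI) (use assms in \<open>auto simp: nth_pact symgrp_less o_inv_distrib\<close>)

lemma pact_zero: "pact (prm 0) I = I"
  by (rule nth_equalityI) (auto simp: nth_pact)

lemma pact_seqs: "g \<in> symgrp n \<Longrightarrow> I \<in> seqs p q n \<Longrightarrow> pact (prm g) I \<in> seqs p q n"
  using permute_list_seqs[of "- g" n I p q] symgrp_uminus[of g n] by (auto simp: pact_def permute_list_def seqs_def)

text \<open>On the stabiliser of \<open>I\<close> the Koszul sign is a character, because signed
  permutations act on the line through \<open>delta I\<close>.\<close>

lemma csign_plus_fixed: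
  assumes g: "g \<in> symgrp n" and h: "h \<in> symgrp n" and I: "length I = n" and fg: "pact (prm g) I = I" and fh: "pact (prm h) I = I"
  shows "csign p I (inv (prm (g + h))) = csign p I (inv (prm g)) * csign p I (inv (prm h))"
proof -
  have "smul (csign p I (inv (prm (g + h)))) (delta I) = pop p n (g + h) (delta I)"
    using pop_delta[OF symgrp_plus[OF g h] I] pact_plus[OF g h I] fg fh by simp
  also have "\<dots> = smul (csign p I (inv (prm g)) * csign p I (inv (prm h))) (delta I)"
    using pop_delta[OF g I] pop_delta[OF h I] fg fh by (simp add: pop_plus[OF g h] pop_smul mult.commute)
  finally have "smul (csign p I (inv (prm (g + h)))) (delta I) = smul (csign p I (inv (prm g)) * csign p I (inv (prm h))) (delta I)" .
  from fun_cong[OF this, of I] show ?thesis by (simp only: smul_apply delta_def) simp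
qed

lemma csign_fixed_odd:
  assumes I: "length I = n" and fixed: "pact (prm s) I = I" and odd: "\<And>\<alpha>. \<alpha> < n \<Longrightarrow> oddi p (I ! \<alpha>) \<Longrightarrow> prm s \<alpha> = \<alpha>"
  shows "csign p I (inv (prm s)) = 1"
proof -
  have "csign p I (inv (prm s)) = koszul (\<lambda>\<alpha>. oddi p (I ! \<alpha>)) n (inv (prm s))"
    unfolding csign_koszul I by (rule koszul_cong) (use fixed I nth_pact in metis)+
  also have "\<dots> = 1" by (rule koszul_fixing) (metis odd prm_uminus_prm(1))
  finally show ?thesis .
qed

text \<open>The Koszul sign of a permutation of equal odd entries is its sign, so that antisymmetrisation does not kill them.\<close>

lemma csign_fixed_even:
  assumes s: "s \<in> symgrp n" and I: "length I = n" and fixed: "pact (prm s) I = I"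
    and even: "\<And>\<alpha>. \<alpha> < n \<Longrightarrow> \<not> oddi p (I ! \<alpha>) \<Longrightarrow> prm s \<alpha> = \<alpha>"
  shows "csign p I (inv (prm s)) = of_real (sg s)"
proof -
  have sp: "prm s permutes {..<n}" using s by (simp add: symgrp_def)
  have "csign p I (inv (prm s)) = koszul (\<lambda>\<alpha>. oddi p (I ! \<alpha>)) n (inv (prm s))"
    unfolding csign_koszul I by (rule koszul_cong) (use fixed I nth_pact in metis)+
  also have "\<dots> = of_int (sign (inv (prm s)))"
  proof (rule koszul_sign[OF _ refl])
    show "inv (prm s) permutes {\<alpha>. \<alpha> < n \<and> oddi p (I ! \<alpha>)}"
      by (rule permutes_superset[OF permutes_inv[OF sp]]) (auto, metis even prm_uminus_prm(1))
  qed
  also have "sign (inv (prm s)) = sign (prm s)"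
    by (rule sign_inverse) (use sp in \<open>auto simp: permutation_permutes\<close>)
  finally show ?thesis by (simp add: sg_def)
qed

abbreviation yact :: "nat \<Rightarrow> nat list \<Rightarrow> (nat list \<Rightarrow> complex) \<Rightarrow> (nat list \<Rightarrow> complex)" where
  "yact p la \<equiv> act p (sum_list la) (rowsym la * colalt la)"

lemma keys_row_col: "supp (rowsym la * colalt la) \<subseteq> symgrp (sum_list la)"
  by (rule keys_mult_symgrp keys_basic)+

lemma sum_prm:
  assumes "\<And>f. f \<in> S \<Longrightarrow> f permutes X"
  shows "(\<Sum>f\<in>S. F f) = (\<Sum>g | prm g \<in> S. F (prm g))"
proof (rule sum.reindex_bij_betw[symmetric])
  have "S \<subseteq> prm ` {g. prm g \<in> S}"
  proof
    fix f assume "f \<in> S"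
    thus "f \<in> prm ` {g. prm g \<in> S}" using prm_Natperm[OF assms] by (intro image_eqI[of _ _ "Natperm f"]) auto
  qed
  thus "bij_betw prm {g. prm g \<in> S} S" unfolding bij_betw_def using inj_prm by (auto simp: inj_on_def prm_inject)
qed

lemma sum_colgrp: "(\<Sum>\<tau>\<in>Ct la. F \<tau>) = (\<Sum>g\<in>colgrp la. F (prm g))"
  unfolding colgrp_def by (rule sum_prm) (auto simp: Ct_def)

lemma sum_rowgrp: "(\<Sum>\<tau>\<in>Rt la. F \<tau>) = (\<Sum>g\<in>rowgrp la. F (prm g))"
  unfolding rowgrp_def by (rule sum_prm) (auto simp: Rt_def)

lemma young_vec_sum:
  "young_vec p la I = (\<Sum>\<tau>\<in>colgrp la. \<Sum>\<sigma>\<in>rowgrp la.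
     smul (of_real (sg \<tau>) * csign p I (inv (prm (\<sigma> + \<tau>)))) (delta (pact (prm (\<sigma> + \<tau>)) I)))"
  unfolding young_vec_def sum_colgrp sum_rowgrp by (simp add: sg_def)

lemma young_vec_act:
  assumes I: "length I = sum_list la"
  shows "young_vec p la I = yact p la (delta I)"
proof -
  let ?n = "sum_list la"
  have st: "\<sigma> + \<tau> \<in> symgrp ?n" if "\<sigma> \<in> rowgrp la" "\<tau> \<in> colgrp la" for \<sigma> \<tau>
    using that rowgrp_sub colgrp_sub symgrp_plus by blast
  have "yact p la (delta I) = (\<Sum>\<sigma>\<in>rowgrp la. \<Sum>\<tau>\<in>colgrp la. act p ?n (sng (\<sigma> + \<tau>) (sg \<tau>)) (delta I))"
    by (simp add: rowsym_def colalt_def chsum_def sum_product mult_single act_sum_left)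
  also have "\<dots> = (\<Sum>\<sigma>\<in>rowgrp la. \<Sum>\<tau>\<in>colgrp la.
     smul (of_real (sg \<tau>) * csign p I (inv (prm (\<sigma> + \<tau>)))) (delta (pact (prm (\<sigma> + \<tau>)) I)))"
    by (intro sum.cong refl) (simp only: act_sng[OF st] pop_delta[OF st I] fn.scale_scale)
  also have "\<dots> = young_vec p la I" unfolding young_vec_sum by (rule sum.swap)
  finally show ?thesis by simp
qed

lemma yact_pop: "\<tau> \<in> colgrp la \<Longrightarrow> yact p la (pop p (sum_list la) \<tau> f) = smul (of_real (sg \<tau>)) (yact p la f)"
proof -
  assume t: "\<tau> \<in> colgrp la"
  hence S: "\<tau> \<in> symgrp (sum_list la)" using colgrp_sub by blast
  have "yact p la (pop p (sum_list la) \<tau> f) = yact p la (act p (sum_list la) (sng \<tau> 1) f)"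
    by (simp add: act_sng[OF S])
  also have "\<dots> = act p (sum_list la) (rowsym la * colalt la * sng \<tau> 1) f"
    by (rule act_mult[symmetric]) (use keys_row_col S in auto)
  also have "rowsym la * colalt la * sng \<tau> 1 = scal (sg \<tau>) * (rowsym la * colalt la)"
    using colgrp.right_mult[OF t] by (simp add: colalt_def mult.assoc scal_commute_left)
  finally show ?thesis by (simp only: act_scal)
qed

lemma young_vec_col:
  assumes t: "\<tau> \<in> colgrp la" and I: "length I = sum_list la"
  shows "smul (csign p I (inv (prm \<tau>))) (young_vec p la (pact (prm \<tau>) I)) = smul (of_real (sg \<tau>)) (young_vec p la I)"
proof -
  have S: "\<tau> \<in> symgrp (sum_list la)" using t colgrp_sub by blast
  show ?thesis using yact_pop[OF t, of p "delta I"] by (simp add: pop_delta[OF S I] act_smul young_vec_act I)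
qed

section \<open>Weights and sorted tableaux\<close>

text \<open>With \<open>row_of\<close> as weights it selects leading terms, with
  \<open>col_of\<close> it measures the progress of straightening.\<close>

definition wt :: "(nat \<Rightarrow> nat) \<Rightarrow> nat list \<Rightarrow> nat" where
  "wt w I = (\<Sum>\<gamma><length I. w \<gamma> * I ! \<gamma>)"

lemma wt_invariant:
  assumes g: "g \<in> symgrp (length I)" and w: "\<And>\<alpha>. \<alpha> < length I \<Longrightarrow> w (prm g \<alpha>) = w \<alpha>"
  shows "wt w (pact (prm g) I) = wt w I"
proof -
  have gp: "prm g permutes {..<length I}" using g by (simp add: symgrp_def)
  have "wt w (pact (prm g) I) = (\<Sum>\<gamma><length I. w \<gamma> * I ! inv (prm g) \<gamma>)"
    by (simp add: wt_def nth_pact)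
  also have "\<dots> = (\<Sum>\<gamma><length I. w (prm g \<gamma>) * I ! \<gamma>)"
    by (subst sum.permute[OF gp]) simp
  finally show ?thesis by (simp add: wt_def w)
qed

text \<open>The rearrangement inequality for two entries.\<close>

lemma wt_swap_less:
  assumes ab: "\<alpha> < length I" "\<beta> < length I" and w: "w \<alpha> < w \<beta>" and I: "I ! \<beta> < I ! \<alpha>"
  shows "wt w I < wt w (pact (prm (swp \<alpha> \<beta>)) I)"
proof -
  let ?T = "{..<length I} - {\<alpha>, \<beta>}"
  have ne: "\<alpha> \<noteq> \<beta>" using w by auto
  have split: "wt w K = w \<alpha> * K ! \<alpha> + w \<beta> * K ! \<beta> + (\<Sum>\<gamma>\<in>?T. w \<gamma> * K ! \<gamma>)" if "length K = length I" for K
  proof -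
    have "{..<length I} = insert \<alpha> (insert \<beta> ?T)" using ab by auto
    hence "wt w K = (\<Sum>\<gamma>\<in>insert \<alpha> (insert \<beta> ?T). w \<gamma> * K ! \<gamma>)" unfolding wt_def that by (rule arg_cong)
    also have "\<dots> = w \<alpha> * K ! \<alpha> + w \<beta> * K ! \<beta> + (\<Sum>\<gamma>\<in>?T. w \<gamma> * K ! \<gamma>)"
      using ne by simp
    finally show ?thesis .
  qed
  let ?K = "pact (prm (swp \<alpha> \<beta>)) I"
  have K: "?K ! \<gamma> = I ! Transposition.transpose \<alpha> \<beta> \<gamma>" if "\<gamma> < length I" for \<gamma>
    using that by (simp add: nth_pact prm_swp)
  have "(\<Sum>\<gamma>\<in>?T. w \<gamma> * ?K ! \<gamma>) = (\<Sum>\<gamma>\<in>?T. w \<gamma> * I ! \<gamma>)"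
    by (rule sum.cong) (auto simp: K Transposition.transpose_def)
  moreover have "w \<alpha> * I ! \<alpha> + w \<beta> * I ! \<beta> < w \<alpha> * I ! \<beta> + w \<beta> * I ! \<alpha>"
  proof -
    obtain d e where d: "w \<beta> = w \<alpha> + d" "d > 0" and e: "I ! \<alpha> = I ! \<beta> + e" "e > 0"
      using w I less_imp_add_positive by metis
    show ?thesis using d(2) e(2) by (simp add: d(1) e(1) algebra_simps)
  qed
  ultimately show ?thesis using ab split[of I] split[of ?K] ne by (simp add: K)
qed

definition colsorted :: "nat list \<Rightarrow> nat list \<Rightarrow> bool" where
  "colsorted la I \<longleftrightarrow> (\<forall>\<alpha><sum_list la. \<forall>\<beta><sum_list la.
     col_of la \<alpha> = col_of la \<beta> \<and> row_of la \<alpha> < row_of la \<beta> \<longrightarrow> I ! \<alpha> \<le> I ! \<beta>)"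

text \<open>At a maximum of the weight no pair is out of order, for exchanging it would raise the
  weight.\<close>

lemma col_max_sorted:
  assumes I: "length I = sum_list la" and t: "\<tau> \<in> colgrp la"
    and max: "\<And>\<tau>'. \<tau>' \<in> colgrp la \<Longrightarrow> wt (row_of la) (pact (prm \<tau>') I) \<le> wt (row_of la) (pact (prm \<tau>) I)"
  shows "colsorted la (pact (prm \<tau>) I)"
  unfolding colsorted_def
proof (intro allI impI, rule ccontr)
  fix \<alpha> \<beta> assume ab: "\<alpha> < sum_list la" "\<beta> < sum_list la" "col_of la \<alpha> = col_of la \<beta> \<and> row_of la \<alpha> < row_of la \<beta>"
    and "\<not> pact (prm \<tau>) I ! \<alpha> \<le> pact (prm \<tau>) I ! \<beta>"
  hence lt: "wt (row_of la) (pact (prm \<tau>) I) < wt (row_of la) (pact (prm (swp \<alpha> \<beta>)) (pact (prm \<tau>) I))"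
    using I by (intro wt_swap_less) auto
  have sw: "swp \<alpha> \<beta> \<in> colgrp la" using ab by (intro swp_colgrp) auto
  have "pact (prm (swp \<alpha> \<beta> + \<tau>)) I = pact (prm (swp \<alpha> \<beta>)) (pact (prm \<tau>) I)"
    by (rule pact_plus) (use sw t colgrp_sub I in auto)
  with lt max[of "swp \<alpha> \<beta> + \<tau>"] colgrp.plus_S[OF sw t] show False by simp
qed

lemma col_max_exists:
  obtains \<tau> where "\<tau> \<in> colgrp la" "\<And>\<tau>'. \<tau>' \<in> colgrp la \<Longrightarrow> wt (row_of la) (pact (prm \<tau>') I) \<le> wt (row_of la) (pact (prm \<tau>) I)"
proof -
  have fin: "finite (colgrp la)" and ne: "colgrp la \<noteq> {}"
    using colgrp.finite_S colgrp.zero_S by auto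
  let ?f = "\<lambda>\<tau>. wt (row_of la) (pact (prm \<tau>) I)"
  have "Max (?f ` colgrp la) \<in> ?f ` colgrp la" by (rule Max_in) (use fin ne in auto)
  then obtain \<tau> where "Max (?f ` colgrp la) = ?f \<tau>" "\<tau> \<in> colgrp la" by (rule imageE)
  thus ?thesis using that[of \<tau>] fin by (metis Max_ge finite_imageI imageI)
qed

text \<open>If \<open>f' \<alpha>\<close> exceeded \<open>f \<alpha>\<close>, all members of the
  class up to \<open>\<alpha>\<close> would have \<open>f\<close>-value at most
  \<open>f \<alpha>\<close>, but only strictly earlier ones such an \<open>f'\<close>-value, against
  the equal counts. Abstract \<open>cls\<close> and \<open>key\<close> serve columns and rows
  alike.\<close>

lemma sorted_arrangement_le:
  fixes cls key :: "nat \<Rightarrow> nat"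
  assumes srt: "\<And>\<alpha> \<beta>. \<alpha> < n \<Longrightarrow> \<beta> < n \<Longrightarrow> cls \<alpha> = cls \<beta> \<Longrightarrow> key \<alpha> < key \<beta> \<Longrightarrow> f \<alpha> \<le> (f \<beta> :: nat)"
      "\<And>\<alpha> \<beta>. \<alpha> < n \<Longrightarrow> \<beta> < n \<Longrightarrow> cls \<alpha> = cls \<beta> \<Longrightarrow> key \<alpha> < key \<beta> \<Longrightarrow> f' \<alpha> \<le> f' \<beta>"
    and inj: "\<And>\<alpha> \<beta>. \<alpha> < n \<Longrightarrow> \<beta> < n \<Longrightarrow> cls \<alpha> = cls \<beta> \<Longrightarrow> key \<alpha> = key \<beta> \<Longrightarrow> \<alpha> = \<beta>"
    and card: "\<And>c x. card {\<gamma>. \<gamma> < n \<and> cls \<gamma> = c \<and> f \<gamma> \<le> x} = card {\<gamma>. \<gamma> < n \<and> cls \<gamma> = c \<and> f' \<gamma> \<le> x}"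
    and a: "\<alpha> < n"
  shows "f' \<alpha> \<le> f \<alpha>"
proof (rule ccontr)
  assume "\<not> f' \<alpha> \<le> f \<alpha>"
  hence lt: "f \<alpha> < f' \<alpha>" by simp
  let ?A = "{\<gamma>. \<gamma> < n \<and> cls \<gamma> = cls \<alpha> \<and> key \<gamma> \<le> key \<alpha>}" and ?B = "{\<gamma>. \<gamma> < n \<and> cls \<gamma> = cls \<alpha> \<and> key \<gamma> < key \<alpha>}"
  have "f \<gamma> \<le> f \<alpha>" if "\<gamma> \<in> ?A" for \<gamma>
    using that srt(1)[of \<gamma> \<alpha>] inj[of \<gamma> \<alpha>] a by (cases "key \<gamma> = key \<alpha>") auto
  hence "card ?A \<le> card {\<gamma>. \<gamma> < n \<and> cls \<gamma> = cls \<alpha> \<and> f \<gamma> \<le> f \<alpha>}" by (intro card_mono) auto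
  also have "\<dots> = card {\<gamma>. \<gamma> < n \<and> cls \<gamma> = cls \<alpha> \<and> f' \<gamma> \<le> f \<alpha>}" by (rule card)
  also have "\<dots> \<le> card ?B"
  proof (intro card_mono subsetI)
    fix \<gamma> assume "\<gamma> \<in> {\<gamma>. \<gamma> < n \<and> cls \<gamma> = cls \<alpha> \<and> f' \<gamma> \<le> f \<alpha>}"
    hence g: "\<gamma> < n" "cls \<gamma> = cls \<alpha>" "f' \<gamma> \<le> f \<alpha>" by auto
    have "key \<gamma> < key \<alpha>"
    proof (rule ccontr)
      assume "\<not> key \<gamma> < key \<alpha>"
      hence "f' \<alpha> \<le> f' \<gamma>" using srt(2)[of \<alpha> \<gamma>] inj[of \<alpha> \<gamma>] a g by (cases "key \<gamma> = key \<alpha>") auto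
      thus False using g lt by simp
    qed
    thus "\<gamma> \<in> ?B" using g by simp
  qed simp
  also have "\<dots> < card ?A" by (intro psubset_card_mono psubsetI) (use a in auto)
  finally show False by simp
qed

lemma sorted_arrangement_unique:
  fixes cls key :: "nat \<Rightarrow> nat"
  assumes J: "length J = n" and g: "g \<in> symgrp n" "\<And>\<alpha>. \<alpha> < n \<Longrightarrow> cls (prm g \<alpha>) = cls \<alpha>"
    and srt: "\<And>\<alpha> \<beta>. \<alpha> < n \<Longrightarrow> \<beta> < n \<Longrightarrow> cls \<alpha> = cls \<beta> \<Longrightarrow> key \<alpha> < key \<beta> \<Longrightarrow> J ! \<alpha> \<le> J ! \<beta>"
      "\<And>\<alpha> \<beta>. \<alpha> < n \<Longrightarrow> \<beta> < n \<Longrightarrow> cls \<alpha> = cls \<beta> \<Longrightarrow> key \<alpha> < key \<beta> \<Longrightarrow> pact (prm g) J ! \<alpha> \<le> pact (prm g) J ! \<beta>"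
    and inj: "\<And>\<alpha> \<beta>. \<alpha> < n \<Longrightarrow> \<beta> < n \<Longrightarrow> cls \<alpha> = cls \<beta> \<Longrightarrow> key \<alpha> = key \<beta> \<Longrightarrow> \<alpha> = \<beta>"
  shows "pact (prm g) J = J"
proof (rule nth_equalityI)
  let ?K = "pact (prm g) J"
  have card: "card {\<gamma>. \<gamma> < n \<and> cls \<gamma> = c \<and> J ! \<gamma> \<le> x} = card {\<gamma>. \<gamma> < n \<and> cls \<gamma> = c \<and> ?K ! \<gamma> \<le> x}" for c x
  proof (rule bij_betw_same_card[of "prm g"])
    have cls': "cls (inv (prm g) \<gamma>) = cls \<gamma>" if "\<gamma> < n" for \<gamma>
      using g(2)[of "inv (prm g) \<gamma>"] symgrp_less(2)[OF g(1)] that by simp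
    show "bij_betw (prm g) {\<gamma>. \<gamma> < n \<and> cls \<gamma> = c \<and> J ! \<gamma> \<le> x} {\<gamma>. \<gamma> < n \<and> cls \<gamma> = c \<and> ?K ! \<gamma> \<le> x}"
      by (rule bij_betw_byWitness[where f' = "inv (prm g)"])
         (use cls' g(2) in \<open>auto simp: symgrp_less[OF g(1)] nth_pact J\<close>)
  qed
  fix \<alpha> assume "\<alpha> < length ?K"
  hence a: "\<alpha> < n" using J by simp
  have "?K ! \<alpha> \<le> J ! \<alpha>"
  proof (rule sorted_arrangement_le[where n = n and cls = cls and key = key and f = "\<lambda>\<alpha>. J ! \<alpha>" and f' = "\<lambda>\<alpha>. ?K ! \<alpha>"])
    show "card {\<gamma>. \<gamma> < n \<and> cls \<gamma> = c \<and> J ! \<gamma> \<le> x} = card {\<gamma>. \<gamma> < n \<and> cls \<gamma> = c \<and> ?K ! \<gamma> \<le> x}" for c x by (rule card)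
  qed (fact srt inj a)+
  moreover have "J ! \<alpha> \<le> ?K ! \<alpha>"
  proof (rule sorted_arrangement_le[where n = n and cls = cls and key = key and f = "\<lambda>\<alpha>. ?K ! \<alpha>" and f' = "\<lambda>\<alpha>. J ! \<alpha>"])
    show "card {\<gamma>. \<gamma> < n \<and> cls \<gamma> = c \<and> ?K ! \<gamma> \<le> x} = card {\<gamma>. \<gamma> < n \<and> cls \<gamma> = c \<and> J ! \<gamma> \<le> x}" for c x by (rule card[symmetric])
  qed (fact srt inj a)+
  ultimately show "?K ! \<alpha> = J ! \<alpha>" by simp
qed simp

lemma colsorted_unique:
  assumes J: "length J = sum_list la" and t: "\<tau> \<in> colgrp la" and s: "colsorted la J" "colsorted la (pact (prm \<tau>) J)"
  shows "pact (prm \<tau>) J = J"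
proof (rule sorted_arrangement_unique[OF J, where cls = "col_of la" and key = "row_of la"])
  show "\<tau> \<in> symgrp (sum_list la)" using t colgrp_sub by blast
  show "\<And>\<alpha>. \<alpha> < sum_list la \<Longrightarrow> col_of la (prm \<tau> \<alpha>) = col_of la \<alpha>" using t by (auto simp: colgrp_def Ct_def)
qed (use s row_col_inj in \<open>auto simp: colsorted_def\<close>)

text \<open>The orbit of \<open>I\<close> under the column group has an arrangement of maximal
  weight; it is column-sorted, and \<open>colsorted_unique\<close> identifies it with
  \<open>I\<close>.\<close>

lemma wt_col_le:
  assumes I: "length I = sum_list la" "colsorted la I" and t: "\<tau> \<in> colgrp la"
  shows "wt (row_of la) (pact (prm \<tau>) I) \<le> wt (row_of la) I"
    "wt (row_of la) (pact (prm \<tau>) I) = wt (row_of la) I \<Longrightarrow> pact (prm \<tau>) I = I"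
proof -
  obtain \<tau>0 where t0: "\<tau>0 \<in> colgrp la"
    and max: "\<And>\<tau>'. \<tau>' \<in> colgrp la \<Longrightarrow> wt (row_of la) (pact (prm \<tau>') I) \<le> wt (row_of la) (pact (prm \<tau>0) I)"
    using col_max_exists by blast
  have "pact (prm \<tau>0) I = I" using colsorted_unique[OF I(1) t0 I(2)] col_max_sorted[OF I(1) t0 max] by simp
  with max have max': "\<And>\<tau>'. \<tau>' \<in> colgrp la \<Longrightarrow> wt (row_of la) (pact (prm \<tau>') I) \<le> wt (row_of la) I" by simp
  thus "wt (row_of la) (pact (prm \<tau>) I) \<le> wt (row_of la) I" using t by blast
  assume "wt (row_of la) (pact (prm \<tau>) I) = wt (row_of la) I"
  hence "colsorted la (pact (prm \<tau>) I)" using col_max_sorted[OF I(1) t] max' by simp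
  thus "pact (prm \<tau>) I = I" using colsorted_unique[OF I(1) t I(2)] by blast
qed

section \<open>Linear independence of semistandard tensors\<close>

lemma semistandard_colsorted: "semistandard p q la I \<Longrightarrow> colsorted la I"
  by (simp add: semistandard_def colsorted_def)

lemma semistandard_length: "semistandard p q la I \<Longrightarrow> length I = sum_list la"
  by (simp add: semistandard_def seqs_def)

text \<open>Row permutations preserve the row weight, and column permutations of a column-sorted
  sequence cannot raise it. So equality holds throughout: \<open>\<tau>\<close> fixes
  \<open>I\<close>, and sortedness along rows makes \<open>\<sigma>\<close> fix it too.\<close>

lemma semistandard_leading:
  assumes I: "semistandard p q la I" and J: "semistandard p q la J" and s: "\<sigma> \<in> rowgrp la" and t: "\<tau> \<in> colgrp la"
    and eq: "pact (prm (\<sigma> + \<tau>)) I = J" and le: "wt (row_of la) I \<le> wt (row_of la) J"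
  shows "I = J \<and> pact (prm \<tau>) I = I \<and> pact (prm \<sigma>) I = I"
proof -
  let ?n = "sum_list la"
  have lI: "length I = ?n" "length J = ?n" using I J by (auto dest: semistandard_length)
  have S: "\<sigma> \<in> symgrp ?n" "\<tau> \<in> symgrp ?n" using s t rowgrp_sub colgrp_sub by blast+
  have J2: "J = pact (prm \<sigma>) (pact (prm \<tau>) I)" using eq pact_plus[OF S lI(1)] by simp
  have row: "row_of la (prm \<sigma> \<alpha>) = row_of la \<alpha>" if "\<alpha> < ?n" for \<alpha> using s that by (auto simp: rowgrp_def Rt_def)
  have "wt (row_of la) J = wt (row_of la) (pact (prm \<tau>) I)"
    unfolding J2 by (rule wt_invariant) (use S row lI in auto)
  hence "wt (row_of la) (pact (prm \<tau>) I) = wt (row_of la) I"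
    using wt_col_le(1)[OF lI(1) semistandard_colsorted[OF I] t] le by simp
  hence tI: "pact (prm \<tau>) I = I" by (rule wt_col_le(2)[OF lI(1) semistandard_colsorted[OF I] t])
  hence J3: "J = pact (prm \<sigma>) I" using J2 by simp
  have "pact (prm \<sigma>) I = I"
    by (rule sorted_arrangement_unique[where cls = "row_of la" and key = "col_of la", OF lI(1) S(1) row])
       (use I J row_col_inj in \<open>auto simp: semistandard_def simp flip: J3\<close>)
  thus ?thesis using tI J3 by simp
qed

text \<open>Equal entries of a row are even and permuted without sign; equal entries of a column are
  odd, and their Koszul sign cancels the sign of \<open>\<tau>\<close>. Hence nothing cancels in the
  leading coefficient.\<close>

lemma semistandard_fixed_sign:
  assumes I: "semistandard p q la I" and s: "\<sigma> \<in> rowgrp la" "pact (prm \<sigma>) I = I" and t: "\<tau> \<in> colgrp la" "pact (prm \<tau>) I = I"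
  shows "of_real (sg \<tau>) * csign p I (inv (prm (\<sigma> + \<tau>))) = 1"
proof -
  let ?n = "sum_list la"
  have lI: "length I = ?n" using I by (auto dest: semistandard_length)
  have S: "\<sigma> \<in> symgrp ?n" "\<tau> \<in> symgrp ?n" using s t rowgrp_sub colgrp_sub by blast+
  have nth: "I ! prm g \<alpha> = I ! \<alpha>" if "g \<in> symgrp ?n" "pact (prm g) I = I" "\<alpha> < ?n" for g \<alpha>
    using nth_pact[of "prm g \<alpha>" I "prm g"] that symgrp_less(1)[OF that(1)] lI by simp
  have "csign p I (inv (prm \<sigma>)) = 1"
  proof (rule csign_fixed_odd[OF lI s(2)])
    fix \<alpha> assume a: "\<alpha> < ?n" "oddi p (I ! \<alpha>)"
    have b: "prm \<sigma> \<alpha> < ?n" using symgrp_less(1)[OF S(1)] a by simp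
    have r: "row_of la (prm \<sigma> \<alpha>) = row_of la \<alpha>" using s a by (auto simp: rowgrp_def Rt_def)
    have e: "I ! prm \<sigma> \<alpha> = I ! \<alpha>" using nth[OF S(1) s(2) a(1)] .
    have "col_of la (prm \<sigma> \<alpha>) = col_of la \<alpha>"
    proof (rule ccontr)
      assume "col_of la (prm \<sigma> \<alpha>) \<noteq> col_of la \<alpha>"
      hence "col_of la (prm \<sigma> \<alpha>) < col_of la \<alpha> \<or> col_of la \<alpha> < col_of la (prm \<sigma> \<alpha>)" by auto
      hence "I ! prm \<sigma> \<alpha> < I ! \<alpha> \<or> I ! \<alpha> < I ! prm \<sigma> \<alpha>"
        using I[unfolded semistandard_def] a b r e by (metis (no_types))
      thus False using e by simp
    qed
    thus "prm \<sigma> \<alpha> = \<alpha>" using row_col_inj[OF b a(1) r] by simp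
  qed
  moreover have "csign p I (inv (prm \<tau>)) = of_real (sg \<tau>)"
  proof (rule csign_fixed_even[OF S(2) lI t(2)])
    fix \<alpha> assume a: "\<alpha> < ?n" "\<not> oddi p (I ! \<alpha>)"
    have b: "prm \<tau> \<alpha> < ?n" using symgrp_less(1)[OF S(2)] a by simp
    have c: "col_of la (prm \<tau> \<alpha>) = col_of la \<alpha>" using t a by (auto simp: colgrp_def Ct_def)
    have e: "I ! prm \<tau> \<alpha> = I ! \<alpha>" using nth[OF S(2) t(2) a(1)] .
    have "row_of la (prm \<tau> \<alpha>) = row_of la \<alpha>"
    proof (rule ccontr)
      assume "row_of la (prm \<tau> \<alpha>) \<noteq> row_of la \<alpha>"
      hence "row_of la (prm \<tau> \<alpha>) < row_of la \<alpha> \<or> row_of la \<alpha> < row_of la (prm \<tau> \<alpha>)" by auto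
      hence "I ! prm \<tau> \<alpha> < I ! \<alpha> \<or> I ! \<alpha> < I ! prm \<tau> \<alpha>"
        using I[unfolded semistandard_def] a b c e by (metis (no_types))
      thus False using e by simp
    qed
    thus "prm \<tau> \<alpha> = \<alpha>" using row_col_inj[OF b a(1)] c by simp
  qed
  moreover have "sg \<tau> * sg \<tau> = 1" using sg_pm[of \<tau>] by auto
  ultimately show ?thesis
    using csign_plus_fixed[OF S lI s(2) t(2), of p] by (metis mult_1 of_real_1 of_real_mult)
qed

lemma finite_semistandard: "finite {I. semistandard p q la I}"
  by (rule finite_subset[OF _ finite_seqs[of p q "sum_list la"]]) (auto simp: semistandard_def)

lemma young_vec_independent:
  assumes zero: "(\<Sum>I | semistandard p q la I. smul (c I) (young_vec p la I)) = 0"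
  shows "\<forall>I\<in>{I. semistandard p q la I}. c I = 0"
proof (rule ccontr)
  let ?S = "{I. semistandard p q la I}" and ?w = "wt (row_of la)"
  let ?N = "{I \<in> ?S. c I \<noteq> 0}"
  assume "\<not> ?thesis"
  hence ne: "?N \<noteq> {}" by auto
  have fin: "finite ?N" using finite_semistandard by simp
  have "Max (?w ` ?N) \<in> ?w ` ?N" by (rule Max_in) (use fin ne in auto)
  then obtain I0 where I0: "Max (?w ` ?N) = ?w I0" "I0 \<in> ?N" by (rule imageE)
  have max: "?w I \<le> ?w I0" if "I \<in> ?N" for I
  proof -
    have "?w I \<le> Max (?w ` ?N)" by (rule Max_ge) (use fin that in auto)
    thus ?thesis by (simp only: I0(1))
  qed
  have I0S: "semistandard p q la I0" "c I0 \<noteq> 0" using I0(2) by auto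
  \<comment> \<open>By maximality of its weight, \<open>I0\<close> is not reached from any other
    sequence with nonzero coefficient.\<close>
  have off: "young_vec p la I I0 = 0" if I: "I \<in> ?N" "I \<noteq> I0" for I
  proof -
    have ne: "pact (prm (\<sigma> + \<tau>)) I \<noteq> I0" if "\<sigma> \<in> rowgrp la" "\<tau> \<in> colgrp la" for \<sigma> \<tau>
      using semistandard_leading[OF _ I0S(1) that] I max[OF I(1)] by auto
    show ?thesis
      unfolding young_vec_sum sum_apply
    proof (intro sum.neutral ballI)
      fix \<tau> \<sigma> assume "\<tau> \<in> colgrp la" "\<sigma> \<in> rowgrp la"
      hence "delta (pact (prm (\<sigma> + \<tau>)) I) I0 = 0" using ne[of \<sigma> \<tau>] by (simp add: delta_def del: prm_plus)
      thus "smul (of_real (sg \<tau>) * csign p I (inv (prm (\<sigma> + \<tau>)))) (delta (pact (prm (\<sigma> + \<tau>)) I)) I0 = 0"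
        by (simp only: smul_apply mult_zero_right)
    qed
  qed
  \<comment> \<open>The leading coefficient counts pairs of permutations whose product fixes
    \<open>I0\<close>, among them the pair of identities.\<close>
  have "young_vec p la I0 I0 = (\<Sum>\<tau>\<in>colgrp la. \<Sum>\<sigma>\<in>rowgrp la. if pact (prm (\<sigma> + \<tau>)) I0 = I0 then 1 else 0)"
    unfolding young_vec_sum sum_apply
  proof (intro sum.cong refl)
    fix \<tau> \<sigma> assume st: "\<tau> \<in> colgrp la" "\<sigma> \<in> rowgrp la"
    show "smul (of_real (sg \<tau>) * csign p I0 (inv (prm (\<sigma> + \<tau>)))) (delta (pact (prm (\<sigma> + \<tau>)) I0)) I0 =
       (if pact (prm (\<sigma> + \<tau>)) I0 = I0 then 1 else 0)"
      using semistandard_fixed_sign[OF I0S(1) st(2) _ st(1)] semistandard_leading[OF I0S(1) I0S(1) st(2,1)]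
      by (auto simp: delta_def simp del: prm_plus)
  qed
  also have "\<dots> = of_nat (\<Sum>\<tau>\<in>colgrp la. \<Sum>\<sigma>\<in>rowgrp la. if pact (prm (\<sigma> + \<tau>)) I0 = I0 then 1 else 0)"
    by (simp only: of_nat_sum of_nat_1 of_nat_0 if_distrib[of of_nat] cong: if_cong)
  also have "\<dots> \<noteq> 0"
  proof -
    have z: "0 \<in> colgrp la" "0 \<in> rowgrp la" "finite (colgrp la)" "finite (rowgrp la)"
      using colgrp.zero_S rowgrp.zero_S
        colgrp.finite_S rowgrp.finite_S by auto
    show ?thesis unfolding of_nat_eq_0_iff using z pact_zero[of I0] by (auto simp: sum_eq_0_iff simp del: prm_plus prm_zero intro!: bexI[of _ 0])
  qed
  finally have diag: "young_vec p la I0 I0 \<noteq> 0" .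
  have "0 = (\<Sum>I\<in>?S. smul (c I) (young_vec p la I)) I0" by (simp only: zero) simp
  also have "\<dots> = (\<Sum>I\<in>?S. c I * young_vec p la I I0)" by simp
  also have "\<dots> = (\<Sum>I\<in>{I0}. c I * young_vec p la I I0)"
    by (rule sum.mono_neutral_right) (use finite_semistandard I0S off in auto)
  finally show False using diag I0S(2) by simp
qed

section \<open>Straightening\<close>

lemma partition_antimono:
  assumes "is_partition la" "r \<le> s" "s < length la" shows "la ! s \<le> la ! r"
  using assms(2,3)
proof (induction s rule: dec_induct)
  case (step s)
  thus ?case using assms(1) by (auto simp: is_partition_def intro: order.trans)
qed simp

lemma permutes_signed: assumes "X \<subseteq> {..<n}" shows "signed_group {g. prm g permutes X} sg"
proof
  have sub: "{g. prm g permutes X} \<subseteq> symgrp n" using assms permutes_subset by (auto simp: symgrp_def)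
  thus "finite {g. prm g permutes X}" using finite_symgrp finite_subset by blast
  show "0 \<in> {g. prm g permutes X}" by (simp add: permutes_id)
  show "g + h \<in> {g. prm g permutes X}" if "g \<in> {g. prm g permutes X}" "h \<in> {g. prm g permutes X}" for g h
    using that by (simp add: permutes_compose)
  show "- g \<in> {g. prm g permutes X}" if "g \<in> {g. prm g permutes X}" for g
    using that by (simp add: permutes_inv)
  show "sg (g + h) = sg g * sg h" if "g \<in> {g. prm g permutes X}" "h \<in> {g. prm g permutes X}" for g h
    using that sub sg_hom by blast
qed (rule sg_pm)

text \<open>Pigeonhole: if \<open>X\<close> is larger than its set of rows after any column permutation, then its
  antisymmetriser is killed by the Young symmetriser.\<close>

lemma garnir_vanish:
  assumes X: "X \<subseteq> {..<sum_list la}"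
    and ph: "\<And>\<tau>. \<tau> \<in> colgrp la \<Longrightarrow> \<not> inj_on (\<lambda>\<gamma>. row_of la (prm \<tau> \<gamma>)) X"
  shows "rowsym la * colalt la * chsum {g. prm g permutes X} sg = 0"
proof -
  let ?G = "chsum {g. prm g permutes X} sg"
  have 1: "rowsym la * sng \<tau> 1 * ?G = 0" if t: "\<tau> \<in> colgrp la" for \<tau>
  proof -
    obtain i j where ij: "i \<in> X" "j \<in> X" "i \<noteq> j" "row_of la (prm \<tau> i) = row_of la (prm \<tau> j)"
      using ph[OF t] by (auto simp: inj_on_def)
    have S: "\<tau> \<in> symgrp (sum_list la)" using t colgrp_sub by blast
    have lt: "prm \<tau> i < sum_list la" "prm \<tau> j < sum_list la" using ij X symgrp_less(1)[OF S] by auto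
    have r: "rowsym la * sng (swp (prm \<tau> i) (prm \<tau> j)) 1 = rowsym la"
      unfolding rowsym_def using rowgrp.right_mult[OF swp_rowgrp[OF lt ij(4)]] by simp
    have "swp i j \<in> {g. prm g permutes X}" using ij by (simp add: prm_swp permutes_swap_id)
    hence c: "sng (swp i j) 1 * ?G = - ?G"
      using signed_group.left_mult[OF permutes_signed[OF X]] sg_swp[OF ij(3)] by (simp add: single_uminus)
    have cj: "swp (prm \<tau> i) (prm \<tau> j) + \<tau> = \<tau> + swp i j" using swp_conj[of "prm \<tau> i" "prm \<tau> j" \<tau>] by simp
    have "rowsym la * sng \<tau> 1 * ?G = rowsym la * (sng (swp (prm \<tau> i) (prm \<tau> j)) 1 * sng \<tau> 1) * ?G"
      by (simp add: r flip: mult.assoc)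
    also have "\<dots> = rowsym la * (sng \<tau> 1 * sng (swp i j) 1) * ?G"
      by (simp add: mult_single cj)
    also have "\<dots> = - (rowsym la * sng \<tau> 1 * ?G)" by (simp add: mult.assoc c)
    finally show ?thesis by (rule neg_self_zero)
  qed
  have s: "sng g d = scal d * sng g 1" for g d by (simp add: mult_single)
  have "rowsym la * colalt la * ?G = (\<Sum>\<tau>\<in>colgrp la. scal (sg \<tau>) * (rowsym la * sng \<tau> 1 * ?G))"
    unfolding colalt_def chsum_def[of "colgrp la"]
    by (subst s) (simp add: sum_distrib_left sum_distrib_right scal_commute_left mult.assoc)
  thus ?thesis by (simp add: 1)
qed

text \<open>An involution exchanging \<open>A - A'\<close> with \<open>A' - A\<close>. That it moves
  no other points matters in straightening, where exactly these places carry equal letters.\<close>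

lemma exchange_permutation:
  assumes fin: "finite X" and sub: "A \<subseteq> X" "A' \<subseteq> X" and card: "card A = card A'"
  obtains s where "s permutes X" "s ` A = A'" "\<And>\<gamma>. s \<gamma> \<noteq> \<gamma> \<Longrightarrow> \<gamma> \<in> (A - A') \<union> (A' - A) \<and> s \<gamma> \<in> (A - A') \<union> (A' - A)"
proof -
  have finA: "finite A" "finite A'" using sub fin finite_subset by auto
  have "card (A - A') = card (A' - A)"
    using card finA by (metis card_Diff_subset_Int Int_commute finite_Int)
  then obtain f where f: "bij_betw f (A - A') (A' - A)" using finA by (meson finite_Diff finite_same_card_bij)
  define s where "s \<gamma> = (if \<gamma> \<in> A - A' then f \<gamma> else if \<gamma> \<in> A' - A then inv_into (A - A') f \<gamma> else \<gamma>)" for \<gamma>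
  have f1: "f \<gamma> \<in> A' - A" "inv_into (A - A') f (f \<gamma>) = \<gamma>" if "\<gamma> \<in> A - A'" for \<gamma>
    using f that by (auto simp: bij_betw_def)
  have f2: "inv_into (A - A') f \<gamma> \<in> A - A'" "f (inv_into (A - A') f \<gamma>) = \<gamma>" if "\<gamma> \<in> A' - A" for \<gamma>
    using bij_betwE[OF bij_betw_inv_into[OF f]] bij_betw_inv_into_right[OF f] that by blast+
  have ss: "s (s \<gamma>) = \<gamma>" for \<gamma> using f1[of \<gamma>] f2[of \<gamma>] by (auto simp: s_def)
  have "s permutes X"
    unfolding permutes_def
  proof (intro conjI allI impI)
    fix x assume "x \<notin> X" thus "s x = x" using sub by (auto simp: s_def)
  next
    fix y show "\<exists>!x. s x = y" using ss by metis
  qed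
  moreover have "s ` A = A'"
  proof
    show "s ` A \<subseteq> A'" using f1 by (auto simp: s_def)
    show "A' \<subseteq> s ` A"
    proof
      fix y assume "y \<in> A'"
      hence "s y \<in> A" using f2[of y] by (auto simp: s_def)
      thus "y \<in> s ` A" using ss[of y] by (metis imageI)
    qed
  qed
  moreover have "\<gamma> \<in> (A - A') \<union> (A' - A) \<and> s \<gamma> \<in> (A - A') \<union> (A' - A)" if "s \<gamma> \<noteq> \<gamma>" for \<gamma>
    using that f1[of \<gamma>] f2[of \<gamma>] by (auto simp: s_def split: if_splits)
  ultimately show ?thesis using that by blast
qed

text \<open>Passing from \<open>A\<close> to \<open>A'\<close> trades values at least
  \<open>x\<close> for as many values at most \<open>y\<close>; if the sum does not fall, every
  traded value is \<open>x = y\<close>.\<close>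

lemma equal_sum_exchange:
  fixes f :: "nat \<Rightarrow> nat"
  assumes fin: "finite A" "finite A'" and card: "card A = card A'"
    and ge: "\<And>\<gamma>. \<gamma> \<in> A \<Longrightarrow> x \<le> f \<gamma>" and le: "\<And>\<gamma>. \<gamma> \<in> A' - A \<Longrightarrow> f \<gamma> \<le> y" and yx: "y \<le> x"
    and sum: "sum f A \<le> sum f A'" and g: "\<gamma> \<in> (A - A') \<union> (A' - A)"
  shows "f \<gamma> = x \<and> x = y"
proof -
  let ?D = "A - A'" and ?E = "A' - A"
  have cDE: "card ?D = card ?E" using card fin by (metis card_Diff_subset_Int Int_commute finite_Int)
  have "sum f A = sum f (A \<inter> A') + sum f ?D" "sum f A' = sum f (A \<inter> A') + sum f ?E"
    using fin by (metis sum.Int_Diff Int_commute)+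
  hence DE: "sum f ?D \<le> sum f ?E" using sum by simp
  have D: "card ?D * x \<le> sum f ?D" using sum_bounded_below[of ?D x f] ge by auto
  have E: "sum f ?E \<le> card ?E * y" using sum_bounded_above[of ?E f y] le by auto
  have "card ?E * y \<le> card ?D * x" using yx cDE by simp
  hence eqs: "sum f ?D = card ?D * x" "sum f ?E = card ?E * y" "card ?E * y = card ?D * x" using D E DE by linarith+
  have ne: "card ?D \<noteq> 0"
  proof
    assume "card ?D = 0"
    hence "?D = {}" "?E = {}" using cDE fin by (metis card_0_eq finite_Diff)+
    thus False using g by blast
  qed
  hence xy: "x = y" using eqs(3) cDE by simp
  have "(\<Sum>\<gamma>\<in>?D. x) = sum f ?D" "sum f ?E = (\<Sum>\<gamma>\<in>?E. y)" using eqs by simp_all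
  note eqs' = this
  have "x = f \<gamma>" if "\<gamma> \<in> ?D" for \<gamma> by (rule sum_mono_inv[OF eqs'(1) _ that]) (use ge fin in auto)
  moreover have "f \<gamma> = y" if "\<gamma> \<in> ?E" for \<gamma> by (rule sum_mono_inv[OF eqs'(2) _ that]) (use le fin in auto)
  ultimately show ?thesis using g xy by blast
qed

text \<open>Antisymmetrise over column \<open>c\<close> from the violating row downwards together
  with column \<open>c'\<close> down to that row. The letters of the first part are at least those
  of the second. So a permutation either raises the column weight, and induction applies, or up to a
  column permutation it only trades equal odd letters, and its term is
  \<open>young_vec p la J\<close> with coefficient +1. The latter terms cannot cancel.\<close>

lemma young_vec_straighten:
  assumes part: "is_partition la" and J: "J \<in> seqs p q (sum_list la)" and cs: "colsorted la J"
    and ab: "\<alpha> < sum_list la" "\<beta> < sum_list la" "row_of la \<alpha> = row_of la \<beta>" "col_of la \<alpha> < col_of la \<beta>"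
    and viol: "J ! \<beta> \<le> J ! \<alpha>" "J ! \<alpha> = J ! \<beta> \<Longrightarrow> oddi p (J ! \<alpha>)"
    and IH: "\<And>K. K \<in> seqs p q (sum_list la) \<Longrightarrow> wt (col_of la) J < wt (col_of la) K \<Longrightarrow> young_vec p la K \<in> fn.span S"
  shows "young_vec p la J \<in> fn.span S"
proof -
  let ?n = "sum_list la" and ?row = "row_of la" and ?col = "col_of la"
  define r0 where "r0 = ?row \<alpha>"
  define c where "c = ?col \<alpha>"
  define c' where "c' = ?col \<beta>"
  define A where "A = {\<gamma>. \<gamma> < ?n \<and> ?col \<gamma> = c \<and> r0 \<le> ?row \<gamma>}"
  define B where "B = {\<gamma>. \<gamma> < ?n \<and> ?col \<gamma> = c' \<and> ?row \<gamma> \<le> r0}"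
  define X where "X = A \<union> B"
  have lJ: "length J = ?n" using J by (simp add: seqs_def)
  have cc: "c < c'" using ab by (simp add: c_def c'_def)
  have fin: "finite A" "finite B" "finite X" by (auto simp: A_def B_def X_def)
  have dis: "A \<inter> B = {}" using cc by (auto simp: A_def B_def)
  have Xn: "X \<subseteq> {..<?n}" by (auto simp: X_def A_def B_def)
  have r0: "r0 < length la" "c' < la ! r0"
    using row_col[OF ab(2)] ab(3) by (auto simp: r0_def c'_def)
  have JA: "J ! \<alpha> \<le> J ! \<gamma>" if "\<gamma> \<in> A" for \<gamma>
  proof (cases "?row \<gamma> = r0")
    case True
    hence "\<gamma> = \<alpha>" using that ab row_col_inj by (auto simp: A_def c_def r0_def)
    thus ?thesis by simp
  next
    case False
    thus ?thesis using that cs ab by (auto simp: A_def c_def r0_def colsorted_def)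
  qed
  have JB: "J ! \<gamma> \<le> J ! \<beta>" if "\<gamma> \<in> B" for \<gamma>
  proof (cases "?row \<gamma> = r0")
    case True
    hence "\<gamma> = \<beta>" using that ab row_col_inj by (auto simp: B_def c'_def r0_def)
    thus ?thesis by simp
  next
    case False
    thus ?thesis using that cs ab by (auto simp: B_def c'_def r0_def colsorted_def)
  qed

  \<comment> \<open>Under \<open>\<tau>\<close> the set \<open>X\<close> stays in its two columns,
    hence in rows that reach column \<open>c\<close>. At most \<open>card A\<close> of these lie
    from row \<open>r0\<close> on and \<open>r0\<close> above it, whereas \<open>B\<close> has at
    least \<open>r0 + 1\<close> cells because all rows up to \<open>r0\<close> reach column
    \<open>c'\<close>.\<close>
  have ph: "\<not> inj_on (\<lambda>\<gamma>. ?row (prm \<tau> \<gamma>)) X" if t: "\<tau> \<in> colgrp la" for \<tau>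
  proof
    assume inj: "inj_on (\<lambda>\<gamma>. ?row (prm \<tau> \<gamma>)) X"
    let ?R = "{r. r < length la \<and> c < la ! r}"
    have S: "\<tau> \<in> symgrp ?n" using t colgrp_sub by blast
    have "?row (prm \<tau> \<gamma>) \<in> ?R" if "\<gamma> \<in> X" for \<gamma>
    proof -
      have g: "\<gamma> < ?n" "?col \<gamma> = c \<or> ?col \<gamma> = c'" using that by (auto simp: X_def A_def B_def)
      have "?col (prm \<tau> \<gamma>) = ?col \<gamma>" using t g(1) by (auto simp: colgrp_def Ct_def)
      thus ?thesis using row_col[of "prm \<tau> \<gamma>" la] g cc symgrp_less(1)[OF S, of \<gamma>] by auto
    qed
    hence "card X \<le> card ?R" using inj by (intro card_inj_on_le[of "\<lambda>\<gamma>. ?row (prm \<tau> \<gamma>)"]) auto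
    moreover have "card ?R \<le> card {r \<in> ?R. r0 \<le> r} + card {..<r0}"
      by (rule order.trans[OF card_mono card_Un_le]) auto
    moreover have "card {r \<in> ?R. r0 \<le> r} \<le> card A"
    proof (rule card_inj_on_le[of "\<lambda>r. cell la r c"])
      show "inj_on (\<lambda>r. cell la r c) {r \<in> ?R. r0 \<le> r}"
        by (rule inj_on_inverseI[of _ ?row]) (auto simp: row_cell)
    qed (auto simp: A_def cell_less row_cell col_cell)
    moreover have "card {..r0} \<le> card B"
    proof (rule card_inj_on_le[of "\<lambda>r. cell la r c'"])
      have *: "r < length la \<and> c' < la ! r" if "r \<le> r0" for r
        using partition_antimono[OF part that r0(1)] r0 that by auto
      show "inj_on (\<lambda>r. cell la r c') {..r0}"
        by (rule inj_on_inverseI[of _ ?row]) (auto simp: row_cell *)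
      show "(\<lambda>r. cell la r c') ` {..r0} \<subseteq> B" using * by (auto simp: B_def cell_less row_cell col_cell)
    qed (rule fin)
    moreover have "card X = card A + card B" unfolding X_def by (rule card_Un_disjoint) (use fin dis in auto)
    ultimately show False by simp
  qed

  let ?G = "{g. prm g permutes X}"
  interpret G: signed_group ?G sg by (rule permutes_signed[OF Xn])
  have GS: "?G \<subseteq> symgrp ?n" using Xn permutes_subset by (auto simp: symgrp_def)
  define Z where "Z g = smul (of_real (sg g)) (yact p la (pop p ?n g (delta J)))" for g
  have "0 = act p ?n (rowsym la * colalt la * chsum ?G sg) (delta J)"
    by (simp add: garnir_vanish[OF Xn ph] act_zero_left)
  also have "\<dots> = yact p la (act p ?n (chsum ?G sg) (delta J))"
    by (rule act_mult) (use keys_row_col G.keys_chsum GS in auto)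
  also have "act p ?n (chsum ?G sg) (delta J) = (\<Sum>g\<in>?G. smul (of_real (sg g)) (pop p ?n g (delta J)))"
    unfolding chsum_def act_sum_left by (rule sum.cong[OF refl]) (use GS act_sng in blast)
  also have "yact p la \<dots> = (\<Sum>g\<in>?G. Z g)" by (simp only: act_sum act_smul Z_def)
  finally have Z0: "(\<Sum>g\<in>?G. Z g) = 0" by (rule sym)

  have Zspan: "Z g \<in> fn.span S" if g: "g \<in> ?G" "wt ?col J < wt ?col (pact (prm g) J)" for g
  proof -
    have S: "g \<in> symgrp ?n" using g GS by blast
    have K: "pact (prm g) J \<in> seqs p q ?n" using pact_seqs[OF S J] .
    have "yact p la (delta (pact (prm g) J)) \<in> fn.span S"
      using IH[OF K g(2)] by (simp add: young_vec_act lJ)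
    thus ?thesis by (simp add: Z_def pop_delta[OF S lJ] act_smul fn.span_scale)
  qed

  have Zeq: "Z g = young_vec p la J" if g: "g \<in> ?G" and le: "\<not> wt ?col J < wt ?col (pact (prm g) J)" for g
  proof -
    have S: "g \<in> symgrp ?n" using g GS by blast
    have gX: "prm g permutes X" using g by simp
    have igX: "inv (prm g) permutes X" using gX by (rule permutes_inv)
    let ?f = "\<lambda>\<gamma>. J ! \<gamma>" and ?f' = "\<lambda>\<gamma>. J ! inv (prm g) \<gamma>"
    \<comment> \<open>The places whose letters \<open>g\<close> moves into \<open>A\<close>.\<close>
    define A' where "A' = inv (prm g) ` A"
    have A'X: "A' \<subseteq> X" using permutes_image[OF igX] by (auto simp: A'_def X_def)
    have injg: "inj_on (inv (prm g)) T" for T using permutes_inj[OF igX] by (meson inj_on_subset subset_UNIV)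
    have cA': "card A = card A'" unfolding A'_def by (rule card_image[OF injg, symmetric])
    have sumA': "sum ?f' A = sum ?f A'" unfolding A'_def by (subst sum.reindex[OF injg]) simp
    have wsplit: "wt ?col K = c * sum (\<lambda>\<gamma>. K ! \<gamma>) A + c' * sum (\<lambda>\<gamma>. K ! \<gamma>) B + (\<Sum>\<gamma>\<in>{..<?n} - X. ?col \<gamma> * K ! \<gamma>)"
      if "length K = ?n" for K
    proof -
      have "wt ?col K = (\<Sum>\<gamma>\<in>{..<?n} - X. ?col \<gamma> * K ! \<gamma>) + (\<Sum>\<gamma>\<in>X. ?col \<gamma> * K ! \<gamma>)"
        unfolding wt_def that by (rule sum.subset_diff) (use Xn in auto)
      also have "(\<Sum>\<gamma>\<in>X. ?col \<gamma> * K ! \<gamma>) = (\<Sum>\<gamma>\<in>A. ?col \<gamma> * K ! \<gamma>) + (\<Sum>\<gamma>\<in>B. ?col \<gamma> * K ! \<gamma>)"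
        unfolding X_def by (rule sum.union_disjoint) (use fin dis in auto)
      also have "(\<Sum>\<gamma>\<in>A. ?col \<gamma> * K ! \<gamma>) = c * sum (\<lambda>\<gamma>. K ! \<gamma>) A" by (simp add: sum_distrib_left A_def)
      also have "(\<Sum>\<gamma>\<in>B. ?col \<gamma> * K ! \<gamma>) = c' * sum (\<lambda>\<gamma>. K ! \<gamma>) B" by (simp add: sum_distrib_left B_def)
      finally show ?thesis by simp
    qed
    have nthg: "pact (prm g) J ! \<gamma> = ?f' \<gamma>" if "\<gamma> < ?n" for \<gamma> using nth_pact that lJ by simp
    have out: "(\<Sum>\<gamma>\<in>{..<?n} - X. ?col \<gamma> * pact (prm g) J ! \<gamma>) = (\<Sum>\<gamma>\<in>{..<?n} - X. ?col \<gamma> * J ! \<gamma>)"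
      by (rule sum.cong) (auto simp: nthg permutes_not_in[OF igX])
    have sA: "sum (\<lambda>\<gamma>. pact (prm g) J ! \<gamma>) A = sum ?f' A" by (rule sum.cong) (auto simp: nthg A_def)
    have sB: "sum (\<lambda>\<gamma>. pact (prm g) J ! \<gamma>) B = sum ?f' B" by (rule sum.cong) (auto simp: nthg B_def)
    have tot: "sum ?f' A + sum ?f' B = sum ?f A + sum ?f B"
    proof -
      have "sum ?f' X = sum ?f X" using sum.permute[OF igX, of ?f] by (simp add: o_def)
      thus ?thesis unfolding X_def using fin dis by (simp add: sum.union_disjoint)
    qed
    have "c * sum ?f' A + c' * sum ?f' B \<le> c * sum ?f A + c' * sum ?f B"
      using le wsplit[OF lJ] wsplit[of "pact (prm g) J"] out sA sB lJ by simp
    \<comment> \<open>The total over \<open>X\<close> is fixed and \<open>c < c'\<close>, so the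
      weight fails to grow only if the letters in \<open>A\<close> do not lose in sum.\<close>
    hence sle: "sum ?f A \<le> sum ?f A'"
    proof -
      assume a: "c * sum ?f' A + c' * sum ?f' B \<le> c * sum ?f A + c' * sum ?f B"
      obtain d where d: "c' = c + d" "d > 0" using cc less_imp_add_positive by blast
      have "c * (sum ?f' A + sum ?f' B) + d * sum ?f' B \<le> c * (sum ?f A + sum ?f B) + d * sum ?f B"
        using a by (simp add: d(1) algebra_simps)
      hence "sum ?f' B \<le> sum ?f B" using tot d(2) by simp
      thus ?thesis using tot sumA' by simp
    qed
    have exch: "J ! \<gamma> = J ! \<alpha> \<and> J ! \<alpha> = J ! \<beta>" if "\<gamma> \<in> (A - A') \<union> (A' - A)" for \<gamma>
    proof (rule equal_sum_exchange[OF fin(1) _ cA' _ _ viol(1) sle that])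
      show "finite A'" using A'X fin finite_subset by blast
      show "J ! \<gamma> \<le> J ! \<beta>" if "\<gamma> \<in> A' - A" for \<gamma> using JB that A'X by (auto simp: X_def)
    qed (use JA in auto)
    \<comment> \<open>\<open>s0\<close> carries \<open>A\<close> to \<open>A'\<close> through places
      with equal letters. So \<open>\<tau> = g + h\<close> preserves \<open>A\<close> and
      \<open>B\<close> and is a column permutation, while \<open>h\<close> changes the tensor of
      \<open>J\<close> only by a sign.\<close>
    obtain s0 where s0: "s0 permutes X" "s0 ` A = A'"
      "\<And>\<gamma>. s0 \<gamma> \<noteq> \<gamma> \<Longrightarrow> \<gamma> \<in> (A - A') \<union> (A' - A) \<and> s0 \<gamma> \<in> (A - A') \<union> (A' - A)"
      using exchange_permutation[OF fin(3) _ A'X cA'] by (auto simp: X_def)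
    define h where "h = Natperm s0"
    have ph: "prm h = s0" unfolding h_def using s0(1) by (rule prm_Natperm)
    have hG: "h \<in> ?G" using s0(1) ph by simp
    have Jh: "J ! s0 \<gamma> = J ! \<gamma>" for \<gamma>
    proof (cases "s0 \<gamma> = \<gamma>")
      case False
      hence "J ! \<gamma> = J ! \<alpha>" "J ! s0 \<gamma> = J ! \<alpha>" using s0(3) exch by blast+
      thus ?thesis by simp
    qed simp
    define \<tau> where "\<tau> = g + h"
    have tG: "\<tau> \<in> ?G" unfolding \<tau>_def by (rule G.plus_S[OF g hG])
    have tX: "prm \<tau> permutes X" using tG by simp
    have tA: "prm \<tau> ` A = A"
    proof -
      have "prm \<tau> ` A = prm g ` (s0 ` A)" by (simp add: \<tau>_def ph image_image)
      also have "\<dots> = A" by (simp add: s0(2) A'_def image_image)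
      finally show ?thesis .
    qed
    have tB: "prm \<tau> \<gamma> \<in> B" if "\<gamma> \<in> B" for \<gamma>
    proof -
      have "prm \<tau> \<gamma> \<in> X" using permutes_in_image[OF tX] that by (simp add: X_def)
      moreover have "prm \<tau> \<gamma> \<notin> A"
      proof
        assume "prm \<tau> \<gamma> \<in> A"
        then obtain \<delta> where "\<delta> \<in> A" "prm \<tau> \<gamma> = prm \<tau> \<delta>" using tA by (metis imageE)
        thus False using that dis by (metis disjoint_iff prm_uminus_prm(1))
      qed
      ultimately show ?thesis by (simp add: X_def)
    qed
    have tC: "\<tau> \<in> colgrp la"
    proof -
      have "?col (prm \<tau> \<gamma>) = ?col \<gamma>" for \<gamma>
      proof (cases "\<gamma> \<in> X")
        case True
        show ?thesis
        proof (cases "\<gamma> \<in> A")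
          case True
          hence "prm \<tau> \<gamma> \<in> A" using tA by blast
          thus ?thesis using True by (simp add: A_def)
        next
          case False
          hence "\<gamma> \<in> B" using \<open>\<gamma> \<in> X\<close> by (simp add: X_def)
          thus ?thesis using tB[of \<gamma>] by (simp add: B_def)
        qed
      qed (simp add: permutes_not_in[OF tX])
      moreover have "prm \<tau> permutes {..<?n}" using GS tG by (auto simp: symgrp_def)
      ultimately show ?thesis by (auto simp: colgrp_def Ct_def)
    qed
    have hS: "h \<in> symgrp ?n" and tS: "\<tau> \<in> symgrp ?n" using GS hG tG by auto
    have mS: "- h \<in> symgrp ?n" using hS by (rule symgrp_uminus)
    have geq: "g = \<tau> + - h" by (simp add: \<tau>_def add.assoc)
    have ii: "inv (inv s0) = s0" using s0(1) by (simp add: permutes_inv_inv)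
    have fixJ: "pact (prm (- h)) J = J"
      by (rule nth_equalityI) (auto simp: nth_pact ph ii Jh)
    have "csign p J (inv (prm (- h))) = of_real (sg (- h))"
    proof (rule csign_fixed_even[OF mS lJ fixJ])
      fix \<gamma> assume "\<gamma> < ?n" "\<not> oddi p (J ! \<gamma>)"
      have "s0 \<gamma> = \<gamma>"
      proof (rule ccontr)
        assume "s0 \<gamma> \<noteq> \<gamma>"
        hence "J ! \<gamma> = J ! \<alpha> \<and> J ! \<alpha> = J ! \<beta>" using s0(3) exch by blast
        thus False using viol(2) \<open>\<not> oddi p (J ! \<gamma>)\<close> by simp
      qed
      thus "prm (- h) \<gamma> = \<gamma>" using permutes_inverses(2)[OF s0(1), of \<gamma>] by (simp add: ph)
    qed
    hence "pop p ?n (- h) (delta J) = smul (of_real (sg (- h))) (delta J)"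
      using pop_delta[OF mS lJ] fixJ by simp
    hence "pop p ?n g (delta J) = smul (of_real (sg (- h))) (pop p ?n \<tau> (delta J))"
      by (subst geq, subst pop_plus[OF tS mS]) (simp add: pop_smul)
    hence "Z g = smul (of_real (sg g * sg (- h) * sg \<tau>)) (young_vec p la J)"
      by (simp add: Z_def act_smul yact_pop[OF tC] young_vec_act lJ mult.assoc)
    \<comment> \<open>Three signs meet: that of the antisymmetriser, the Koszul sign of
      \<open>- h\<close> on equal odd letters, and that of the column permutation
      \<open>\<tau>\<close>.\<close>
    moreover have "sg g * sg (- h) * sg \<tau> = 1"
    proof -
      have "sg g = sg \<tau> * sg (- h)" using sg_hom[OF tS mS] geq by simp
      thus ?thesis using sg_pm[of \<tau>] sg_pm[of "- h"] by auto
    qed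
    ultimately show ?thesis by simp
  qed

  let ?H = "{g \<in> ?G. \<not> wt ?col J < wt ?col (pact (prm g) J)}"
  have finG: "finite ?G" by (rule G.finite_S)
  have "(\<Sum>g\<in>?G. Z g) = (\<Sum>g\<in>?G - ?H. Z g) + (\<Sum>g\<in>?H. Z g)"
    by (rule sum.subset_diff) (use finG in auto)
  also have "(\<Sum>g\<in>?H. Z g) = (\<Sum>g\<in>?H. young_vec p la J)"
    by (rule sum.cong[OF refl]) (use Zeq in blast)
  also have "\<dots> = smul (of_nat (card ?H)) (young_vec p la J)"
    by (simp add: fun_eq_iff)
  finally have split: "(\<Sum>g\<in>?G. Z g) = (\<Sum>g\<in>?G - ?H. Z g) + smul (of_nat (card ?H)) (young_vec p la J)" .
  have "smul (of_nat (card ?H)) (young_vec p la J) = - (\<Sum>g\<in>?G - ?H. Z g)"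
    by (rule iffD1[OF add_eq_0_iff trans[OF split[symmetric] Z0]])
  moreover have "- (\<Sum>g\<in>?G - ?H. Z g) \<in> fn.span S"
    by (rule fn.span_neg, rule fn.span_sum, rule Zspan) auto
  ultimately have "smul (inverse (of_nat (card ?H))) (smul (of_nat (card ?H)) (young_vec p la J)) \<in> fn.span S"
    by (simp only: fn.span_scale)
  \<comment> \<open>The identity is among the terms that return
    \<open>young_vec p la J\<close>.\<close>
  moreover have "card ?H \<noteq> 0"
  proof -
    have "0 \<in> ?H" using pact_zero[of J] G.zero_S by auto
    moreover have "finite ?H" using finG by simp
    ultimately show ?thesis by (auto simp only: card_eq_0_iff)
  qed
  ultimately show ?thesis by simp
qed

lemma wt_bound: "I \<in> seqs p q n \<Longrightarrow> wt (col_of la) I \<le> (\<Sum>\<gamma><n. col_of la \<gamma> * (p + q))"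
proof -
  assume I: "I \<in> seqs p q n"
  have "I ! \<gamma> \<le> p + q" if "\<gamma> < n" for \<gamma>
  proof -
    have "I ! \<gamma> \<in> set I" using I that by (simp add: seqs_def)
    thus ?thesis using I by (auto simp: seqs_def)
  qed
  thus ?thesis using I by (auto simp: wt_def seqs_def intro!: sum_mono)
qed

text \<open>Induction upwards in the column weight, well-founded by \<open>wt_bound\<close>. Sorting
  the columns first keeps this weight and changes the vector only by a sign. A column repeating an
  even letter then gives a vector equal to its negative; any other failure is a violation in a
  row.\<close>

lemma young_vec_spanned:
  assumes part: "is_partition la" and "I \<in> seqs p q (sum_list la)"
  shows "young_vec p la I \<in> fn.span (young_vec p la ` {I. semistandard p q la I})"
  using assms(2)
proof (induction I rule: measure_induct_rule[where f = "\<lambda>I. (\<Sum>\<gamma><sum_list la. col_of la \<gamma> * (p + q)) - wt (col_of la) I"])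
  case (less I)
  let ?n = "sum_list la" and ?S = "young_vec p la ` {I. semistandard p q la I}"
  have lI: "length I = ?n" using less.prems by (simp add: seqs_def)
  obtain \<tau> where t: "\<tau> \<in> colgrp la" and cs: "colsorted la (pact (prm \<tau>) I)"
    using col_max_exists col_max_sorted[OF lI] by metis
  define J where "J = pact (prm \<tau>) I"
  have tS: "\<tau> \<in> symgrp ?n" using t colgrp_sub by blast
  have J: "J \<in> seqs p q ?n" unfolding J_def by (rule pact_seqs[OF tS less.prems])
  have lJ: "length J = ?n" using J by (simp add: seqs_def)
  have csJ: "colsorted la J" using cs by (simp add: J_def)
  have wJ: "wt (col_of la) J = wt (col_of la) I"
    unfolding J_def by (rule wt_invariant) (use tS t lI in \<open>auto simp: colgrp_def Ct_def\<close>)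
  have IH: "young_vec p la K \<in> fn.span ?S" if "K \<in> seqs p q ?n" "wt (col_of la) J < wt (col_of la) K" for K
  proof (rule less.IH[OF _ that(1)])
    show "(\<Sum>\<gamma><?n. col_of la \<gamma> * (p + q)) - wt (col_of la) K < (\<Sum>\<gamma><?n. col_of la \<gamma> * (p + q)) - wt (col_of la) I"
      using that(2) wJ wt_bound[OF that(1), of la] by linarith
  qed
  have "young_vec p la J \<in> fn.span ?S"
  proof (cases "\<exists>\<alpha><?n. \<exists>\<beta><?n. \<alpha> \<noteq> \<beta> \<and> col_of la \<alpha> = col_of la \<beta> \<and> J ! \<alpha> = J ! \<beta> \<and> \<not> oddi p (J ! \<alpha>)")
    case True
    then obtain \<alpha> \<beta> where ab: "\<alpha> < ?n" "\<beta> < ?n" "\<alpha> \<noteq> \<beta>" "col_of la \<alpha> = col_of la \<beta>" "J ! \<alpha> = J ! \<beta>" "\<not> oddi p (J ! \<alpha>)"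
      by blast
    have sw: "swp \<alpha> \<beta> \<in> colgrp la" using ab by (intro swp_colgrp) auto
    have fixJ: "pact (prm (swp \<alpha> \<beta>)) J = J"
      by (rule nth_equalityI) (auto simp: nth_pact prm_swp Transposition.transpose_def ab(5))
    have "csign p J (inv (prm (swp \<alpha> \<beta>))) = 1"
      by (rule csign_fixed_odd[OF lJ fixJ]) (use ab in \<open>auto simp: prm_swp Transposition.transpose_def\<close>)
    hence "young_vec p la J = smul (- 1) (young_vec p la J)"
      using young_vec_col[OF sw lJ, of p] fixJ sg_swp[OF ab(3)] by simp
    hence "young_vec p la J = 0" by (rule smul_neg_self)
    thus ?thesis by (simp add: fn.span_zero)
  next
    case ncol: False
    show ?thesis
    proof (cases "semistandard p q la J")
      case True thus ?thesis by (intro fn.span_base) auto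
    next
      case False
      have col: "J ! \<alpha> \<le> J ! \<beta> \<and> (\<not> oddi p (J ! \<alpha>) \<longrightarrow> J ! \<alpha> < J ! \<beta>)"
        if "\<alpha> < ?n" "\<beta> < ?n" "col_of la \<alpha> = col_of la \<beta>" "row_of la \<alpha> < row_of la \<beta>" for \<alpha> \<beta>
        using csJ ncol that by (fastforce simp: colsorted_def le_less)
      then obtain \<alpha> \<beta> where ab: "\<alpha> < ?n" "\<beta> < ?n" "row_of la \<alpha> = row_of la \<beta>" "col_of la \<alpha> < col_of la \<beta>"
        "\<not> (J ! \<alpha> \<le> J ! \<beta> \<and> (oddi p (J ! \<alpha>) \<longrightarrow> J ! \<alpha> < J ! \<beta>))"
        using False J unfolding semistandard_def by blast
      show ?thesis
        by (rule young_vec_straighten[OF part J csJ ab(1-4) _ _ IH]) (use ab(5) in auto)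
    qed
  qed
  moreover have "young_vec p la I = smul (of_real (sg \<tau>) * csign p I (inv (prm \<tau>))) (young_vec p la J)"
  proof -
    have "smul (of_real (sg \<tau>)) (smul (csign p I (inv (prm \<tau>))) (young_vec p la J)) =
       smul (of_real (sg \<tau>)) (smul (of_real (sg \<tau>)) (young_vec p la I))"
      using young_vec_col[OF t lI, of p] by (simp add: J_def)
    also have "\<dots> = young_vec p la I" using sg_pm[of \<tau>] by auto
    finally show ?thesis by simp
  qed
  ultimately show ?case by (metis fn.span_scale)
qed

lemma Wlam_semistandard:
  assumes "is_partition la"
  shows "Wlam p q la = fn.span (young_vec p la ` {I. semistandard p q la I})"
  unfolding Wlam_def
proof (rule antisym)
  show "fn.span (young_vec p la ` seqs p q (sum_list la)) \<subseteq> fn.span (young_vec p la ` {I. semistandard p q la I})"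
    by (rule fn.span_minimal) (use young_vec_spanned[OF assms] in auto)
  show "fn.span (young_vec p la ` {I. semistandard p q la I}) \<subseteq> fn.span (young_vec p la ` seqs p q (sum_list la))"
    by (rule fn.span_mono) (auto simp: semistandard_def)
qed

section \<open>The decomposition\<close>

lemma even_partitionsD: "la \<in> even_partitions (2 * k) \<Longrightarrow> sum_list la = 2 * k" "la \<in> even_partitions n \<Longrightarrow> is_partition la"
  by (auto simp: even_partitions_def)

lemma Wlam_eq_yact: "Wlam p q la = yact p la ` tens p q (sum_list la)"
proof
  let ?T = "tens p q (sum_list la)"
  interpret L: Vector_Spaces.linear smul smul "yact p la" by (rule act_linear)
  show "Wlam p q la \<subseteq> yact p la ` ?T"
    unfolding Wlam_def
  proof (rule fn.span_minimal)
    show "young_vec p la ` seqs p q (sum_list la) \<subseteq> yact p la ` ?T"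
    proof
      fix f assume "f \<in> young_vec p la ` seqs p q (sum_list la)"
      then obtain I where I: "I \<in> seqs p q (sum_list la)" "f = young_vec p la I" by auto
      have "f = yact p la (delta I)" using I young_vec_act[of I la p] by (simp add: seqs_def)
      thus "f \<in> yact p la ` ?T" using tens_delta[OF I(1)] by (rule image_eqI)
    qed
    show "fn.subspace (yact p la ` ?T)" by (rule L.subspace_image[OF subspace_tens])
  qed
  show "yact p la ` ?T \<subseteq> Wlam p q la"
  proof
    fix f assume "f \<in> yact p la ` ?T"
    then obtain v where v: "v \<in> ?T" "f = yact p la v" by auto
    have "f = yact p la (\<Sum>I\<in>seqs p q (sum_list la). smul (v I) (delta I))"
      using tens_expand[OF v(1)] v(2) by simp
    also have "\<dots> = (\<Sum>I\<in>seqs p q (sum_list la). smul (v I) (yact p la (delta I)))"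
      by (simp only: L.sum L.scale)
    also have "\<dots> = (\<Sum>I\<in>seqs p q (sum_list la). smul (v I) (young_vec p la I))"
      by (rule sum.cong) (auto simp: young_vec_act seqs_def)
    also have "\<dots> \<in> Wlam p q la"
      unfolding Wlam_def by (intro fn.span_sum fn.span_scale fn.span_base) auto
    finally show "f \<in> Wlam p q la" .
  qed
qed

lemma Wlam_tens: "w \<in> Wlam p q la \<Longrightarrow> w \<in> tens p q (sum_list la)"
  using act_tens by (auto simp: Wlam_eq_yact)

lemma Wlam_Tact:
  assumes "w \<in> Wlam p q la" "a < p + q" "b < p + q" shows "Tact p a b w \<in> Wlam p q la"
  using assms Tact_tens by (force simp: Wlam_eq_yact simp flip: act_Tact)

lemma subspace_Wlam: "fn.subspace (Wlam p q la)"
  by (simp add: Wlam_def)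

text \<open>On \<open>Wlam\<close> the row sum inverts averaging over H up to a nonzero scalar; this
  is what makes the projection injective there.\<close>

lemma row_hyp_Wlam:
  assumes la: "la \<in> even_partitions (2 * k)"
  obtains \<mu> where "\<mu> \<noteq> 0"
    "\<And>w. w \<in> Wlam p q la \<Longrightarrow> act p (2 * k) (rowsym la) (act p (2 * k) (hypsum k) w) = smul \<mu> w"
proof -
  note n = even_partitionsD(1)[OF la]
  obtain \<mu> where mu: "\<mu> \<noteq> 0" "rowsym la * hypsum k * rowsym la * colalt la = scal \<mu> * (rowsym la * colalt la)"
    using row_hyp_row_col[OF la] by blast
  have ks: "supp (rowsym la) \<subseteq> symgrp (2 * k)" "supp (rowsym la * colalt la) \<subseteq> symgrp (2 * k)"
    "supp (hypsum k * (rowsym la * colalt la)) \<subseteq> symgrp (2 * k)"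
    using keys_basic(1)[of la] keys_row_col[of la] keys_mult_symgrp[OF keys_basic(3)] n by auto
  have "act p (2 * k) (rowsym la) (act p (2 * k) (hypsum k) w) = smul (of_real \<mu>) w" if w: "w \<in> Wlam p q la" for w
  proof -
    obtain v where v: "w = act p (2 * k) (rowsym la * colalt la) v" using w n by (auto simp: Wlam_eq_yact)
    have "act p (2 * k) (rowsym la) (act p (2 * k) (hypsum k) w) = act p (2 * k) (rowsym la * (hypsum k * (rowsym la * colalt la))) v"
      by (simp only: v act_mult[OF keys_basic(3) ks(2)] act_mult[OF ks(1) ks(3)])
    also have "rowsym la * (hypsum k * (rowsym la * colalt la)) = scal \<mu> * (rowsym la * colalt la)"
      using mu(2) by (simp add: mult.assoc)
    finally show ?thesis by (simp only: act_scal v)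
  qed
  thus ?thesis using that[of "of_real \<mu>"] mu(1) by simp
qed

lemma proj_Wlam_zero:
  assumes la: "la \<in> even_partitions (2 * k)" and w: "w \<in> Wlam p q la" and zero: "proj p q k w = 0"
  shows "w = 0"
proof -
  obtain \<mu> where mu: "\<mu> \<noteq> 0" "act p (2 * k) (rowsym la) (act p (2 * k) (hypsum k) w) = smul \<mu> w"
    using row_hyp_Wlam[OF la] w by metis
  have "act p (2 * k) (hypsum k) w = sect p q k 0"
    using sect_proj[of w p q k] Wlam_tens[OF w] even_partitionsD(1)[OF la] zero by simp
  also have "\<dots> = 0" by (simp add: sect_def)
  finally have "smul \<mu> w = 0" using mu(2) act_0 by metis
  thus ?thesis using mu(1) by (simp only: fn.scale_eq_0_iff) simp
qed

lemma inj_on_proj_Wlam: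
  assumes la: "la \<in> even_partitions (2 * k)" shows "inj_on (proj p q k) (Wlam p q la)"
proof (rule inj_onI)
  interpret L: Vector_Spaces.linear smul smul "proj p q k" by (rule proj_linear)
  fix w w' assume w: "w \<in> Wlam p q la" "w' \<in> Wlam p q la" "proj p q k w = proj p q k w'"
  have "w - w' = 0"
  proof (rule proj_Wlam_zero[OF la])
    show "w - w' \<in> Wlam p q la" by (rule fn.subspace_diff[OF subspace_Wlam w(1,2)])
    show "proj p q k (w - w') = 0" by (simp only: L.diff w(3)) simp
  qed
  thus "w = w'" by simp
qed

text \<open>The triangular argument of \<open>zonal_independent\<close> for vectors: the average of
  the sum over H vanishes, and the row sum of the least shape isolates its own term.\<close>

lemma proj_Wlam_direct:
  assumes w: "\<And>la. la \<in> even_partitions (2 * k) \<Longrightarrow> w la \<in> Wlam p q la"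
    and zero: "proj p q k (\<Sum>la\<in>even_partitions (2 * k). w la) = 0" and la: "la \<in> even_partitions (2 * k)"
  shows "w la = 0"
proof (rule ccontr)
  let ?P = "even_partitions (2 * k)" and ?act = "act p (2 * k)"
  let ?N = "{la \<in> ?P. w la \<noteq> 0}"
  assume "w la \<noteq> 0"
  hence "la \<in> ?N" using la by simp
  from ex_has_least_nat[of "\<lambda>la. la \<in> ?N", OF this]
  obtain nu where nu: "nu \<in> ?N" "\<And>la. la \<in> ?N \<Longrightarrow> total_colsum nu \<le> total_colsum la" by blast
  hence nuP: "nu \<in> ?P" "w nu \<noteq> 0" by auto
  have wt: "w la \<in> tens p q (2 * k)" if "la \<in> ?P" for la
    using Wlam_tens[OF w[OF that]] even_partitionsD(1)[OF that] by simp
  obtain \<mu> where mu: "\<mu> \<noteq> 0" "?act (rowsym nu) (?act (hypsum k) (w nu)) = smul \<mu> (w nu)"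
    using row_hyp_Wlam[OF nuP(1)] w[OF nuP(1)] by metis
  have off: "?act (rowsym nu) (?act (hypsum k) (w la)) = 0" if la: "la \<in> ?P" "la \<noteq> nu" for la
  proof (cases "w la = 0")
    case True thus ?thesis by (simp only: act_0)
  next
    case False
    note n = even_partitionsD(1)[OF la(1)] even_partitionsD(1)[OF nuP(1)]
    obtain v where v: "w la = ?act (rowsym la * colalt la) v" using w[OF la(1)] n by (auto simp: Wlam_eq_yact)
    have ks: "supp (rowsym nu) \<subseteq> symgrp (2 * k)" "supp (rowsym la * colalt la) \<subseteq> symgrp (2 * k)"
      "supp (hypsum k * (rowsym la * colalt la)) \<subseteq> symgrp (2 * k)"
      using keys_basic(1)[of nu] keys_row_col[of la] keys_mult_symgrp[OF keys_basic(3)] n by auto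
    have "rowsym nu * (hypsum k * rowsym la) * colalt la = 0"
    proof (rule row_col_vanish_order)
      show "supp (hypsum k * rowsym la) \<subseteq> symgrp (sum_list la)"
        using keys_mult_symgrp[OF keys_basic(3), of "rowsym la" k] keys_basic(1)[of la] n by simp
      show "total_colsum nu \<le> total_colsum la" using nu(2)[of la] la(1) False by simp
    qed (use la nuP n even_partitionsD(2) in auto)
    hence "rowsym nu * (hypsum k * (rowsym la * colalt la)) = 0" by (simp add: mult.assoc)
    moreover have "?act (rowsym nu) (?act (hypsum k) (w la)) = ?act (rowsym nu * (hypsum k * (rowsym la * colalt la))) v"
      by (simp only: v act_mult[OF keys_basic(3) ks(2)] act_mult[OF ks(1) ks(3)])
    ultimately show ?thesis by (simp only: act_zero_left)
  qed
  have sumt: "(\<Sum>la\<in>?P. w la) \<in> tens p q (2 * k)" using wt by (intro fn.subspace_sum[OF subspace_tens])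
  have "?act (hypsum k) (\<Sum>la\<in>?P. w la) = sect p q k 0" using sect_proj[OF sumt] zero by simp
  also have "\<dots> = 0" by (simp add: sect_def)
  finally have hz: "?act (hypsum k) (\<Sum>la\<in>?P. w la) = 0" .
  have "(\<Sum>la\<in>?P. ?act (rowsym nu) (?act (hypsum k) (w la))) = ?act (rowsym nu) (?act (hypsum k) (\<Sum>la\<in>?P. w la))"
    by (simp only: act_sum)
  also have "\<dots> = 0" by (simp only: hz act_0)
  finally have "(\<Sum>la\<in>?P. ?act (rowsym nu) (?act (hypsum k) (w la))) = 0" .
  moreover have "(\<Sum>la\<in>?P. ?act (rowsym nu) (?act (hypsum k) (w la))) = (\<Sum>la\<in>{nu}. ?act (rowsym nu) (?act (hypsum k) (w la)))"
    by (rule sum.mono_neutral_right) (use finite_even_partitions nuP off in auto)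
  ultimately have "smul \<mu> (w nu) = 0" using mu(2) by simp
  thus False using mu(1) nuP(2) by (simp only: fn.scale_eq_0_iff) simp
qed

lemma proj_Sk: "proj p q k f \<in> Sk p q k"
  unfolding proj_def Sk_def by (intro fn.span_sum fn.span_scale fn.span_base) auto

lemma Sk_eq: "Sk p q k = proj p q k ` tens p q (2 * k)"
proof
  interpret L: Vector_Spaces.linear smul smul "proj p q k" by (rule proj_linear)
  show "Sk p q k \<subseteq> proj p q k ` tens p q (2 * k)"
    unfolding Sk_def
  proof (rule fn.span_minimal)
    show "Xmon p ` seqs p q (2 * k) \<subseteq> proj p q k ` tens p q (2 * k)"
      using proj_delta tens_delta by (metis (no_types, lifting) image_eqI image_subsetI)
    show "fn.subspace (proj p q k ` tens p q (2 * k))" by (rule L.subspace_image[OF subspace_tens])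
  qed
qed (use proj_Sk in auto)

text \<open>Since |H| times the projection of \<open>f\<close> is the projection of e f, the
  decomposition of e applies. Its terms are e applied to multiples of a b (a e f), which lie in
  \<open>Wlam\<close>; these are the witnesses \<open>w\<close>.\<close>

lemma Sk_decomposition:
  assumes "x \<in> Sk p q k"
  obtains w where "\<And>la. la \<in> even_partitions (2 * k) \<Longrightarrow> w la \<in> Wlam p q la"
    "x = (\<Sum>la\<in>even_partitions (2 * k). proj p q k (w la))"
proof -
  let ?P = "even_partitions (2 * k)" and ?act = "act p (2 * k)" and ?c = "of_nat (card (hypgrp k)) :: complex"
  obtain f where f: "f \<in> tens p q (2 * k)" "x = proj p q k f" using assms Sk_eq by auto
  obtain c where c: "hypsum k = (\<Sum>la\<in>?P. scal (c la) * zonal k la)" using hypsum_decomposition by blast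
  define v where "v la = ?act (rowsym la * hypsum k) f" for la
  define w where "w la = smul (of_real (c la)) (?act (rowsym la * colalt la) (v la))" for la
  have vt: "v la \<in> tens p q (2 * k)" for la unfolding v_def by (rule act_tens[OF f(1)])
  have W: "w la \<in> Wlam p q la" if "la \<in> ?P" for la
  proof -
    have "?act (rowsym la * colalt la) (v la) \<in> Wlam p q la"
      using vt even_partitionsD(1)[OF that] by (auto simp: Wlam_eq_yact)
    thus ?thesis unfolding w_def by (rule fn.subspace_scale[OF subspace_Wlam])
  qed
  have trm: "proj p q k (?act (scal (c la) * zonal k la) f) = smul ?c (proj p q k (w la))" if la: "la \<in> ?P" for la
  proof -
    note n = even_partitionsD(1)[OF la]
    have ks: "supp (rowsym la) \<subseteq> symgrp (2 * k)" "supp (rowsym la * colalt la) \<subseteq> symgrp (2 * k)"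
      using keys_basic(1)[of la] keys_row_col[of la] n by auto
    have k2: "supp (rowsym la * hypsum k) \<subseteq> symgrp (2 * k)"
      by (rule keys_mult_symgrp[OF ks(1) keys_basic(3)])
    have k3: "supp (rowsym la * colalt la * (rowsym la * hypsum k)) \<subseteq> symgrp (2 * k)"
      by (rule keys_mult_symgrp[OF ks(2) k2])
    have z: "zonal k la = hypsum k * (rowsym la * colalt la * (rowsym la * hypsum k))"
      by (simp add: zonal_def mult.assoc)
    have "?act (zonal k la) f = ?act (hypsum k) (?act (rowsym la * colalt la) (v la))"
      by (simp only: z act_mult[OF keys_basic(3) k3] act_mult[OF ks(2) k2] v_def)
    thus ?thesis by (simp add: act_scal w_def proj_smul proj_hypsum mult.commute[of _ ?c])
  qed
  have "smul ?c x = proj p q k (?act (hypsum k) f)" by (simp add: proj_hypsum f(2))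
  also have "\<dots> = (\<Sum>la\<in>?P. proj p q k (?act (scal (c la) * zonal k la) f))"
    by (subst c) (simp only: act_sum_left proj_sum)
  also have "\<dots> = (\<Sum>la\<in>?P. smul ?c (proj p q k (w la)))" by (rule sum.cong[OF refl trm])
  also have "\<dots> = smul ?c (\<Sum>la\<in>?P. proj p q k (w la))" by (simp only: fn.scale_sum_right)
  finally have "smul ?c x = smul ?c (\<Sum>la\<in>?P. proj p q k (w la))" .
  moreover have "?c \<noteq> 0" using hypgrp.card_pos[of k] by simp
  ultimately have "x = (\<Sum>la\<in>?P. proj p q k (w la))" by (simp only: fn.scale_cancel_left) simp
  thus ?thesis using that W by blast
qed

section \<open>Pfaffian bases and the module structure of the summands\<close>

lemma Pf_proj:
  assumes n: "sum_list la = 2 * k" and I: "I \<in> seqs p q (2 * k)"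
  shows "Pf p la I = proj p q k (young_vec p la I)"
proof -
  have "pact (\<sigma> \<circ> \<tau>) I \<in> seqs p q (2 * k)" if "\<sigma> \<in> Rt la" "\<tau> \<in> Ct la" for \<sigma> \<tau>
  proof -
    have st: "\<sigma> \<circ> \<tau> permutes {..<2 * k}" using that n by (auto simp: Rt_def Ct_def intro: permutes_compose)
    from pact_seqs[of "Natperm (\<sigma> \<circ> \<tau>)", OF _ I] show ?thesis by (simp add: prm_Natperm[OF st] symgrp_def st)
  qed
  thus ?thesis unfolding Pf_def young_vec_def proj_sum proj_smul
    by (intro sum.cong refl) (simp add: proj_delta)
qed

text \<open>The projection is injective on \<open>Wlam\<close> and sends
  \<open>young_vec p la I\<close> to \<open>Pf p la I\<close>, so it transports the semistandard
  basis.\<close>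

lemma Pf_basis:
  assumes la: "la \<in> even_partitions (2 * k)"
  shows "inj_on (Pf p la) {I. semistandard p q la I}"
    and "fn.independent (Pf p la ` {I. semistandard p q la I})"
    and "fn.span (Pf p la ` {I. semistandard p q la I}) = proj p q k ` Wlam p q la"
proof -
  let ?S = "{I. semistandard p q la I}"
  note n = even_partitionsD[OF la]
  interpret L: Vector_Spaces.linear smul smul "proj p q k" by (rule proj_linear)
  have Pf: "Pf p la I = proj p q k (young_vec p la I)" if "I \<in> ?S" for I
    using Pf_proj[OF n(1)] that n(1) by (simp add: semistandard_def)
  have ind: "\<forall>I\<in>?S. c I = 0" if z: "(\<Sum>I\<in>?S. smul (c I) (Pf p la I)) = 0" for c
  proof (rule young_vec_independent, rule proj_Wlam_zero[OF la])
    have "proj p q k (\<Sum>I\<in>?S. smul (c I) (young_vec p la I)) = (\<Sum>I\<in>?S. smul (c I) (proj p q k (young_vec p la I)))"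
      by (simp only: L.sum L.scale)
    also have "\<dots> = (\<Sum>I\<in>?S. smul (c I) (Pf p la I))" by (rule sum.cong) (simp_all add: Pf)
    finally show "proj p q k (\<Sum>I\<in>?S. smul (c I) (young_vec p la I)) = 0" using z by simp
    show "(\<Sum>I\<in>?S. smul (c I) (young_vec p la I)) \<in> Wlam p q la"
      unfolding Wlam_def by (intro fn.span_sum fn.span_scale fn.span_base) (auto simp: semistandard_def)
  qed
  show "inj_on (Pf p la) ?S" "fn.independent (Pf p la ` ?S)"
    using fn.family_independent[OF finite_semistandard ind] by blast+
  have "Pf p la ` ?S = proj p q k ` (young_vec p la ` ?S)"
    unfolding image_image by (rule image_cong[OF refl Pf])
  thus "fn.span (Pf p la ` ?S) = proj p q k ` Wlam p q la"
    by (simp only: L.span_image Wlam_semistandard[OF n(2)])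
qed

lemma proj_Wlam_submodule:
  assumes la: "la \<in> even_partitions (2 * k)"
  shows "gl_submodule (p + q) (Pact p) (proj p q k ` Wlam p q la)"
proof -
  interpret L: Vector_Spaces.linear smul smul "proj p q k" by (rule proj_linear)
  have "Pact p a b (proj p q k w) \<in> proj p q k ` Wlam p q la" if "w \<in> Wlam p q la" "a < p + q" "b < p + q" for a b w
    using Pact_proj[of w p q k a b] Wlam_tens[OF that(1)] Wlam_Tact[OF that] that even_partitionsD(1)[OF la] by auto
  thus ?thesis unfolding gl_submodule_def using L.subspace_image[OF subspace_Wlam] by auto
qed

lemma proj_Wlam_iso:
  assumes la: "la \<in> even_partitions (2 * k)"
  shows "gl_iso (p + q) (Pact p) (proj p q k ` Wlam p q la) (Tact p) (Wlam p q la)"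
proof -
  let ?W = "Wlam p q la" and ?\<phi> = "inv_into (Wlam p q la) (proj p q k)"
  have inj: "inj_on (proj p q k) ?W" by (rule inj_on_proj_Wlam[OF la])
  have \<phi>: "?\<phi> (proj p q k w) = w" if "w \<in> ?W" for w using inv_into_f_f[OF inj that] .
  have "bij_betw ?\<phi> (proj p q k ` ?W) ?W" by (rule inj_on_imp_bij_betw[OF inj, THEN bij_betw_inv_into])
  moreover have "?\<phi> (proj p q k v + proj p q k w) = ?\<phi> (proj p q k v) + ?\<phi> (proj p q k w)" if "v \<in> ?W" "w \<in> ?W" for v w
    using that \<phi> fn.subspace_add[OF subspace_Wlam that] by (simp flip: proj_add)
  moreover have "?\<phi> (smul c (proj p q k w)) = smul c (?\<phi> (proj p q k w))" if "w \<in> ?W" for c w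
    using that \<phi> fn.subspace_scale[OF subspace_Wlam that] by (simp flip: proj_smul)
  moreover have "?\<phi> (Pact p a b (proj p q k w)) = Tact p a b (?\<phi> (proj p q k w))" if "w \<in> ?W" "a < p + q" "b < p + q" for a b w
    using that \<phi> Wlam_Tact[OF that] Pact_proj[of w p q k a b] Wlam_tens[OF that(1)] even_partitionsD(1)[OF la] by simp
  ultimately show ?thesis unfolding gl_iso_def by (intro exI[of _ ?\<phi>]) blast
qed

theorem theorem4p4:
  fixes p q :: nat
  shows "\<forall>k. \<exists>U :: nat list \<Rightarrow> ((nat \<times> nat) multiset \<Rightarrow> complex) set.
    (\<forall>la\<in>even_partitions (2*k).
        U la \<subseteq> Sk p q k \<and> gl_submodule (p+q) (Pact p) (U la)
      \<and> gl_iso (p+q) (Pact p) (U la) (Tact p) (Wlam p q la))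
    \<and> Sk p q k = {(\<Sum>la\<in>even_partitions (2*k). u la) | u. \<forall>la\<in>even_partitions (2*k). u la \<in> U la}
    \<and> (\<forall>u. (\<forall>la\<in>even_partitions (2*k). u la \<in> U la) \<and> (\<Sum>la\<in>even_partitions (2*k). u la) = 0
           \<longrightarrow> (\<forall>la\<in>even_partitions (2*k). u la = 0))
    \<and> (\<forall>la\<in>even_partitions (2*k).
        inj_on (Pf p la) {I. semistandard p q la I}
      \<and> module.independent smul (Pf p la ` {I. semistandard p q la I})
      \<and> module.span smul (Pf p la ` {I. semistandard p q la I}) = U la)"
proof (rule allI, rule exI)
  fix k
  let ?P = "even_partitions (2*k)"
  \<comment> \<open>One copy of \<open>Wlam\<close> per shape; multiplicity one is the directness of
    the sum of these images.\<close>
  let ?U = "\<lambda>la. proj p q k ` Wlam p q la"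
  have lift: "\<exists>w. \<forall>la\<in>?P. w la \<in> Wlam p q la \<and> u la = proj p q k (w la)" if "\<forall>la\<in>?P. u la \<in> ?U la" for u
    using that by (intro bchoice) auto
  have sub: "\<forall>la\<in>?P. ?U la \<subseteq> Sk p q k \<and> gl_submodule (p+q) (Pact p) (?U la) \<and> gl_iso (p+q) (Pact p) (?U la) (Tact p) (Wlam p q la)"
    using proj_Sk proj_Wlam_submodule proj_Wlam_iso by blast
  have dec: "Sk p q k = {(\<Sum>la\<in>?P. u la) | u. \<forall>la\<in>?P. u la \<in> ?U la}" (is "_ = ?R")
  proof (rule set_eqI, rule iffI)
    fix x assume "x \<in> Sk p q k"
    then obtain w where "\<And>la. la \<in> ?P \<Longrightarrow> w la \<in> Wlam p q la" "x = (\<Sum>la\<in>?P. proj p q k (w la))"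
      using Sk_decomposition by blast
    thus "x \<in> ?R" by (intro CollectI exI[of _ "\<lambda>la. proj p q k (w la)"]) auto
  next
    fix x assume "x \<in> ?R"
    then obtain u where u: "x = (\<Sum>la\<in>?P. u la)" "\<forall>la\<in>?P. u la \<in> ?U la" by blast
    have "u la \<in> Sk p q k" if "la \<in> ?P" for la using u(2) that proj_Sk by auto
    thus "x \<in> Sk p q k" unfolding u(1) Sk_def by (rule fn.span_sum)
  qed
  have dir: "\<forall>u. (\<forall>la\<in>?P. u la \<in> ?U la) \<and> (\<Sum>la\<in>?P. u la) = 0 \<longrightarrow> (\<forall>la\<in>?P. u la = 0)"
  proof (intro allI impI ballI, elim conjE)
    fix u la assume u: "\<forall>la\<in>?P. u la \<in> ?U la" "(\<Sum>la\<in>?P. u la) = 0" and la: "la \<in> ?P"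
    obtain w where w: "\<forall>la\<in>?P. w la \<in> Wlam p q la \<and> u la = proj p q k (w la)" using lift[OF u(1)] by blast
    have "proj p q k (\<Sum>la\<in>?P. w la) = (\<Sum>la\<in>?P. u la)"
      unfolding proj_sum by (rule sum.cong) (use w in auto)
    hence "w la = 0" using proj_Wlam_direct[of k w p q la] w u(2) la by simp
    thus "u la = 0" using w la proj_0 by metis
  qed
  have bas: "\<forall>la\<in>?P. inj_on (Pf p la) {I. semistandard p q la I}
      \<and> module.independent smul (Pf p la ` {I. semistandard p q la I})
      \<and> module.span smul (Pf p la ` {I. semistandard p q la I}) = ?U la"
    using Pf_basis by blast
  show "(\<forall>la\<in>?P. ?U la \<subseteq> Sk p q k \<and> gl_submodule (p+q) (Pact p) (?U la) \<and> gl_iso (p+q) (Pact p) (?U la) (Tact p) (Wlam p q la))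
    \<and> Sk p q k = {(\<Sum>la\<in>?P. u la) | u. \<forall>la\<in>?P. u la \<in> ?U la}
    \<and> (\<forall>u. (\<forall>la\<in>?P. u la \<in> ?U la) \<and> (\<Sum>la\<in>?P. u la) = 0 \<longrightarrow> (\<forall>la\<in>?P. u la = 0))
    \<and> (\<forall>la\<in>?P. inj_on (Pf p la) {I. semistandard p q la I}
      \<and> module.independent smul (Pf p la ` {I. semistandard p q la I})
      \<and> module.span smul (Pf p la ` {I. semistandard p q la I}) = ?U la)"
    by (rule conjI[OF sub conjI[OF dec conjI[OF dir bas]]])
qed

end
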